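(* Let $F$ be a tract, $\Gamma$ an ordered abelian group, $M$ a (weak or strong) $F[\Gamma]$-matroid on a finite totally ordered set $E$, and $\mathbf u\in(\Gamma\cup\{\infty\})^E$. Then $$(M^{\mathbf u})^*=(M^*\setminus Z_{\mathbf u})^{-\mathbf u^\circ}+_{\ell}Z_{\mathbf u}.$$ If $\mathbf u\in\Gamma^E$, then $(M^{\mathbf u})^*=(M^* )^{-\mathbf u}$.
   Context: Tracts. A tract $F=(F^\times,N_F)$ is a multiplicative abelian group $F^\times$ (identity $1$) together with a subset $N_F$ (the null set) of the group semiring $\mathbb N[F^\times]$ of finite formal sums such that: $0\in N_F$; $1\notin N_F$; there is a unique element $-1\in F^\times$ with $1+(-1)\in N_F$; and if $\sum a_i\in N_F$ then $\sum c a_i\in N_F$ for all $c\in F^\times$. We also write $F=F^\times\cup\{0\}$ with $0\cdot g=0$; zero terms of formal sums are dropped. A homomorphism of tracts is a group homomorphism $F_1^\times\to F_2^\times$ whose induced map on formal sums sends $N_{F_1}$ into $N_{F_2}$. Every tract carries a fixed involution $a\mapsto\overline a$ (a tract homomorphism $F\to F$ squaring to the identity); on $F[\Gamma]$ (below) it is $\overline{(a,\gamma)}=(\overline a,\gamma)$. Tropical extension. $\Gamma$ is a (totally) ordered abelian group, written additively; $\infty$ is larger than every element of $\Gamma$ and absorbing. $F[\Gamma]$ is the tract with group $F^\times\times\Gamma$, zero element $\infty$, and null set consisting of the zero sum and all finite sums $\sum_{i\in I}(a_i,\gamma_i)$ with $\sum_{i\in I_{\min}}a_i\in N_F$, where $I_{\min}=\{i\in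 I:\gamma_i\le\gamma_j\ \forall j\in I\}$. Put $\theta(a,\gamma)=a$, $\theta(\infty)=0$, $|(a,\gamma)|=\gamma$, $|\infty|=\infty$. Matroids. Let $0\le r\le|E|$. A strong Plücker vector of rank $r$ on $E$ is a nonzero function $P\colon\binom Er\to F$ with $\sum_{j\in J\setminus I}\operatorname{sign}(j;I,J)P(I+j)P(J-j)\in N_F$ for all $I\in\binom{E}{r-1}$, $J\in\binom{E}{r+1}$, where $\operatorname{sign}(j;I,J)=(-1)^\ell$, $\ell=\#\{j'\in J:j<j'\}+\#\{i\in I:j<i\}$. A weak Plücker vector is a nonzero function whose support is the set of bases of a matroid and which satisfies these relations whenever $|J\setminus I|=3$. A weak (resp. strong) $F$-matroid is an equivalence class of weak (resp. strong) Plücker vectors under scaling by $F^\times$. The support of $X\in F^E$ is $\underline X=\{i:X_i\neq0\}$. For $\tau=\{i_0<\dots<i_r\}$ let $(C_\tau)_{i_s}=(-1)^sP(\tau-i_s)$, $0$ elsewhere; the circuits $\mathcal C(M)\subseteq F^E$ are the $F^\times$-multiples of the nonzero $C_\tau$. An $F$-matroid is determined by its set of circuits. The dual $M^*$ has Plücker vector $P^*(I)=\operatorname{sign}(I,I^c)\overline{P(I^c)}$, $I^c=E\setminus I$, where $\operatorname{sign}(I,I^c)$ is the sign of the permutation listing $I$ then $I^c$, each increasingly. Minors, loops and coloops. For $X\in F^E$, $A\subseteq E$, $X\setminus A\in F^{E\setminus A}$ is the restriction. $\operatorname{MinSupp}(\mathcal X)$ is the set of nonzero elements of $\mathcal X$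 of inclusion-minimal support. $M/A$ and $M\setminus A$ are the $F$-matroids on $E\setminus A$ with circuits $\operatorname{MinSupp}\{C\setminus A:C\in\mathcal C(M)\}$ and $\{C\setminus A:C\in\mathcal C(M),\underline C\cap A=\emptyset\}$ respectively. For $A$ disjoint from the ground set $E$ of $M$, with $0_A=(0,\dots,0)\in F^A$ and $\chi_i$ the tuple with $1$ in coordinate $i$ and $0$ elsewhere: $M+_{co\ell}A$ is the $F$-matroid on $E\sqcup A$ with circuits $\mathcal C(M)\times\{0_A\}$; $M+_\ell A$ is the $F$-matroid on $E\sqcup A$ with circuits $(\mathcal C(M)\times\{0_A\})\cup\{\alpha\chi_i:i\in A,\alpha\in F^\times\}$. Initial matroids. For $\mathbf u\in\Gamma^E$ and $M$ with Plücker vector $P\colon\binom Er\to F[\Gamma]$, $M^{\mathbf u}$ is the $F$-matroid with Plücker vector $P^{\mathbf u}(I)=\theta(P(I))$ if $|P(I)|-\sum_{i\in I}u_i\le|P(J)|-\sum_{j\in J}u_j$ for all $J\in\binom Er$, and $0$ otherwise. For $\mathbf u\in(\Gamma\cup\{\infty\})^E$ put $Z_{\mathbf u}=\{i:u_i=\infty\}$, $\mathbf u^\circ=\mathbf u\setminus Z_{\mathbf u}\in\Gamma^{E\setminus Z_{\mathbf u}}$, and $M^{\mathbf u}=(M/Z_{\mathbf u})^{\mathbf u^\circ}+_{co\ell}Z_{\mathbf u}$. *)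

theory Defs
  imports
    "HOL-Algebra.Group"
    "HOL-Combinatorics.Permutations"
    "HOL-Library.Multiset"
begin

section \<open>Tracts\<close>

text \<open>
  The carrier is the group of units. A finite formal sum of units, i.e. an element of the group
  semiring with natural number coefficients, is a multiset of units. The involution is part of
  the structure.
\<close>

record 'a tract_struct = "'a monoid" +
  null :: "'a multiset set"
  involution :: "'a \<Rightarrow> 'a"

definition tract_hom :: "'a tract_struct \<Rightarrow> 'b tract_struct \<Rightarrow> ('a \<Rightarrow> 'b) set" where
  "tract_hom F G = {h \<in> hom F G. \<forall>m \<in> null F. image_mset h m \<in> null G}"

locale tract = comm_group F for F :: "'a tract_struct" (structure) +
  assumes null_units: "m \<in> null F \<Longrightarrow> set_mset m \<subseteq> carrier F"
    and zero_null: "{#} \<in> null F"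
    and one_not_null: "{#\<one>#} \<notin> null F"
    and ex1_neg_one: "\<exists>!e. e \<in> carrier F \<and> {#\<one>, e#} \<in> null F"
    and scale_null: "c \<in> carrier F \<Longrightarrow> m \<in> null F \<Longrightarrow> image_mset (\<lambda>a. c \<otimes> a) m \<in> null F"
    and involution_hom: "involution F \<in> tract_hom F F"
    and involution_involution: "a \<in> carrier F \<Longrightarrow> involution F (involution F a) = a"

definition neg_one :: "'a tract_struct \<Rightarrow> 'a" where
  "neg_one F = (THE e. e \<in> carrier F \<and> {#\<one>\<^bsub>F\<^esub>, e#} \<in> null F)"

text \<open>The tract with its zero element is modelled by the option type, with zero \<open>None\<close>.\<close>

definition omult :: "'a tract_struct \<Rightarrow> 'a option \<Rightarrow> 'a option \<Rightarrow> 'a option" where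
  "omult F x y = (case (x, y) of (Some a, Some b) \<Rightarrow> Some (a \<otimes>\<^bsub>F\<^esub> b) | _ \<Rightarrow> None)"

definition signed :: "'a tract_struct \<Rightarrow> int \<Rightarrow> 'a option \<Rightarrow> 'a option" where
  "signed F s x = (if s = -1 then omult F (Some (neg_one F)) x else x)"

text \<open>The formal sum of \<open>f j\<close> over \<open>j \<in> J\<close>, zero terms being dropped.\<close>

definition formal_sum :: "('e \<Rightarrow> 'a option) \<Rightarrow> 'e set \<Rightarrow> 'a multiset" where
  "formal_sum f J = image_mset (\<lambda>j. the (f j)) (mset_set {j \<in> J. f j \<noteq> None})"


section \<open>Tropical extensions\<close>

datatype 'g ext = Fin (fin: 'g) | Infty

instantiation ext :: (linorder) linorder
begin

definition less_eq_ext :: "'a ext \<Rightarrow> 'a ext \<Rightarrow> bool" where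
  "x \<le> y = (case (x, y) of (_, Infty) \<Rightarrow> True | (Infty, Fin _) \<Rightarrow> False | (Fin a, Fin b) \<Rightarrow> a \<le> b)"

definition less_ext :: "'a ext \<Rightarrow> 'a ext \<Rightarrow> bool" where
  "(x :: 'a ext) < y = (x \<le> y \<and> \<not> y \<le> x)"

instance
  by standard (auto simp: less_eq_ext_def less_ext_def split: ext.splits)

end

primrec ext_minus :: "'g::ab_group_add ext \<Rightarrow> 'g \<Rightarrow> 'g ext" where
  "ext_minus (Fin a) b = Fin (a - b)"
| "ext_minus Infty b = Infty"

text \<open>The zero element \<open>\<infinity>\<close> of the tropical extension is again \<open>None\<close>.\<close>

definition trop :: "'a tract_struct \<Rightarrow> ('a \<times> 'g::linordered_ab_group_add) tract_struct" where
  "trop F =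
    \<lparr> carrier = carrier F \<times> UNIV,
      monoid.mult = (\<lambda>(a, g) (b, h). (a \<otimes>\<^bsub>F\<^esub> b, g + h)),
      one = (\<one>\<^bsub>F\<^esub>, 0),
      null = {m. set_mset m \<subseteq> carrier F \<times> UNIV \<and>
        (m = {#} \<or>
         image_mset fst (filter_mset (\<lambda>x. \<forall>y \<in># m. snd x \<le> snd y) m) \<in> null F)},
      involution = (\<lambda>(a, g). (involution F a, g)) \<rparr>"

definition theta :: "('a \<times> 'g) option \<Rightarrow> 'a option" where
  "theta = map_option fst"

definition val :: "('a \<times> 'g) option \<Rightarrow> 'g ext" where
  "val x = (case x of None \<Rightarrow> Infty | Some (a, g) \<Rightarrow> Fin g)"


section \<open>Matroids over tracts\<close>

definition matroid_bases :: "'e set \<Rightarrow> 'e set set \<Rightarrow> bool" where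
  "matroid_bases E \<B> \<longleftrightarrow> finite E \<and> \<B> \<subseteq> Pow E \<and> \<B> \<noteq> {} \<and>
    (\<forall>A \<in> \<B>. \<forall>B \<in> \<B>. \<forall>x \<in> A - B. \<exists>y \<in> B - A. insert y (A - {x}) \<in> \<B>)"

definition subsets :: "'e set \<Rightarrow> nat \<Rightarrow> 'e set set" where
  "subsets E r = {I. I \<subseteq> E \<and> card I = r}"

text \<open>
  A function on the \<open>r\<close>-element subsets of \<open>E\<close> is extended by zero to all sets, and likewise
  an element of \<open>F\<^sup>E\<close> is extended by zero to all indices; thus equality of functions is equality
  on their actual domains.
\<close>

definition nonzero_function ::
  "'a tract_struct \<Rightarrow> 'e set \<Rightarrow> nat \<Rightarrow> ('e set \<Rightarrow> 'a option) \<Rightarrow> bool" where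
  "nonzero_function F E r P \<longleftrightarrow>
    (\<forall>I. I \<notin> subsets E r \<longrightarrow> P I = None) \<and>
    (\<forall>I a. P I = Some a \<longrightarrow> a \<in> carrier F) \<and>
    (\<exists>I. P I \<noteq> None)"

definition plucker_relation ::
  "'a tract_struct \<Rightarrow> ('e::linorder set \<Rightarrow> 'a option) \<Rightarrow> 'e set \<Rightarrow> 'e set \<Rightarrow> bool" where
  "plucker_relation F P I J \<longleftrightarrow>
    formal_sum
      (\<lambda>j. signed F ((-1) ^ (card {j' \<in> J. j < j'} + card {i \<in> I. j < i}))
             (omult F (P (insert j I)) (P (J - {j}))))
      (J - I) \<in> null F"

datatype kind = Weak | Strong

text \<open>
  \<open>card I + 1 = r\<close> rather than \<open>card I = r - 1\<close>: for \<open>r = 0\<close> there is no such \<open>I\<close>.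
\<close>

fun plucker ::
  "kind \<Rightarrow> 'a tract_struct \<Rightarrow> 'e::linorder set \<Rightarrow> nat \<Rightarrow> ('e set \<Rightarrow> 'a option) \<Rightarrow> bool" where
  "plucker Strong F E r P \<longleftrightarrow>
     nonzero_function F E r P \<and>
     (\<forall>I J. I \<subseteq> E \<and> card I + 1 = r \<and> J \<in> subsets E (r + 1) \<longrightarrow> plucker_relation F P I J)"
| "plucker Weak F E r P \<longleftrightarrow>
     nonzero_function F E r P \<and>
     matroid_bases E {I. P I \<noteq> None} \<and>
     (\<forall>I J. I \<subseteq> E \<and> card I + 1 = r \<and> J \<in> subsets E (r + 1) \<and> card (J - I) = 3 \<longrightarrow>
        plucker_relation F P I J)"

definition scale :: "'a tract_struct \<Rightarrow> 'a \<Rightarrow> ('i \<Rightarrow> 'a option) \<Rightarrow> 'i \<Rightarrow> 'a option" where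
  "scale F c f = (\<lambda>i. omult F (Some c) (f i))"

text \<open>\<open>vectors\<close> is the scaling class of Pluecker vectors.\<close>

record ('e, 'a) fmatroid =
  ground :: "'e set"
  rank :: nat
  vectors :: "('e set \<Rightarrow> 'a option) set"

definition is_matroid :: "kind \<Rightarrow> 'a tract_struct \<Rightarrow> ('e::linorder, 'a) fmatroid \<Rightarrow> bool" where
  "is_matroid k F M \<longleftrightarrow>
    finite (ground M) \<and> rank M \<le> card (ground M) \<and>
    (\<exists>P. plucker k F (ground M) (rank M) P \<and> vectors M = {scale F c P |c. c \<in> carrier F})"

definition supp :: "('i \<Rightarrow> 'a option) \<Rightarrow> 'i set" where
  "supp X = {i. X i \<noteq> None}"

text \<open>For \<open>\<tau> = {i\<^sub>0 < \<dots> < i\<^sub>r}\<close>, the index \<open>s\<close> of \<open>i = i\<^sub>s\<close> is the number of smaller elements.\<close>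

definition circuit_vector ::
  "'a tract_struct \<Rightarrow> ('e::linorder set \<Rightarrow> 'a option) \<Rightarrow> 'e set \<Rightarrow> 'e \<Rightarrow> 'a option" where
  "circuit_vector F P \<tau> =
    (\<lambda>i. if i \<in> \<tau> then signed F ((-1) ^ card {t \<in> \<tau>. t < i}) (P (\<tau> - {i})) else None)"

definition circuits :: "'a tract_struct \<Rightarrow> ('e::linorder, 'a) fmatroid \<Rightarrow> ('e \<Rightarrow> 'a option) set" where
  "circuits F M =
    {scale F c (circuit_vector F P \<tau>) |c P \<tau>.
       c \<in> carrier F \<and> P \<in> vectors M \<and> \<tau> \<in> subsets (ground M) (rank M + 1) \<and>
       supp (circuit_vector F P \<tau>) \<noteq> {}}"

text \<open>
  The sign of the permutation of \<open>E\<close> that lists \<open>I\<close> and then \<open>E - I\<close>, each increasingly: it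
  sends the \<open>n\<close>-th smallest element of \<open>E\<close> to the \<open>n\<close>-th entry of the list.
\<close>

definition split_sign :: "'e::linorder set \<Rightarrow> 'e set \<Rightarrow> int" where
  "split_sign E I =
    sign (\<lambda>x. if x \<in> E
              then (sorted_list_of_set I @ sorted_list_of_set (E - I)) ! card {y \<in> E. y < x}
              else x)"

definition dual_vector ::
  "'a tract_struct \<Rightarrow> 'e::linorder set \<Rightarrow> ('e set \<Rightarrow> 'a option) \<Rightarrow> 'e set \<Rightarrow> 'a option" where
  "dual_vector F E P =
    (\<lambda>I. if I \<subseteq> E then signed F (split_sign E I) (map_option (involution F) (P (E - I))) else None)"

text \<open>Taking duals commutes with scaling up to the involution, so the image is a scaling class.\<close>

definition dual :: "'a tract_struct \<Rightarrow> ('e::linorder, 'a) fmatroid \<Rightarrow> ('e, 'a) fmatroid" where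
  "dual F M =
    \<lparr> ground = ground M,
      rank = card (ground M) - rank M,
      vectors = dual_vector F (ground M) ` vectors M \<rparr>"


section \<open>Minors, loops and coloops\<close>

definition matroid_with_circuits ::
  "kind \<Rightarrow> 'a tract_struct \<Rightarrow> 'e::linorder set \<Rightarrow> ('e \<Rightarrow> 'a option) set \<Rightarrow> ('e, 'a) fmatroid" where
  "matroid_with_circuits k F E \<C> =
    (THE N. is_matroid k F N \<and> ground N = E \<and> circuits F N = \<C>)"

definition delete_coords :: "('i \<Rightarrow> 'a option) \<Rightarrow> 'i set \<Rightarrow> 'i \<Rightarrow> 'a option" where
  "delete_coords X A = (\<lambda>i. if i \<in> A then None else X i)"

definition MinSupp :: "('i \<Rightarrow> 'a option) set \<Rightarrow> ('i \<Rightarrow> 'a option) set" where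
  "MinSupp \<X> = {X \<in> \<X>. supp X \<noteq> {} \<and> \<not> (\<exists>Y \<in> \<X>. supp Y \<noteq> {} \<and> supp Y \<subset> supp X)}"

definition contract ::
  "kind \<Rightarrow> 'a tract_struct \<Rightarrow> ('e::linorder, 'a) fmatroid \<Rightarrow> 'e set \<Rightarrow> ('e, 'a) fmatroid" where
  "contract k F M A = matroid_with_circuits k F (ground M - A)
     (MinSupp {delete_coords C A |C. C \<in> circuits F M})"

definition delete ::
  "kind \<Rightarrow> 'a tract_struct \<Rightarrow> ('e::linorder, 'a) fmatroid \<Rightarrow> 'e set \<Rightarrow> ('e, 'a) fmatroid" where
  "delete k F M A = matroid_with_circuits k F (ground M - A)
     {delete_coords C A |C. C \<in> circuits F M \<and> supp C \<inter> A = {}}"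

text \<open>
  In the next two definitions \<open>A\<close> is meant to be disjoint from the ground set. Vectors being
  extended by zero, appending the coordinates \<open>0\<^sub>A\<close> to a circuit does not change it.
\<close>

definition add_coloops ::
  "kind \<Rightarrow> 'a tract_struct \<Rightarrow> ('e::linorder, 'a) fmatroid \<Rightarrow> 'e set \<Rightarrow> ('e, 'a) fmatroid" where
  "add_coloops k F M A = matroid_with_circuits k F (ground M \<union> A) (circuits F M)"

definition add_loops ::
  "kind \<Rightarrow> 'a tract_struct \<Rightarrow> ('e::linorder, 'a) fmatroid \<Rightarrow> 'e set \<Rightarrow> ('e, 'a) fmatroid" where
  "add_loops k F M A = matroid_with_circuits k F (ground M \<union> A)
     (circuits F M \<union> {(\<lambda>j. if j = i then Some \<alpha> else None) |i \<alpha>. i \<in> A \<and> \<alpha> \<in> carrier F})"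


section \<open>Initial matroids\<close>

definition initial_vector ::
  "'e set \<Rightarrow> nat \<Rightarrow> ('e \<Rightarrow> 'g::linordered_ab_group_add) \<Rightarrow> ('e set \<Rightarrow> ('a \<times> 'g) option) \<Rightarrow>
    'e set \<Rightarrow> 'a option" where
  "initial_vector E r u P =
    (\<lambda>I. if I \<in> subsets E r \<and>
            (\<forall>J \<in> subsets E r.
               ext_minus (val (P I)) (\<Sum>i\<in>I. u i) \<le> ext_minus (val (P J)) (\<Sum>j\<in>J. u j))
         then theta (P I) else None)"

text \<open>As for duals, scaling \<open>P\<close> by \<open>(c, \<gamma>)\<close> scales its initial vector by \<open>c\<close>.\<close>

definition initial ::
  "('e, 'a \<times> 'g::linordered_ab_group_add) fmatroid \<Rightarrow> ('e \<Rightarrow> 'g) \<Rightarrow> ('e, 'a) fmatroid" where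
  "initial M u =
    \<lparr> ground = ground M,
      rank = rank M,
      vectors = initial_vector (ground M) (rank M) u ` vectors M \<rparr>"

definition inf_set :: "'e set \<Rightarrow> ('e \<Rightarrow> 'g ext) \<Rightarrow> 'e set" where
  "inf_set E u = {i \<in> E. u i = Infty}"

text \<open>
  The finite part of \<open>u\<close> is \<open>\<lambda>i. fin (u i)\<close>, of which only the values on
  \<open>E - inf_set E u\<close> are used.
\<close>

definition initial_ext ::
  "kind \<Rightarrow> 'a tract_struct \<Rightarrow> ('e::linorder, 'a \<times> 'g::linordered_ab_group_add) fmatroid \<Rightarrow>
    ('e \<Rightarrow> 'g ext) \<Rightarrow> ('e, 'a) fmatroid" where
  "initial_ext k F M u =
    (let Z = inf_set (ground M) u
     in add_coloops k F (initial (contract k (trop F) M Z) (\<lambda>i. fin (u i))) Z)"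

end

theory Submission
  imports Defs
begin

text \<open>
  Every operation is computed on Pluecker vectors. An \<open>F\<close>-matroid is determined by its circuits:
  the circuits determine the bases, and for adjacent bases \<open>\<tau> - x\<close>, \<open>\<tau> - y\<close> the circuit vector
  \<open>C\<^sub>\<tau>\<close> determines the ratio \<open>P (\<tau> - x) / P (\<tau> - y)\<close>. Let \<open>T\<close> be a basis of \<open>M\<close> with \<open>B = T \<inter> Z\<close> as
  large as possible. Then \<open>M / Z\<close> has the vector \<open>I \<mapsto> \<plusminus> P (I \<union> B)\<close>. The complement of \<open>T\<close> meets \<open>Z\<close>
  in \<open>Z - B\<close>, which is as small as possible for the dual, so \<open>M\<^sup>* \<setminus> Z\<close> has the vector
  \<open>I \<mapsto> \<plusminus> P\<^sup>* (I \<union> (Z - B))\<close>. Up to a global sign this is the dual of the former vector. On vectors,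
  taking initial forms commutes with duality, since \<open>\<Sum>\<^sub>E u\<close> is constant, and adding coloops
  corresponds under duality to extension by zero, which adds loops.

  Weak matroids need the additional fact that the bases of least twisted valuation form a matroid;
  it follows because the three-term relations imply the full valuated exchange property.
\<close>


section \<open>Crossing numbers and signs of permutations\<close>

text \<open>Minors and (co)loop extensions are definite descriptions by circuits, so each is
  evaluated by exhibiting one Pluecker vector with the required circuits and appealing to
  uniqueness. Uniqueness and proportionality are proved for weak vectors: every strong vector is
  weak, and the three-term relations suffice. A three-term relation compares only sets that are one
  exchange apart, and it yields an equation only when one of its products vanishes; such arguments
  therefore move along a path of single exchanges. All signs are powers of -1 whose exponents are
  values of \<open>crossings\<close>: for disjoint sets the number of inversions of the list
  \<open>A\<close> then \<open>B\<close>, for a singleton argument the number of elements above or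
  below a point. Sign identities thereby reduce to parities of sums of natural numbers, including
  those of the dual, whose sign is defined by a permutation. The value group is an arbitrary ordered
  abelian group, so the valuated exchange argument uses only differences of values and minima over
  finite sets.\<close>

definition crossings :: "'e::linorder set \<Rightarrow> 'e set \<Rightarrow> nat" where
  "crossings A B = card {(a, b). a \<in> A \<and> b \<in> B \<and> b < a}"

lemma crossings_finite:
  assumes "finite A" "finite B"
  shows "finite {(a, b). a \<in> A \<and> b \<in> B \<and> b < a}"
  by (rule finite_subset[of _ "A \<times> B"]) (use assms in auto)

lemma crossings_Un_left:
  assumes "finite A" "finite A'" "finite B" "A \<inter> A' = {}"
  shows "crossings (A \<union> A') B = crossings A B + crossings A' B"
proof -
  have "{(a, b). a \<in> A \<union> A' \<and> b \<in> B \<and> b < a} =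
      {(a, b). a \<in> A \<and> b \<in> B \<and> b < a} \<union> {(a, b). a \<in> A' \<and> b \<in> B \<and> b < a}"
    by auto
  then show ?thesis
    unfolding crossings_def using assms
    by (simp only:) (rule card_Un_disjoint, auto intro: crossings_finite)
qed

lemma crossings_Un_right:
  assumes "finite A" "finite B" "finite B'" "B \<inter> B' = {}"
  shows "crossings A (B \<union> B') = crossings A B + crossings A B'"
proof -
  have "{(a, b). a \<in> A \<and> b \<in> B \<union> B' \<and> b < a} =
      {(a, b). a \<in> A \<and> b \<in> B \<and> b < a} \<union> {(a, b). a \<in> A \<and> b \<in> B' \<and> b < a}"
    by auto
  then show ?thesis
    unfolding crossings_def using assms
    by (simp only:) (rule card_Un_disjoint, auto intro: crossings_finite)
qed

lemma crossings_insert_left: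
  assumes "finite A" "finite B" "a \<notin> A"
  shows "crossings (insert a A) B = crossings {a} B + crossings A B"
  using crossings_Un_left[of "{a}" A B] assms by simp

lemma crossings_insert_right:
  assumes "finite A" "finite B" "b \<notin> B"
  shows "crossings A (insert b B) = crossings A {b} + crossings A B"
  using crossings_Un_right[of A "{b}" B] assms by simp

lemma crossings_singleton_right: "crossings A {b} = card {a \<in> A. b < a}"
proof -
  have "{(a, b'). a \<in> A \<and> b' \<in> {b} \<and> b' < a} = (\<lambda>a. (a, b)) ` {a \<in> A. b < a}" by auto
  then show ?thesis unfolding crossings_def by (simp add: card_image inj_on_def)
qed

lemma crossings_singleton_left: "crossings {a} B = card {b \<in> B. b < a}"
proof -
  have "{(a', b). a' \<in> {a} \<and> b \<in> B \<and> b < a'} = Pair a ` {b \<in> B. b < a}" by auto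
  then show ?thesis unfolding crossings_def by (simp add: card_image inj_on_def)
qed

lemma crossings_empty [simp]: "crossings {} B = 0" "crossings A {} = 0"
  unfolding crossings_def by auto

lemma crossings_singleton [simp]: "crossings {a} {b} = (if b < a then 1 else 0)"
  unfolding crossings_singleton_left by (auto simp: card_eq_0_iff card_1_singleton_iff)

text \<open>Disjointness makes the two entries of each pair in \<open>A \<times> B\<close> strictly
  comparable, so the pair is counted in exactly one of the two summands. Interchanging two blocks in
  a sign thus costs a product of cardinalities.\<close>

lemma crossings_commute:
  assumes "finite A" "finite B" "A \<inter> B = {}"
  shows "crossings A B + crossings B A = card A * card B"
proof -
  have *: "crossings B A = card {(a, b). a \<in> A \<and> b \<in> B \<and> a < b}"
    unfolding crossings_def
    by (rule bij_betw_same_card[of prod.swap]) (auto simp: bij_betw_def inj_on_def image_def)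
  let ?S = "{(a, b). a \<in> A \<and> b \<in> B \<and> b < a}" and ?T = "{(a, b). a \<in> A \<and> b \<in> B \<and> a < b}"
  have "b < a \<or> a < b" if "a \<in> A" "b \<in> B" for a b
    using assms(3) that by (metis disjoint_iff linorder_neqE)
  then have eq: "A \<times> B = ?S \<union> ?T" by blast
  have "finite ?S" "finite ?T"
    by (rule finite_subset[OF _ finite_cartesian_product[OF assms(1,2)]], blast)+
  moreover have "?S \<inter> ?T = {}" by (auto dest: less_asym)
  ultimately have "card (A \<times> B) = card ?S + card ?T" unfolding eq by (rule card_Un_disjoint)
  then show ?thesis unfolding * by (simp add: crossings_def card_cartesian_product)
qed

section \<open>The sign of the permutation listing a set and then its complement\<close>

definition split_perm :: "'e::linorder set \<Rightarrow> 'e set \<Rightarrow> 'e \<Rightarrow> 'e" where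
  "split_perm E I x =
    (if x \<in> E
     then (sorted_list_of_set I @ sorted_list_of_set (E - I)) ! card {y \<in> E. y < x}
     else x)"

lemma sorted_list_of_set_nth_card:
  assumes "finite E" "x \<in> E"
  shows "sorted_list_of_set E ! card {y \<in> E. y < x} = x" "card {y \<in> E. y < x} < card E"
proof -
  show lt: "card {y \<in> E. y < x} < card E"
    by (rule psubset_card_mono) (use assms in auto)
  let ?l = "sorted_list_of_set E"
  obtain i where i: "i < length ?l" "?l ! i = x"
    using assms by (metis in_set_conv_nth set_sorted_list_of_set)
  have sd: "sorted_wrt (<) ?l" by (simp add: strict_sorted_list_of_set)
  have "{y \<in> E. y < x} = {y \<in> set ?l. y < x}" using assms by simp
  also have "\<dots> = (!) ?l ` {..<i}"
  proof -
    have "?l ! j < ?l ! i \<longleftrightarrow> j < i" if "j < length ?l" for j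
      using sd i(1) that by (metis linorder_neqE_nat not_less_iff_gr_or_eq sorted_wrt_nth_less)
    then show ?thesis using i by (auto simp: in_set_conv_nth image_iff) (use less_trans in blast)
  qed
  finally have "{y \<in> E. y < x} = (!) ?l ` {..<i}" .
  moreover have "inj_on ((!) ?l) {..<i}"
    using i by (auto simp: inj_on_def nth_eq_iff_index_eq)
  ultimately have "card {y \<in> E. y < x} = i" by (simp add: card_image)
  then show "?l ! card {y \<in> E. y < x} = x" using i by simp
qed

lemma sorted_list_of_set_strict_mono_image:
  assumes "finite A" "strict_mono_on A f"
  shows "sorted_list_of_set (f ` A) = map f (sorted_list_of_set A)"
proof (rule strict_sorted_equal)
  show "sorted_wrt (<) (sorted_list_of_set (f ` A))" by (rule strict_sorted_list_of_set)
  show "set (sorted_list_of_set (f ` A)) = set (map f (sorted_list_of_set A))" using assms by simp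
  have "sorted_wrt (<) (sorted_list_of_set A)" by (rule strict_sorted_list_of_set)
  then show "sorted_wrt (<) (map f (sorted_list_of_set A))"
    unfolding sorted_wrt_map
    by (rule sorted_wrt_mono_rel[rotated]) (use assms in \<open>auto simp: strict_mono_on_def\<close>)
qed

text \<open>If \<open>I\<close> is an initial segment of \<open>E\<close>, the concatenated list is
  already sorted. This is the case without crossings in the computation of the sign.\<close>

lemma split_perm_initial:
  assumes "finite E" "I \<subseteq> E" "\<And>x y. x \<in> E - I \<Longrightarrow> y \<in> I \<Longrightarrow> y < x"
  shows "split_perm E I = id"
proof -
  have "sorted_list_of_set I @ sorted_list_of_set (E - I) = sorted_list_of_set E"
  proof (rule strict_sorted_equal)
    show "sorted_wrt (<) (sorted_list_of_set E)" by (rule strict_sorted_list_of_set)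
    show "set (sorted_list_of_set I @ sorted_list_of_set (E - I)) = set (sorted_list_of_set E)"
      using assms by (auto simp: finite_subset)
    show "sorted_wrt (<) (sorted_list_of_set I @ sorted_list_of_set (E - I))"
      using assms by (auto simp: sorted_wrt_append finite_subset strict_sorted_list_of_set)
  qed
  then show ?thesis
    unfolding split_perm_def fun_eq_iff using sorted_list_of_set_nth_card[OF assms(1)] by simp
qed

text \<open>The transposition of two neighbours of \<open>E\<close> is strictly increasing on any
  subset of \<open>E\<close> that contains only one of them. Hence it carries each of the two sorted
  lists of the exchanged set to the corresponding list of \<open>I\<close>, entry by entry.\<close>

lemma split_perm_transpose:
  assumes E: "finite E" and I: "I \<subseteq> E" and x: "x \<in> E - I" and y: "y \<in> I" and "x < y"
    and adj: "\<And>e. e \<in> E \<Longrightarrow> x < e \<Longrightarrow> e < y \<Longrightarrow> False"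
  shows "split_perm E I = transpose x y \<circ> split_perm E (insert x (I - {y}))"
proof -
  let ?J = "insert x (I - {y})"
  have fin: "finite ?J" "finite (E - ?J)" using E I by (auto simp: finite_subset)
  have above: "y < b" if "b \<in> E" "x < b" "b \<noteq> y" for b
    using adj that by (meson linorder_neqE)
  have below: "a < x" if "a \<in> E" "a < y" "a \<noteq> x" for a
    using adj that by (meson linorder_neqE)
  have left: "transpose x y a = (if a = x then y else a)" if "a \<in> ?J" for a
    using that \<open>x < y\<close> by (auto simp: transpose_def)
  have 1: "strict_mono_on ?J (transpose x y)"
  proof (rule strict_mono_onI)
    fix a b assume ab: "a \<in> ?J" "b \<in> ?J" "a < b"
    have "b \<noteq> x \<Longrightarrow> x < b \<Longrightarrow> y < b" using above[of b] ab I \<open>x < y\<close> by blast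
    moreover have "a < x \<Longrightarrow> a < y" using \<open>x < y\<close> by (rule less_trans[rotated])
    ultimately show "transpose x y a < transpose x y b"
      unfolding left[OF ab(1)] left[OF ab(2)] using ab(3) by auto
  qed
  have right: "transpose x y a = (if a = y then x else a)" if "a \<in> E - ?J" for a
    using that by (auto simp: transpose_def)
  have 2: "strict_mono_on (E - ?J) (transpose x y)"
  proof (rule strict_mono_onI)
    fix a b assume ab: "a \<in> E - ?J" "b \<in> E - ?J" "a < b"
    have "a \<noteq> y \<Longrightarrow> a < y \<Longrightarrow> a < x" using below[of a] ab by blast
    moreover have "y < b \<Longrightarrow> x < b" using \<open>x < y\<close> by (rule less_trans)
    ultimately show "transpose x y a < transpose x y b"
      unfolding right[OF ab(1)] right[OF ab(2)] using ab(3) by auto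
  qed
  have im1: "transpose x y ` ?J = I"
    using x y I \<open>x < y\<close> by (auto simp: transpose_def image_iff split: if_splits)
  have "bij (transpose x y)" by simp
  moreover have "transpose x y ` E = E"
    using x y I by (auto simp: transpose_def image_iff split: if_splits)
  ultimately have im2: "transpose x y ` (E - ?J) = E - I"
    using im1 by (simp add: image_set_diff bij_is_inj)
  have l: "sorted_list_of_set I @ sorted_list_of_set (E - I) =
      map (transpose x y) (sorted_list_of_set ?J @ sorted_list_of_set (E - ?J))"
    using sorted_list_of_set_strict_mono_image[OF fin(1) 1]
      sorted_list_of_set_strict_mono_image[OF fin(2) 2] im1 im2 by simp
  have len: "length (sorted_list_of_set ?J @ sorted_list_of_set (E - ?J)) = card E"
  proof -
    have "?J \<subseteq> E" using x I by auto
    then have "card (E - ?J) + card ?J = card E"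
      using E fin(1) by (metis card_Diff_subset card_mono le_add_diff_inverse2)
    then show ?thesis using fin by (simp only: length_append length_sorted_list_of_set add.commute)
  qed
  show ?thesis
  proof
    fix z
    show "split_perm E I z = (transpose x y \<circ> split_perm E ?J) z"
    proof (cases "z \<in> E")
      case True
      then show ?thesis
        using sorted_list_of_set_nth_card(2)[OF E True] len
        unfolding split_perm_def l by (simp del: map_append)
    next
      case False
      then have "z \<noteq> x" "z \<noteq> y" using x y I by auto
      then show ?thesis using False by (simp add: split_perm_def)
    qed
  qed
qed

text \<open>
  Exchanging \<open>x \<notin> I\<close> and \<open>y \<in> I\<close> that are neighbours in \<open>E\<close> with \<open>x < y\<close> removes one crossing and composes
  the permutation with a transposition.
\<close>

lemma split_perm_sign:
  assumes "finite E" "I \<subseteq> E"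
  shows "permutation (split_perm E I) \<and> sign (split_perm E I) = (-1) ^ crossings I (E - I)"
  using assms
proof (induction "crossings I (E - I)" arbitrary: I rule: less_induct)
  case less
  note E = less.prems(1) and I = less.prems(2)
  show ?case
  proof (cases "\<exists>x\<in>E - I. \<exists>y\<in>I. x < y")
    case False
    then have *: "y < x" if "x \<in> E - I" "y \<in> I" for x y
      using that by (metis DiffD2 linorder_neqE)
    then have "{(a, b). a \<in> I \<and> b \<in> E - I \<and> b < a} = {}" using False by blast
    then have "crossings I (E - I) = 0" unfolding crossings_def by (simp only: card.empty)
    then show ?thesis using split_perm_initial[OF E I *] by (simp add: sign_id)
  next
    case True
    then obtain x0 y0 where "x0 \<in> E - I \<and> y0 \<in> I \<and> x0 < y0" by blast
    \<comment> \<open>Among the pairs out of order, one with fewest elements of \<open>E\<close>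
      strictly between its entries. An element in between would form a closer such pair with
      \<open>x\<close> or with \<open>y\<close>, according to whether it lies in \<open>I\<close>;
      so the two entries are neighbours.\<close>
    then obtain p where p: "fst p \<in> E - I \<and> snd p \<in> I \<and> fst p < snd p"
      and min: "\<And>q. fst q \<in> E - I \<and> snd q \<in> I \<and> fst q < snd q \<Longrightarrow>
        card {e \<in> E. fst p < e \<and> e < snd p} \<le> card {e \<in> E. fst q < e \<and> e < snd q}"
      using ex_has_least_nat[of "\<lambda>p. fst p \<in> E - I \<and> snd p \<in> I \<and> fst p < snd p" "(x0, y0)"
          "\<lambda>p. card {e \<in> E. fst p < e \<and> e < snd p}"] by auto
    obtain x y where xy: "p = (x, y)" by (cases p)
    have x: "x \<in> E - I" and y: "y \<in> I" and lt: "x < y" using p xy by auto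
    let ?B = "\<lambda>a b. {e \<in> E. a < e \<and> e < b}"
    have adj: False if e: "e \<in> E" "x < e" "e < y" for e
    proof (cases "e \<in> I")
      case True
      have "?B x e \<subseteq> ?B x y" using less_trans[OF _ e(3)] by blast
      then have "?B x e \<subset> ?B x y" using e by blast
      then have "card (?B x e) < card (?B x y)" using E by (intro psubset_card_mono) auto
      then show False using min[of "(x, e)"] xy True x e by simp
    next
      case False
      have "?B e y \<subseteq> ?B x y" using less_trans[OF e(2)] by blast
      then have "?B e y \<subset> ?B x y" using e by blast
      then have "card (?B e y) < card (?B x y)" using E by (intro psubset_card_mono) auto
      then show False using min[of "(e, y)"] xy False y e by simp
    qed
    let ?J = "insert x (I - {y})"
    define K where "K = I - {y}"
    define L where "L = E - I - {x}"
    have fin: "finite K" "finite L" using E I by (auto simp: K_def L_def finite_subset)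
    have IK: "I = insert y K" "y \<notin> K" "E - I = insert x L" "x \<notin> L"
      using x y by (auto simp: K_def L_def)
    have JK: "?J = insert x K" "x \<notin> K" "E - ?J = insert y L" "y \<notin> L"
      using x y I lt by (auto simp: K_def L_def)
    \<comment> \<open>Every other element of \<open>E\<close> lies on the same side of
      \<open>x\<close> and of \<open>y\<close>. Its crossings are therefore unaffected by the
      exchange, and only the crossing of \<open>y\<close> with \<open>x\<close> is lost.\<close>
    have between: "x < k \<longleftrightarrow> y < k" "k < x \<longleftrightarrow> k < y" if "k \<in> E" "k \<noteq> x" "k \<noteq> y" for k
    proof -
      have "k < x \<or> y < k" using adj[OF that(1)] that(2,3) linorder_neqE by blast
      then show "x < k \<longleftrightarrow> y < k" "k < x \<longleftrightarrow> k < y"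
        using lt less_trans[OF lt] less_trans[OF _ lt] less_asym by blast+
    qed
    have "{k \<in> K. x < k} = {k \<in> K. y < k}"
    proof (intro Collect_cong conj_cong refl)
      fix k assume "k \<in> K"
      then have "k \<in> E" "k \<noteq> x" "k \<noteq> y" using I x by (auto simp: K_def)
      then show "x < k \<longleftrightarrow> y < k" by (rule between)
    qed
    then have k: "crossings K {x} = crossings K {y}" unfolding crossings_singleton_right by simp
    have "{l \<in> L. l < x} = {l \<in> L. l < y}"
    proof (intro Collect_cong conj_cong refl)
      fix k assume "k \<in> L"
      then have "k \<in> E" "k \<noteq> x" "k \<noteq> y" using y by (auto simp: L_def)
      then show "k < x \<longleftrightarrow> k < y" by (rule between)
    qed
    then have l: "crossings {x} L = crossings {y} L" unfolding crossings_singleton_left by simp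
    have "crossings (insert y K) (insert x L) = Suc (crossings (insert x K) (insert y L))"
      using crossings_insert_left[of K "insert x L" y] crossings_insert_right[of "{y}" L x]
        crossings_insert_right[of K L x] crossings_insert_left[of K "insert y L" x]
        crossings_insert_right[of "{x}" L y] crossings_insert_right[of K L y]
        fin IK(2,4) JK(2,4) k l lt by simp
    then have cr: "crossings I (E - I) = Suc (crossings ?J (E - ?J))"
      by (simp only: IK(1)[symmetric] IK(3)[symmetric] JK(1)[symmetric] JK(3)[symmetric])
    have J: "?J \<subseteq> E" using x I by auto
    have IH: "permutation (split_perm E ?J)"
        "sign (split_perm E ?J) = (-1) ^ crossings ?J (E - ?J)"
      using less.hyps[OF _ E J] cr by simp_all
    have "split_perm E I = transpose x y \<circ> split_perm E ?J"
      using E I x y lt adj by (rule split_perm_transpose)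
    then show ?thesis
      using IH cr lt
      by (simp add: sign_compose permutation_compose permutation_swap_id sign_swap_id)
  qed
qed

lemma split_sign_eq:
  assumes "finite E" "I \<subseteq> E"
  shows "split_sign E I = (-1) ^ crossings I (E - I)"
  using split_perm_sign[OF assms] unfolding split_sign_def split_perm_def by simp


section \<open>Bases and valuated exchange\<close>

text \<open>For a set \<tau> with one element more than a basis, this is the unique circuit inside
  \<tau> if \<tau> contains a basis, and empty otherwise. It is also the support of the circuit
  vector of \<tau>, which is why it replaces minimal dependent sets throughout.\<close>

definition circuit_in :: "'e set set \<Rightarrow> 'e set \<Rightarrow> 'e set" where
  "circuit_in \<B> \<tau> = {j \<in> \<tau>. \<tau> - {j} \<in> \<B>}"

lemma circuit_in_subset: "circuit_in \<B> \<tau> \<subseteq> \<tau>"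
  unfolding circuit_in_def by auto

text \<open>The exchange axiom of valuated matroids in the minimum convention, for one pair and one
  outgoing element, so that an induction on \<open>card (B - B')\<close> can be stated.\<close>

definition valuated_exchange ::
  "'e set set \<Rightarrow> ('e set \<Rightarrow> 'g::linordered_ab_group_add) \<Rightarrow> 'e set \<Rightarrow> 'e set \<Rightarrow> 'e \<Rightarrow> bool" where
  "valuated_exchange \<B> w B B' x \<longleftrightarrow>
    (\<exists>y\<in>B' - B. insert y (B - {x}) \<in> \<B> \<and> insert x (B' - {y}) \<in> \<B> \<and>
      w (insert y (B - {x})) + w (insert x (B' - {y})) \<le> w B + w B')"

lemma sum_exchange:
  fixes p :: "'e \<Rightarrow> 'g::ab_group_add"
  assumes "finite B" "x \<in> B" "y \<notin> B"
  shows "sum p (insert y (B - {x})) = sum p B - p x + p y"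
  using assms by (simp add: sum.remove)

text \<open>An exchange only redistributes the elements of \<open>B\<close> and \<open>B'\<close>
  between the two sets, so the sums of \<open>p\<close> on both sides of the inequality agree and
  cancel.\<close>

lemma valuated_exchange_twist:
  assumes "finite B" "finite B'" "x \<in> B - B'"
  shows "valuated_exchange \<B> (\<lambda>A. w A + sum p A) B B' x \<longleftrightarrow> valuated_exchange \<B> w B B' x"
proof -
  have "w (insert y (B - {x})) + sum p (insert y (B - {x})) +
        (w (insert x (B' - {y})) + sum p (insert x (B' - {y}))) \<le> w B + sum p B + (w B' + sum p B') \<longleftrightarrow>
      w (insert y (B - {x})) + w (insert x (B' - {y})) \<le> w B + w B'" if "y \<in> B' - B" for y
  proof -
    have "sum p (insert y (B - {x})) = sum p B - p x + p y"
      "sum p (insert x (B' - {y})) = sum p B' - p y + p x"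
      using that assms sum_exchange[of B x y p] sum_exchange[of B' y x p] by blast+
    then have "w (insert y (B - {x})) + sum p (insert y (B - {x})) +
        (w (insert x (B' - {y})) + sum p (insert x (B' - {y}))) =
      w (insert y (B - {x})) + w (insert x (B' - {y})) + (sum p B + sum p B')"
      by (simp only:) (simp add: algebra_simps)
    moreover have "w B + sum p B + (w B' + sum p B') = w B + w B' + (sum p B + sum p B')"
      by (simp add: algebra_simps)
    ultimately show ?thesis by (simp only: add_le_cancel_right)
  qed
  then show ?thesis unfolding valuated_exchange_def by (intro bex_cong refl conj_cong) blast+
qed

lemma add_le_imp_le:
  fixes a b c d :: "'g::linordered_ab_group_add"
  assumes "a + b \<le> c + d" "c \<le> a"
  shows "b \<le> d"
  using assms by (meson add_le_less_mono not_le)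

lemma card_exchange: "finite X \<Longrightarrow> x \<in> X \<Longrightarrow> y \<notin> X \<Longrightarrow> card (insert y (X - {x})) = card X"
  by (metis DiffD1 card.insert card.remove finite_Diff)

section \<open>Exchange properties and circuits of an ordinary matroid\<close>

locale bases =
  fixes E :: "'e set" and \<B> :: "'e set set" and r :: nat
  assumes matroid: "matroid_bases E \<B>"
    and card_basis: "B \<in> \<B> \<Longrightarrow> card B = r"
begin

lemma finite_ground: "finite E"
  using matroid unfolding matroid_bases_def by blast

lemma basis_subset: "B \<in> \<B> \<Longrightarrow> B \<subseteq> E"
  using matroid unfolding matroid_bases_def by blast

lemma finite_basis: "B \<in> \<B> \<Longrightarrow> finite B"
  using basis_subset finite_ground finite_subset by blast

lemma finite_bases: "finite \<B>"
  using finite_ground basis_subset by (meson PowI finite_Pow_iff finite_subset subsetI)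

lemma bases_nonempty: "\<B> \<noteq> {}"
  using matroid unfolding matroid_bases_def by blast

lemma exchange:
  assumes "A \<in> \<B>" "B \<in> \<B>" "x \<in> A" "x \<notin> B"
  obtains y where "y \<in> B" "y \<notin> A" "insert y (A - {x}) \<in> \<B>"
  using assms matroid unfolding matroid_bases_def by (metis DiffD1 DiffD2 DiffI)

text \<open>Extremal choice, replacing arguments that repeat an exchange until no further
  improvement is possible.\<close>

lemma basis_maximizing:
  fixes f :: "'e set \<Rightarrow> nat"
  assumes "T \<in> \<B>" "Q T"
  obtains B where "B \<in> \<B>" "Q B" "\<And>A. A \<in> \<B> \<Longrightarrow> Q A \<Longrightarrow> f A \<le> f B"
proof -
  let ?S = "{B \<in> \<B>. Q B}"
  have S: "finite ?S" "?S \<noteq> {}" using finite_bases assms by auto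
  then have "Max (f ` ?S) \<in> f ` ?S" by (intro Max_in) auto
  then obtain B where "B \<in> ?S" "f B = Max (f ` ?S)" by auto
  moreover have "f A \<le> Max (f ` ?S)" if "A \<in> ?S" for A using S that by simp
  ultimately show ?thesis using that by auto
qed

text \<open>Among the bases containing the circuit take one that meets \<tau> in as many elements as
  possible. If it lies inside \<tau>, the one element of \<tau> it misses belongs to the circuit by
  definition. Otherwise an element outside \<tau>, hence outside the circuit, can be traded for one
  of \<open>\<tau> - {i}\<close>, contradicting maximality.\<close>

lemma circuit_not_subset_basis:
  assumes tau: "card \<tau> = r + 1" and i: "i \<in> circuit_in \<B> \<tau>" and T: "T \<in> \<B>"
  shows "\<not> circuit_in \<B> \<tau> \<subseteq> T"
proof
  let ?S = "circuit_in \<B> \<tau>"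
  assume "?S \<subseteq> T"
  then obtain B where B: "B \<in> \<B>" "?S \<subseteq> B"
    and max: "\<And>A. A \<in> \<B> \<Longrightarrow> ?S \<subseteq> A \<Longrightarrow> card (A \<inter> \<tau>) \<le> card (B \<inter> \<tau>)"
    using basis_maximizing[of T "\<lambda>B. ?S \<subseteq> B" "\<lambda>B. card (B \<inter> \<tau>)"] T by blast
  have ti: "\<tau> - {i} \<in> \<B>" "i \<in> \<tau>" using i unfolding circuit_in_def by auto
  have fin: "finite \<tau>" using tau card.infinite by fastforce
  show False
  proof (cases "B \<subseteq> \<tau>")
    case True
    have "card (\<tau> - B) = 1"
      using True tau card_basis[OF B(1)] finite_basis[OF B(1)] by (simp add: card_Diff_subset)
    then obtain j where j: "\<tau> - B = {j}" using card_1_singletonE by blast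
    then have "\<tau> - {j} = B" using True by blast
    then have "j \<in> ?S" using j B(1) unfolding circuit_in_def by blast
    then show False using B(2) j by blast
  next
    case False
    then obtain x where x: "x \<in> B" "x \<notin> \<tau>" by blast
    obtain y where y: "y \<in> \<tau> - {i}" "y \<notin> B" "insert y (B - {x}) \<in> \<B>"
      using exchange[OF B(1) ti(1) x(1)] x(2) by blast
    have "?S \<subseteq> insert y (B - {x})" using B(2) x(2) circuit_in_subset[of \<B> \<tau>] by blast
    moreover have "insert y (B - {x}) \<inter> \<tau> = insert y (B \<inter> \<tau>)" using x y by blast
    ultimately show False using max[OF y(3)] y(2) fin by simp
  qed
qed

text \<open>If \<open>\<sigma> - {k}\<close> is a basis, it cannot contain the circuit of \<tau>; as
  that circuit lies in \<sigma>, it must contain \<open>k\<close>. So the circuit of \<sigma> lies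
  in that of \<tau>, hence in \<tau>, and the same argument applies with the roles
  interchanged.\<close>

lemma circuit_in_eq:
  assumes "card \<tau> = r + 1" "card \<sigma> = r + 1" "i \<in> circuit_in \<B> \<tau>" "j \<in> circuit_in \<B> \<sigma>"
    and sub: "circuit_in \<B> \<tau> \<subseteq> \<sigma>"
  shows "circuit_in \<B> \<sigma> = circuit_in \<B> \<tau>"
proof -
  have *: "circuit_in \<B> \<sigma>' \<subseteq> circuit_in \<B> \<tau>'"
    if "card \<tau>' = r + 1" "i' \<in> circuit_in \<B> \<tau>'" "circuit_in \<B> \<tau>' \<subseteq> \<sigma>'" for \<tau>' \<sigma>' i'
  proof
    fix k assume "k \<in> circuit_in \<B> \<sigma>'"
    then have "\<sigma>' - {k} \<in> \<B>" unfolding circuit_in_def by blast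
    then show "k \<in> circuit_in \<B> \<tau>'" using circuit_not_subset_basis[OF that(1,2)] that(3) by blast
  qed
  have "circuit_in \<B> \<sigma> \<subseteq> circuit_in \<B> \<tau>" using * assms by blast
  moreover from this have "circuit_in \<B> \<tau> \<subseteq> circuit_in \<B> \<sigma>"
    using *[OF assms(2,4)] circuit_in_subset[of \<B> \<tau>] by (meson order_trans)
  ultimately show ?thesis by blast
qed

lemma fundamental_circuit:
  assumes "B \<in> \<B>" "u \<notin> B"
  shows "card (insert u B) = r + 1" "u \<in> circuit_in \<B> (insert u B)"
  using assms card_basis finite_basis by (auto simp: circuit_in_def)

text \<open>Exchange with the incoming element prescribed: the fundamental circuit of
  \<open>u\<close> over \<open>A\<close> is not contained in \<open>B\<close>, and any of its
  elements outside \<open>B\<close> may leave.\<close>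

lemma dual_exchange:
  assumes "A \<in> \<B>" "B \<in> \<B>" "u \<in> B" "u \<notin> A"
  obtains v where "v \<in> A" "v \<notin> B" "insert u (A - {v}) \<in> \<B>"
proof -
  obtain v where v: "v \<in> circuit_in \<B> (insert u A)" "v \<notin> B"
    using circuit_not_subset_basis[OF fundamental_circuit[OF assms(1,4)] assms(2)] by blast
  then have "v \<in> A" "insert u A - {v} \<in> \<B>" using assms(3) unfolding circuit_in_def by auto
  moreover have "insert u A - {v} = insert u (A - {v})" using assms(3) v(2) by blast
  ultimately show ?thesis using that v(2) by metis
qed

text \<open>Take a basis \<open>B\<close> that meets \<open>X\<close> in as many elements as
  possible and \<open>x \<in> X - B\<close>. If the fundamental circuit of \<open>x\<close> had an
  element outside \<open>X\<close>, trading that element for \<open>x\<close> would enlarge the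
  meet.\<close>

lemma dependent_contains_circuit:
  assumes X: "X \<subseteq> E" and dep: "\<And>B. B \<in> \<B> \<Longrightarrow> \<not> X \<subseteq> B"
  obtains \<tau> i where "\<tau> \<subseteq> E" "card \<tau> = r + 1" "i \<in> circuit_in \<B> \<tau>" "circuit_in \<B> \<tau> \<subseteq> X"
proof -
  obtain T where "T \<in> \<B>" using bases_nonempty by blast
  then obtain B where B: "B \<in> \<B>"
    and max: "\<And>A. A \<in> \<B> \<Longrightarrow> card (A \<inter> X) \<le> card (B \<inter> X)"
    using basis_maximizing[of T "\<lambda>_. True" "\<lambda>B. card (B \<inter> X)"] by auto
  obtain x where x: "x \<in> X" "x \<notin> B" using dep[OF B] by blast
  have "circuit_in \<B> (insert x B) \<subseteq> X"
  proof
    fix j assume j: "j \<in> circuit_in \<B> (insert x B)"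
    show "j \<in> X"
    proof (rule ccontr)
      assume "j \<notin> X"
      then have "(insert x B - {j}) \<inter> X = insert x (B \<inter> X)" using x by blast
      moreover have "insert x B - {j} \<in> \<B>" using j unfolding circuit_in_def by blast
      ultimately have "card (insert x (B \<inter> X)) \<le> card (B \<inter> X)" using max by metis
      then show False using x finite_basis[OF B] by simp
    qed
  qed
  moreover have "insert x B \<subseteq> E" using x X basis_subset[OF B] by blast
  ultimately show ?thesis using that fundamental_circuit[OF B x(2)] by blast
qed

text \<open>Among the bases containing \<open>X\<close>, one that meets \<open>S\<close> most has no
  element outside \<open>X \<union> S\<close>: such an element could be traded for one of
  \<open>S\<close>.\<close>

lemma extend_to_basis:
  assumes "T \<in> \<B>" "X \<subseteq> T" "S \<in> \<B>"
  obtains B where "B \<in> \<B>" "X \<subseteq> B" "B \<subseteq> X \<union> S"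
proof -
  obtain B where B: "B \<in> \<B>" "X \<subseteq> B"
    and max: "\<And>A. A \<in> \<B> \<Longrightarrow> X \<subseteq> A \<Longrightarrow> card (A \<inter> S) \<le> card (B \<inter> S)"
    using basis_maximizing[of T "\<lambda>B. X \<subseteq> B" "\<lambda>B. card (B \<inter> S)"] assms by blast
  have "B \<subseteq> X \<union> S"
  proof (rule ccontr)
    assume "\<not> B \<subseteq> X \<union> S"
    then obtain t where t: "t \<in> B" "t \<notin> X" "t \<notin> S" by blast
    obtain y where y: "y \<in> S" "y \<notin> B" "insert y (B - {t}) \<in> \<B>"
      using exchange[OF B(1) assms(3) t(1,3)] by blast
    have "insert y (B - {t}) \<inter> S = insert y (B \<inter> S)" "X \<subseteq> insert y (B - {t})"
      using t y B(2) by blast+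
    then have "card (insert y (B \<inter> S)) \<le> card (B \<inter> S)" using max[OF y(3)] by simp
    then show False using y finite_basis[OF B(1)] by simp
  qed
  then show ?thesis using that B by blast
qed

text \<open>A basis of maximal meet with \<open>A\<close> can be altered inside \<open>A\<close>
  alone until it contains the part of a circuit lying in \<open>A\<close>. If an element
  \<open>s\<close> of that part is missing, its fundamental circuit lies in \<open>A\<close> by
  maximality. It is not contained in \<tau>, for then it would equal the circuit of \<tau>, which
  has the element \<open>i\<close> outside \<open>A\<close>. So it has an element outside the
  circuit of \<tau> that can be traded for \<open>s\<close>.\<close>

lemma absorb_circuit:
  assumes max: "\<And>B. B \<in> \<B> \<Longrightarrow> card (B \<inter> A) \<le> m"
    and T: "T \<in> \<B>" "card (T \<inter> A) = m"
    and tau: "card \<tau> = r + 1" "i \<in> circuit_in \<B> \<tau>" "i \<notin> A"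
  obtains B where "B \<in> \<B>" "card (B \<inter> A) = m" "B - A = T - A" "circuit_in \<B> \<tau> \<inter> A \<subseteq> B"
proof -
  let ?S = "circuit_in \<B> \<tau>"
  obtain B where B: "B \<in> \<B>" "card (B \<inter> A) = m \<and> B - A = T - A"
    and maxB: "\<And>C. C \<in> \<B> \<Longrightarrow> card (C \<inter> A) = m \<and> C - A = T - A \<Longrightarrow>
      card (C \<inter> ?S) \<le> card (B \<inter> ?S)"
    using basis_maximizing[of T "\<lambda>B. card (B \<inter> A) = m \<and> B - A = T - A" "\<lambda>B. card (B \<inter> ?S)"] T
    by blast
  have "?S \<inter> A \<subseteq> B"
  proof
    fix s assume s: "s \<in> ?S \<inter> A"
    show "s \<in> B"
    proof (rule ccontr)
      assume sB: "s \<notin> B"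
      let ?D = "circuit_in \<B> (insert s B)"
      note fund = fundamental_circuit[OF B(1) sB]
      have DA: "?D \<subseteq> A"
      proof
        fix j assume j: "j \<in> ?D"
        show "j \<in> A"
        proof (rule ccontr)
          assume "j \<notin> A"
          then have "(insert s B - {j}) \<inter> A = insert s (B \<inter> A)" using s by blast
          then have "card (insert s (B \<inter> A)) \<le> m"
            using max[of "insert s B - {j}"] j unfolding circuit_in_def by simp
          then show False using B sB finite_basis[OF B(1)] by simp
        qed
      qed
      have "\<not> ?D \<subseteq> \<tau>"
        using circuit_in_eq[OF fund(1) tau(1) fund(2) tau(2)] DA tau(2,3) by blast
      then obtain j where j: "j \<in> ?D" "j \<notin> ?S" using circuit_in_subset[of \<B> \<tau>] by blast
      then have jB: "j \<in> B" "j \<in> A" "insert s (B - {j}) \<in> \<B>"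
        using s DA unfolding circuit_in_def by (auto simp: insert_Diff_if split: if_splits)
      have eq: "insert s (B - {j}) \<inter> A = insert s (B \<inter> A - {j})"
        "insert s (B - {j}) \<inter> ?S = insert s (B \<inter> ?S)"
        "insert s (B - {j}) - A = B - A" using s j jB by blast+
      have "card (insert s (B \<inter> A - {j})) = card (B \<inter> A)"
        using sB jB finite_basis[OF B(1)] by (intro card_exchange) auto
      then have "card (insert s (B \<inter> ?S)) \<le> card (B \<inter> ?S)"
        using maxB[OF jB(3)] eq B(2) by simp
      then show False using sB finite_basis[OF B(1)] by simp
    qed
  qed
  then show ?thesis using that B by blast
qed

text \<open>
  In the minimal counterexample \<open>B, B', x\<close> the valuation has been twisted so that no exchange
  \<open>B - x + v\<close> changes its value. Among the best exchanges \<open>B' - v + u\<close> one for which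
  \<open>B - x + v\<close> is a basis is preferred.
\<close>

lemma no_minimal_violation:
  fixes w :: "'e set \<Rightarrow> 'g::linordered_ab_group_add"
  assumes loc: "\<And>C C' z. C \<in> \<B> \<Longrightarrow> C' \<in> \<B> \<Longrightarrow> z \<in> C - C' \<Longrightarrow> card (C - C') = 2 \<Longrightarrow>
      valuated_exchange \<B> w C C' z"
    and IH: "\<And>C C' z. C \<in> \<B> \<Longrightarrow> C' \<in> \<B> \<Longrightarrow> z \<in> C - C' \<Longrightarrow> card (C - C') < card (B - B') \<Longrightarrow>
      valuated_exchange \<B> w C C' z"
    and B: "B \<in> \<B>" "B' \<in> \<B>" "x \<in> B - B'" and n: "card (B - B') \<ge> 2"
    and equal: "\<And>v. v \<in> B' - B \<Longrightarrow> insert v (B - {x}) \<in> \<B> \<Longrightarrow> w (insert v (B - {x})) = w B"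
    and less: "\<And>v. v \<in> B' - B \<Longrightarrow> insert v (B - {x}) \<in> \<B> \<Longrightarrow> insert x (B' - {v}) \<in> \<B> \<Longrightarrow>
      w B' < w (insert x (B' - {v}))"
    and le: "\<And>v. v \<in> B' - B \<Longrightarrow> insert v (B - {x}) \<notin> \<B> \<Longrightarrow> insert x (B' - {v}) \<in> \<B> \<Longrightarrow>
      w B' \<le> w (insert x (B' - {v}))"
  shows False
proof -
  have "\<not> B - B' \<subseteq> {x}" using n card_mono[of "{x}" "B - B'"] by auto
  then obtain u where u: "u \<in> B" "u \<notin> B'" "u \<noteq> x" by blast
  let ?ex = "\<lambda>v. insert u (B' - {v})"
  let ?S = "{v \<in> B' - B. ?ex v \<in> \<B>}"
  let ?m = "Min ((\<lambda>v. w (?ex v)) ` ?S)"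
  have finS: "finite ?S" using finite_basis[OF B(2)] by simp
  obtain v1 where "v1 \<in> ?S" using dual_exchange[OF B(2,1) u(1,2)] by blast
  then have Sne: "?S \<noteq> {}" by blast
  have min: "?m \<le> w (?ex v)" if "v \<in> ?S" for v using finS that by simp
  have "?m \<in> (\<lambda>v. w (?ex v)) ` ?S" using finS Sne by (intro Min_in) auto
  then obtain v2 where v2: "v2 \<in> ?S" "w (?ex v2) = ?m" by auto
  obtain v where v: "v \<in> ?S" "w (?ex v) = ?m"
    and pref: "\<And>y. y \<in> ?S \<Longrightarrow> w (?ex y) = ?m \<Longrightarrow> insert y (B - {x}) \<in> \<B> \<Longrightarrow>
      insert v (B - {x}) \<in> \<B>"
  proof (cases "\<exists>y\<in>?S. w (?ex y) = ?m \<and> insert y (B - {x}) \<in> \<B>")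
    case True then show ?thesis using that by blast
  next
    case False then show ?thesis using that v2 by blast
  qed
  have vB: "v \<in> B'" "v \<notin> B" and ex: "?ex v \<in> \<B>" using v(1) by auto
  \<comment> \<open>\<open>u\<close> now belongs to both sets, so the pair \<open>B\<close>,
    \<open>?ex v\<close> is closer than \<open>B\<close>, \<open>B'\<close> and the exchange
    property is available for it.\<close>
  have "B - ?ex v = B - B' - {u}" using u vB by blast
  moreover have "card (B - B' - {u}) < card (B - B')"
    using u finite_basis[OF B(1)] by (intro card_Diff1_less) auto
  ultimately have "valuated_exchange \<B> w B (?ex v) x"
    using IH[OF B(1) ex, of x] B(3) u(3) by simp
  then obtain y where y: "y \<in> ?ex v - B" "insert y (B - {x}) \<in> \<B>" "insert x (?ex v - {y}) \<in> \<B>"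
    and yle: "w (insert y (B - {x})) + w (insert x (?ex v - {y})) \<le> w B + w (?ex v)"
    unfolding valuated_exchange_def by blast
  have yB: "y \<in> B'" "y \<notin> B" "y \<noteq> v" "y \<noteq> u" using y(1) u by auto
  let ?C = "insert x (?ex v - {y})"
  \<comment> \<open>By \<open>equal\<close>, the exchange on the side of \<open>B\<close> does not
    change the weight, so the whole inequality falls on the other side.\<close>
  have Cle: "w ?C \<le> w (?ex v)" using yle equal[OF _ y(2)] yB by simp
  \<comment> \<open>\<open>?C\<close> and \<open>B'\<close> are at distance two, so the local
    exchange applies. It trades \<open>x\<close> for \<open>y\<close> or for \<open>v\<close>; both
    outcomes are refuted.\<close>
  have CB: "?C - B' = {x, u}" "B' - ?C = {v, y}" using B(3) u vB yB by auto
  then have "valuated_exchange \<B> w ?C B' x"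
    using loc[OF y(3) B(2), of x] B(3) u(3) by simp
  then obtain z where z: "z \<in> {v, y}" "insert z (?C - {x}) \<in> \<B>" "insert x (B' - {z}) \<in> \<B>"
    and zle: "w (insert z (?C - {x})) + w (insert x (B' - {z})) \<le> w ?C + w B'"
    unfolding valuated_exchange_def CB by blast
  show False
  proof (cases "z = y")
    case True
    have "insert y (?C - {x}) = ?ex v" using B(3) u vB yB by auto
    then have "w (?ex v) + w (insert x (B' - {y})) \<le> w (?ex v) + w B'"
      using zle Cle True by (simp only:) (meson add_right_mono order_trans)
    moreover have "w B' < w (insert x (B' - {y}))" using less[OF _ y(2)] yB z(3) True by simp
    ultimately show False by simp
  next
    case False
    then have zv: "z = v" using z by blast
    \<comment> \<open>Trading \<open>x\<close> for \<open>v\<close> leaves another candidate for the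
      exchange of \<open>u\<close>. Minimality of \<open>?ex v\<close> among these candidates bounds
      the weight of \<open>insert x (B' - {v})\<close> by that of \<open>B'\<close>.\<close>
    have Ceq: "insert v (?C - {x}) = ?ex y" using B(3) u vB yB by auto
    then have yS: "y \<in> ?S" using z(2) zv yB by simp
    have 1: "w (?ex y) + w (insert x (B' - {v})) \<le> ?m + w B'"
      using zle add_right_mono[OF Cle, of "w B'"] unfolding zv Ceq v(2) by (rule order_trans)
    then have "w (insert x (B' - {v})) \<le> w B'"
      using min[OF yS] by (rule add_le_imp_le)
    then have nv: "insert v (B - {x}) \<notin> \<B>" using less[of v] vB z(3) zv by (meson DiffI leD)
    then have "w B' \<le> w (insert x (B' - {v}))" using le vB z(3) zv by blast
    then have "w (?ex y) + w B' \<le> ?m + w B'" using 1 by (meson add_left_mono order_trans)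
    \<comment> \<open>So \<open>y\<close> is also a best candidate and
      \<open>insert y (B - {x})\<close> is a basis, whereas \<open>insert v (B - {x})\<close> is
      not: \<open>v\<close> was not chosen according to the preference.\<close>
    then have "w (?ex y) = ?m" using min[OF yS] by simp
    then show False using pref[OF yS] y(2) nv by blast
  qed
qed

text \<open>The local-to-global principle for valuated matroids whose support is already known to be
  a matroid. A violating pair, all closer pairs being good, is brought by a twist into the position
  excluded by \<open>no_minimal_violation\<close>.\<close>

lemma local_imp_valuated_exchange:
  fixes w :: "'e set \<Rightarrow> 'g::linordered_ab_group_add"
  assumes loc: "\<And>C C' z. C \<in> \<B> \<Longrightarrow> C' \<in> \<B> \<Longrightarrow> z \<in> C - C' \<Longrightarrow> card (C - C') = 2 \<Longrightarrow>
      valuated_exchange \<B> w C C' z"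
    and "B \<in> \<B>" "B' \<in> \<B>" "x \<in> B - B'"
  shows "valuated_exchange \<B> w B B' x"
  using assms(2-)
proof (induction "card (B - B')" arbitrary: B B' x rule: less_induct)
  case less
  note B = less.prems
  have fin: "finite B" "finite B'" using B finite_basis by auto
  show ?case
  proof (rule ccontr)
    assume viol: "\<not> ?case"
    \<comment> \<open>At distance one the exchange merely interchanges \<open>B\<close> and
      \<open>B'\<close>, so the sum of weights is unchanged.\<close>
    have card2: "card (B - B') \<ge> 2"
    proof (rule ccontr)
      assume "\<not> card (B - B') \<ge> 2"
      moreover have "card (B - B') \<noteq> 0" using B(3) fin by auto
      ultimately have 1: "card (B - B') = 1" by linarith
      then have 2: "B - B' = {x}" using B(3) by (metis card_1_singletonE singletonD)
      have "card (B' - B) = card (B - B')"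
        using card_basis[OF B(1)] card_basis[OF B(2)] fin by (intro card_le_sym_Diff antisym) auto
      then obtain y where y: "B' - B = {y}" using 1 card_1_singletonE by metis
      then have "insert y (B - {x}) = B'" "insert x (B' - {y}) = B" using 2 by blast+
      then have "valuated_exchange \<B> w B B' x"
        unfolding valuated_exchange_def y using B by (simp add: add.commute)
      then show False using viol by blast
    qed
    define p where "p v = (if v \<in> B' - B then
      (if insert v (B - {x}) \<in> \<B> then w B - w (insert v (B - {x}))
       else w (insert x (B' - {v})) - w B') else 0)" for v
    let ?w = "\<lambda>A. w A + sum p A"
    have px: "p x = 0" using B(3) by (simp add: p_def)
    have sumB: "sum p (insert v (B - {x})) = sum p B + p v"
      and sumB': "sum p (insert x (B' - {v})) = sum p B' - p v" if "v \<in> B' - B" for v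
      using sum_exchange[of B x v p] sum_exchange[of B' v x p] fin B(3) that px by auto
    show False
    proof (rule no_minimal_violation[of ?w B B' x])
      show "valuated_exchange \<B> ?w C C' z"
        if "C \<in> \<B>" "C' \<in> \<B>" "z \<in> C - C'" "card (C - C') = 2" for C C' z
        using loc[OF that] valuated_exchange_twist[OF _ _ that(3)] finite_basis that(1,2) by blast
      show "valuated_exchange \<B> ?w C C' z"
        if "C \<in> \<B>" "C' \<in> \<B>" "z \<in> C - C'" "card (C - C') < card (B - B')" for C C' z
        using less.hyps[OF that(4,1,2,3)] valuated_exchange_twist[OF _ _ that(3)] finite_basis that(1,2)
        by blast
      show "?w (insert v (B - {x})) = ?w B" if "v \<in> B' - B" "insert v (B - {x}) \<in> \<B>" for v
        using sumB[OF that(1)] that by (simp add: p_def)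
      show "?w B' < ?w (insert x (B' - {v}))"
        if "v \<in> B' - B" "insert v (B - {x}) \<in> \<B>" "insert x (B' - {v}) \<in> \<B>" for v
      proof -
        have "w B + w B' < w (insert v (B - {x})) + w (insert x (B' - {v}))"
          using viol that unfolding valuated_exchange_def by (meson not_le)
        moreover have "w B = w (insert v (B - {x})) + p v" using that by (simp add: p_def)
        ultimately have "p v + w B' < w (insert x (B' - {v}))" by (simp add: add.assoc)
        then show ?thesis unfolding sumB'[OF that(1)] by (simp add: algebra_simps)
      qed
      show "?w B' \<le> ?w (insert x (B' - {v}))"
        if "v \<in> B' - B" "insert v (B - {x}) \<notin> \<B>" "insert x (B' - {v}) \<in> \<B>" for v
        using sumB'[OF that(1)] that by (simp add: p_def)
    qed (use B card2 in auto)
  qed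
qed

text \<open>An exchange between two bases of least weight produces two bases whose weights sum to at
  most twice the minimum. Neither can be below the minimum, so both attain it.\<close>

lemma minimizers_matroid_bases:
  fixes w :: "'e set \<Rightarrow> 'g::linordered_ab_group_add"
  assumes "\<And>C C' z. C \<in> \<B> \<Longrightarrow> C' \<in> \<B> \<Longrightarrow> z \<in> C - C' \<Longrightarrow> card (C - C') = 2 \<Longrightarrow>
      valuated_exchange \<B> w C C' z"
  shows "matroid_bases E {B \<in> \<B>. \<forall>A\<in>\<B>. w B \<le> w A}"
  unfolding matroid_bases_def
proof (intro conjI ballI)
  have "finite (w ` \<B>)" "w ` \<B> \<noteq> {}" using finite_bases bases_nonempty by auto
  then obtain B where "B \<in> \<B>" "w B = Min (w ` \<B>)" by (metis Min_in imageE)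
  then have "\<forall>A\<in>\<B>. w B \<le> w A" using finite_bases by simp
  then show "{B \<in> \<B>. \<forall>A\<in>\<B>. w B \<le> w A} \<noteq> {}" using \<open>B \<in> \<B>\<close> by blast
next
  fix B B' x
  assume B: "B \<in> {B \<in> \<B>. \<forall>A\<in>\<B>. w B \<le> w A}" "B' \<in> {B \<in> \<B>. \<forall>A\<in>\<B>. w B \<le> w A}"
    and x: "x \<in> B - B'"
  have "valuated_exchange \<B> w B B' x" using local_imp_valuated_exchange assms B x by blast
  then obtain y where y: "y \<in> B' - B" "insert y (B - {x}) \<in> \<B>" "insert x (B' - {y}) \<in> \<B>"
    and le: "w (insert y (B - {x})) + w (insert x (B' - {y})) \<le> w B + w B'"
    unfolding valuated_exchange_def by blast
  have "w B' \<le> w (insert x (B' - {y}))" using B y by blast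
  then have "w (insert y (B - {x})) \<le> w B"
    using le add_le_imp_le by (metis add.commute)
  then have "\<forall>A\<in>\<B>. w (insert y (B - {x})) \<le> w A" using B(1) order_trans by fast
  then show "\<exists>y\<in>B' - B. insert y (B - {x}) \<in> {B \<in> \<B>. \<forall>A\<in>\<B>. w B \<le> w A}" using y by blast
qed (use finite_ground basis_subset in auto)

text \<open>Removing \<open>x\<close> from a complement adds it to the basis, so exchange for
  complements is exchange with prescribed incoming element.\<close>

lemma dual_matroid_bases: "matroid_bases E {B. B \<subseteq> E \<and> E - B \<in> \<B>}"
  unfolding matroid_bases_def
proof (intro conjI ballI)
  obtain T where "T \<in> \<B>" using bases_nonempty by blast
  then have "E - T \<in> {B. B \<subseteq> E \<and> E - B \<in> \<B>}" using basis_subset by (simp add: double_diff)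
  then show "{B. B \<subseteq> E \<and> E - B \<in> \<B>} \<noteq> {}" by blast
next
  fix A B x assume A: "A \<in> {B. B \<subseteq> E \<and> E - B \<in> \<B>}" and B: "B \<in> {B. B \<subseteq> E \<and> E - B \<in> \<B>}"
    and x: "x \<in> A - B"
  obtain v where v: "v \<in> E - A" "v \<notin> E - B" "insert x (E - A - {v}) \<in> \<B>"
    using dual_exchange[of "E - A" "E - B" x] A B x by blast
  moreover have "insert x (E - A - {v}) = E - insert v (A - {x})" using A x v by blast
  ultimately show "\<exists>y\<in>B - A. insert y (A - {x}) \<in> {B. B \<subseteq> E \<and> E - B \<in> \<B>}"
    using A by (intro bexI[of _ v]) auto
qed (use finite_ground in auto)

end


section \<open>Arithmetic in tracts\<close>

notation omult (infixl "\<odot>\<index>" 70)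

definition ocarrier :: "'a tract_struct \<Rightarrow> 'a option set" where
  "ocarrier F = insert None (Some ` carrier F)"

text \<open>Signs are indexed by exponents, so that a product of signs becomes a sum of crossing
  numbers of which only the parity matters.\<close>

definition sign_unit :: "'a tract_struct \<Rightarrow> nat \<Rightarrow> 'a option" where
  "sign_unit F n = Some (if even n then \<one>\<^bsub>F\<^esub> else neg_one F)"

lemma omult_simps [simp]:
  "None \<odot>\<^bsub>F\<^esub> x = None" "x \<odot>\<^bsub>F\<^esub> None = None" "Some a \<odot>\<^bsub>F\<^esub> Some b = Some (a \<otimes>\<^bsub>F\<^esub> b)"
  by (auto simp: omult_def split: option.splits)

lemma omult_eq_None_iff [simp]: "x \<odot>\<^bsub>F\<^esub> y = None \<longleftrightarrow> x = None \<or> y = None"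
  by (auto simp: omult_def split: option.splits)

lemma None_ocarrier [simp]: "None \<in> ocarrier F"
  by (simp add: ocarrier_def)

lemma Some_ocarrier [simp]: "Some a \<in> ocarrier F \<longleftrightarrow> a \<in> carrier F"
  by (auto simp: ocarrier_def)

lemma sign_unit_neq_None [simp]: "sign_unit F n \<noteq> None"
  by (simp add: sign_unit_def)

lemma signed_eq_None_iff [simp]: "signed F s x = None \<longleftrightarrow> x = None"
  by (simp add: signed_def)

lemma scale_apply: "scale F c f i = Some c \<odot>\<^bsub>F\<^esub> f i"
  by (simp add: scale_def)

lemma in_mset_setD: "x \<in># mset_set A \<Longrightarrow> x \<in> A"
  by (metis elem_mset_set empty_iff mset_set.infinite set_mset_empty)

lemma formal_sum_cong:
  assumes "J = J'" "\<And>j. j \<in> J' \<Longrightarrow> f j = g j"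
  shows "formal_sum f J = formal_sum g J'"
proof -
  have "{j \<in> J. f j \<noteq> None} = {j \<in> J'. g j \<noteq> None}" using assms by auto
  then show ?thesis
    unfolding formal_sum_def
    by (simp only:) (rule image_mset_cong, drule in_mset_setD, simp add: assms(2))
qed

lemma formal_sum_empty:
  assumes "\<And>j. j \<in> J \<Longrightarrow> f j = None"
  shows "formal_sum f J = {#}"
proof -
  have "{j \<in> J. f j \<noteq> None} = {}" using assms by auto
  then show ?thesis by (simp only: formal_sum_def mset_set.empty image_mset_empty)
qed

lemma formal_sum_singleton:
  assumes "i \<in> J" "f i = Some a" "\<And>j. j \<in> J \<Longrightarrow> j \<noteq> i \<Longrightarrow> f j = None"
  shows "formal_sum f J = {#a#}"
proof -
  have "f j \<noteq> None \<longleftrightarrow> j = i" if "j \<in> J" for j using that assms by fastforce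
  then have "{j \<in> J. f j \<noteq> None} = {i}" using assms(1) by blast
  then show ?thesis by (simp add: formal_sum_def assms)
qed

lemma formal_sum_pair:
  assumes "i \<in> J" "k \<in> J" "i \<noteq> k" "f i = Some a" "f k = Some b"
    "\<And>j. j \<in> J \<Longrightarrow> j \<noteq> i \<Longrightarrow> j \<noteq> k \<Longrightarrow> f j = None"
  shows "formal_sum f J = {#a, b#}"
proof -
  have "f j \<noteq> None \<longleftrightarrow> j = i \<or> j = k" if "j \<in> J" for j using that assms by fastforce
  then have "{j \<in> J. f j \<noteq> None} = {i, k}" using assms(1,2) by blast
  then show ?thesis using assms(3) by (simp add: formal_sum_def assms(4,5))
qed

section \<open>Signs, the involution and null sums in a tract\<close>

context tract
begin

lemma neg_one_spec: "neg_one F \<in> carrier F \<and> {#\<one>, neg_one F#} \<in> null F"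
  unfolding neg_one_def by (rule theI'[OF ex1_neg_one])

lemma neg_one_closed [simp]: "neg_one F \<in> carrier F"
  using neg_one_spec by blast

lemma neg_one_unique: "e \<in> carrier F \<Longrightarrow> {#\<one>, e#} \<in> null F \<Longrightarrow> e = neg_one F"
  using neg_one_spec ex1_neg_one by blast

lemma null_scale_iff:
  assumes "c \<in> carrier F" "set_mset m \<subseteq> carrier F"
  shows "image_mset (\<lambda>a. c \<otimes> a) m \<in> null F \<longleftrightarrow> m \<in> null F"
proof
  assume "image_mset (\<lambda>a. c \<otimes> a) m \<in> null F"
  then have "image_mset (\<lambda>a. inv c \<otimes> a) (image_mset (\<lambda>a. c \<otimes> a) m) \<in> null F"
    using assms by (intro scale_null[of "inv c"]) auto
  moreover have "image_mset (\<lambda>a. inv c \<otimes> a) (image_mset (\<lambda>a. c \<otimes> a) m) = image_mset (\<lambda>a. a) m"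
    unfolding multiset.map_comp
    by (intro image_mset_cong) (use assms in \<open>auto simp: m_assoc[symmetric]\<close>)
  ultimately show "m \<in> null F" by (simp only: multiset.map_ident)
qed (use assms scale_null in auto)

lemma singleton_not_null: "a \<in> carrier F \<Longrightarrow> {#a#} \<notin> null F"
  using null_scale_iff[of a "{#\<one>#}"] one_not_null by simp

text \<open>Division by \<open>a\<close> reduces this to the uniqueness of -1.\<close>

lemma null_pair:
  assumes "a \<in> carrier F" "b \<in> carrier F" "{#a, b#} \<in> null F"
  shows "b = neg_one F \<otimes> a"
proof -
  have "{#\<one>, inv a \<otimes> b#} \<in> null F"
    using scale_null[of "inv a" "{#a, b#}"] assms by simp
  then have "inv a \<otimes> b = neg_one F" using assms by (intro neg_one_unique) auto
  then show ?thesis using assms by (metis inv_closed inv_solve_left m_comm neg_one_closed)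
qed

text \<open>The null pair of 1 and -1 is unordered, so \<open>null_pair\<close> also applies with -1
  in first place.\<close>

lemma neg_one_square: "neg_one F \<otimes> neg_one F = \<one>"
proof -
  have "{#neg_one F, \<one>#} \<in> null F" using neg_one_spec by (simp add: add_mset_commute)
  then show ?thesis using null_pair[of "neg_one F" \<one>] by simp
qed

lemma involution_closed [simp]: "a \<in> carrier F \<Longrightarrow> involution F a \<in> carrier F"
  using involution_hom unfolding tract_hom_def hom_def by auto

lemma involution_mult:
  "a \<in> carrier F \<Longrightarrow> b \<in> carrier F \<Longrightarrow> involution F (a \<otimes> b) = involution F a \<otimes> involution F b"
  using involution_hom unfolding tract_hom_def hom_def by auto

lemma involution_null: "m \<in> null F \<Longrightarrow> image_mset (involution F) m \<in> null F"
  using involution_hom unfolding tract_hom_def by auto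

lemma involution_one: "involution F \<one> = \<one>"
  using involution_mult[of \<one> \<one>] by (metis involution_closed l_one one_closed r_cancel_one')

lemma involution_neg_one: "involution F (neg_one F) = neg_one F"
  using neg_one_spec involution_null[of "{#\<one>, neg_one F#}"]
  by (intro neg_one_unique) (auto simp: involution_one)

lemma omult_closed [simp]: "x \<in> ocarrier F \<Longrightarrow> y \<in> ocarrier F \<Longrightarrow> x \<odot> y \<in> ocarrier F"
  by (auto simp: ocarrier_def)

lemma omult_commute: "x \<in> ocarrier F \<Longrightarrow> y \<in> ocarrier F \<Longrightarrow> x \<odot> y = y \<odot> x"
  by (auto simp: ocarrier_def m_comm)

lemma omult_assoc:
  "x \<in> ocarrier F \<Longrightarrow> y \<in> ocarrier F \<Longrightarrow> z \<in> ocarrier F \<Longrightarrow> x \<odot> y \<odot> z = x \<odot> (y \<odot> z)"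
  by (auto simp: ocarrier_def m_assoc)

lemma omult_left_commute:
  "x \<in> ocarrier F \<Longrightarrow> y \<in> ocarrier F \<Longrightarrow> z \<in> ocarrier F \<Longrightarrow> x \<odot> (y \<odot> z) = y \<odot> (x \<odot> z)"
  by (auto simp: ocarrier_def m_lcomm)

lemmas omult_ac = omult_assoc omult_commute omult_left_commute

lemma omult_one [simp]: "x \<in> ocarrier F \<Longrightarrow> Some \<one> \<odot> x = x"
  by (auto simp: ocarrier_def)

lemma omult_left_cancel:
  "c \<in> carrier F \<Longrightarrow> x \<in> ocarrier F \<Longrightarrow> y \<in> ocarrier F \<Longrightarrow> Some c \<odot> x = Some c \<odot> y \<longleftrightarrow> x = y"
  by (auto simp: ocarrier_def)

lemma sign_unit_closed [simp]: "sign_unit F n \<in> ocarrier F"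
  by (simp add: sign_unit_def)

lemma sign_unit_add: "sign_unit F m \<odot> sign_unit F n = sign_unit F (m + n)"
  by (simp add: sign_unit_def neg_one_square)

lemma sign_unit_left_add: "x \<in> ocarrier F \<Longrightarrow>
    sign_unit F m \<odot> (sign_unit F n \<odot> x) = sign_unit F (m + n) \<odot> x"
  by (simp add: sign_unit_add omult_assoc[symmetric])

lemma sign_unit_even: "even n \<Longrightarrow> x \<in> ocarrier F \<Longrightarrow> sign_unit F n \<odot> x = x"
  by (simp add: sign_unit_def)

lemma sign_unit_cong: "even (m + n) \<Longrightarrow> sign_unit F m = sign_unit F n"
  by (simp add: sign_unit_def)

lemma sign_unit_carrier: obtains c where "c \<in> carrier F" "sign_unit F n = Some c"
  using sign_unit_closed[of n] by (auto simp: sign_unit_def split: if_splits)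

lemma signed_eq: "x \<in> ocarrier F \<Longrightarrow> signed F ((-1) ^ n) x = sign_unit F n \<odot> x"
  by (cases "even n") (simp_all add: signed_def sign_unit_def)

lemma omult_sign_unit_left:
  "x \<in> ocarrier F \<Longrightarrow> y \<in> ocarrier F \<Longrightarrow>
    (sign_unit F m \<odot> x) \<odot> (sign_unit F n \<odot> y) = sign_unit F (m + n) \<odot> (x \<odot> y)"
  by (simp add: sign_unit_add[symmetric] omult_ac)

abbreviation conj_opt :: "'a option \<Rightarrow> 'a option" where
  "conj_opt \<equiv> map_option (involution F)"

lemma conj_opt_closed [simp]: "x \<in> ocarrier F \<Longrightarrow> conj_opt x \<in> ocarrier F"
  by (auto simp: ocarrier_def)

lemma conj_opt_mult:
  "x \<in> ocarrier F \<Longrightarrow> y \<in> ocarrier F \<Longrightarrow> conj_opt (x \<odot> y) = conj_opt x \<odot> conj_opt y"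
  by (auto simp: ocarrier_def involution_mult)

lemma conj_opt_sign_unit: "conj_opt (sign_unit F n) = sign_unit F n"
  by (simp add: sign_unit_def involution_one involution_neg_one)

lemma formal_sum_units:
  assumes "\<And>j. j \<in> J \<Longrightarrow> f j \<in> ocarrier F"
  shows "set_mset (formal_sum f J) \<subseteq> carrier F"
proof -
  have "the (f j) \<in> carrier F" if "j \<in># mset_set {j \<in> J. f j \<noteq> None}" for j
    using in_mset_setD[OF that] assms[of j] by (auto simp: ocarrier_def)
  then show ?thesis unfolding formal_sum_def by auto
qed

lemma formal_sum_scale:
  assumes "c \<in> carrier F" "\<And>j. j \<in> J \<Longrightarrow> f j \<in> ocarrier F"
  shows "formal_sum (\<lambda>j. Some c \<odot> f j) J \<in> null F \<longleftrightarrow> formal_sum f J \<in> null F"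
proof -
  have "formal_sum (\<lambda>j. Some c \<odot> f j) J = image_mset (\<lambda>a. c \<otimes> a) (formal_sum f J)"
    by (auto simp: formal_sum_def multiset.map_comp intro!: image_mset_cong dest!: in_mset_setD)
  then show ?thesis using null_scale_iff[OF assms(1) formal_sum_units[of J f]] assms(2) by simp
qed

lemma formal_sum_conj:
  assumes "formal_sum f J \<in> null F"
  shows "formal_sum (\<lambda>j. conj_opt (f j)) J \<in> null F"
proof -
  have "formal_sum (\<lambda>j. conj_opt (f j)) J = image_mset (involution F) (formal_sum f J)"
    by (auto simp: formal_sum_def multiset.map_comp intro!: image_mset_cong dest!: in_mset_setD)
  then show ?thesis using involution_null[OF assms] by simp
qed

text \<open>A sum consisting of a single unit is never null. This is how a Pluecker relation
  produces a basis exchange.\<close>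

lemma null_sum_other_term:
  assumes "formal_sum f J \<in> null F" "i \<in> J" "f i \<noteq> None" "f i \<in> ocarrier F"
  obtains j where "j \<in> J" "j \<noteq> i" "f j \<noteq> None"
proof (rule ccontr)
  assume "\<not> thesis"
  then have *: "f j = None" if "j \<in> J" "j \<noteq> i" for j using that \<open>\<And>j. \<lbrakk>j \<in> J; j \<noteq> i; f j \<noteq> None\<rbrakk> \<Longrightarrow> thesis\<close> by blast
  obtain a where "f i = Some a" "a \<in> carrier F" using assms(3,4) by auto
  then show False using formal_sum_singleton[of i J f a] assms(1,2) * singleton_not_null by metis
qed

text \<open>Null sums are not closed under any kind of elimination, but with at most two surviving
  terms a relation becomes an equation: both terms vanish, or they are negatives of each
  other.\<close>

lemma null_sum_two_terms:
  assumes "formal_sum f J \<in> null F" "i \<in> J" "k \<in> J" "i \<noteq> k" "f i \<in> ocarrier F" "f k \<in> ocarrier F"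
    and rest: "\<And>j. j \<in> J \<Longrightarrow> j \<noteq> i \<Longrightarrow> j \<noteq> k \<Longrightarrow> f j = None"
  shows "f k = sign_unit F 1 \<odot> f i"
proof (cases "f i")
  case None
  then show ?thesis using null_sum_other_term[OF assms(1,3) _ assms(6)] rest by (metis omult_simps(2))
next
  case (Some a)
  then obtain b where b: "f k = Some b"
    using null_sum_other_term[OF assms(1,2) _ assms(5)] rest by (metis not_Some_eq)
  have "{#a, b#} \<in> null F" using formal_sum_pair[of i J k f a b] assms Some b by simp
  then show ?thesis using null_pair[of a b] assms(5,6) Some b by (simp add: sign_unit_def)
qed

end


section \<open>Tropical extensions and Pluecker terms\<close>

lemma trop_simps [simp]:
  "carrier (trop F) = carrier F \<times> UNIV"
  "(a, g) \<otimes>\<^bsub>trop F\<^esub> (b, h) = (a \<otimes>\<^bsub>F\<^esub> b, g + h)"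
  "\<one>\<^bsub>trop F\<^esub> = (\<one>\<^bsub>F\<^esub>, 0)"
  "involution (trop F) (a, g) = (involution F a, g)"
  by (simp_all add: trop_def)

definition min_part :: "('a \<times> 'g::linorder) multiset \<Rightarrow> ('a \<times> 'g) multiset" where
  "min_part m = filter_mset (\<lambda>x. \<forall>y \<in># m. snd x \<le> snd y) m"

lemma null_trop:
  "m \<in> null (trop F) \<longleftrightarrow> set_mset m \<subseteq> carrier F \<times> UNIV \<and>
    (m = {#} \<or> image_mset fst (min_part m) \<in> null F)"
  by (simp add: trop_def min_part_def)

text \<open>Multiplication by a fixed unit shifts all valuations equally and the involution fixes
  them; both therefore commute with passing to the terms of least valuation.\<close>

lemma min_part_image:
  assumes "\<And>x y. x \<in># m \<Longrightarrow> y \<in># m \<Longrightarrow> snd (f x) \<le> snd (f y) \<longleftrightarrow> snd x \<le> snd y"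
  shows "min_part (image_mset f m) = image_mset f (min_part m)"
  unfolding min_part_def filter_mset_image_mset
  by (intro arg_cong[of _ _ "image_mset f"] filter_mset_cong refl) (use assms in auto)

lemma (in tract) trop_tract: "tract (trop F :: ('a \<times> 'g::linordered_ab_group_add) tract_struct)"
proof -
  let ?T = "trop F :: ('a \<times> 'g) tract_struct"
  interpret T: comm_group ?T
  proof (rule comm_groupI)
    fix x assume "x \<in> carrier ?T"
    then obtain a g where "x = (a, g)" "a \<in> carrier F" by auto
    then show "\<exists>y\<in>carrier ?T. y \<otimes>\<^bsub>?T\<^esub> x = \<one>\<^bsub>?T\<^esub>"
      by (intro bexI[of _ "(inv a, - g)"]) auto
  qed (auto simp: m_ac ac_simps)
  show ?thesis
  proof
    show "m \<in> null ?T \<Longrightarrow> set_mset m \<subseteq> carrier ?T" for m by (simp add: null_trop)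
    show "{#} \<in> null ?T" by (simp add: null_trop)
    show "{#\<one>\<^bsub>?T\<^esub>#} \<notin> null ?T" using one_not_null by (simp add: null_trop min_part_def)
    show "\<exists>!e. e \<in> carrier ?T \<and> {#\<one>\<^bsub>?T\<^esub>, e#} \<in> null ?T"
    proof (rule ex1I[of _ "(neg_one F, 0)"])
      show "(neg_one F, 0) \<in> carrier ?T \<and> {#\<one>\<^bsub>?T\<^esub>, (neg_one F, 0)#} \<in> null ?T"
        using neg_one_spec by (simp add: null_trop min_part_def)
      fix e assume e: "e \<in> carrier ?T \<and> {#\<one>\<^bsub>?T\<^esub>, e#} \<in> null ?T"
      obtain b h where bh: "e = (b, h)" by (cases e)
      have b: "b \<in> carrier F" using e bh by simp
      have null: "image_mset fst (min_part {#(\<one>, 0), (b, h)#}) \<in> null F"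
        using e bh by (simp add: null_trop)
      \<comment> \<open>Unless the valuation is that of 1, only one term is of least valuation and
        the sum is not null. At valuation zero the uniqueness of -1 in \<open>F\<close>
        decides.\<close>
      consider "h < 0" | "h = 0" | "0 < h" by (rule linorder_cases)
      then show "e = (neg_one F, 0)"
      proof cases
        case 1
        then have "h \<le> 0" "\<not> 0 \<le> h" by auto
        then have "{#b#} \<in> null F" using null by (simp add: min_part_def)
        then show ?thesis using singleton_not_null b by blast
      next
        case 2
        then have "{#\<one>, b#} \<in> null F" using null by (simp add: min_part_def)
        then show ?thesis using neg_one_unique b bh 2 by blast
      next
        case 3
        then have "0 \<le> h" "\<not> h \<le> 0" by auto
        then have "{#\<one>#} \<in> null F" using null by (simp add: min_part_def)
        then show ?thesis using one_not_null by blast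
      qed
    qed
    show "image_mset (\<lambda>a. c \<otimes>\<^bsub>?T\<^esub> a) m \<in> null ?T" if "c \<in> carrier ?T" "m \<in> null ?T" for c m
    proof -
      obtain a g where c: "c = (a, g)" by (cases c)
      have "min_part (image_mset (\<lambda>x. c \<otimes>\<^bsub>?T\<^esub> x) m) = image_mset (\<lambda>x. c \<otimes>\<^bsub>?T\<^esub> x) (min_part m)"
        by (rule min_part_image) (auto simp: c)
      moreover have "image_mset fst (image_mset (\<lambda>x. c \<otimes>\<^bsub>?T\<^esub> x) (min_part m)) =
          image_mset (\<lambda>x. a \<otimes> x) (image_mset fst (min_part m))"
        unfolding multiset.map_comp by (intro image_mset_cong) (auto simp: c)
      ultimately show ?thesis
        using that scale_null[of a "image_mset fst (min_part m)"] by (auto simp: null_trop c)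
    qed
    show "involution ?T \<in> tract_hom ?T ?T"
      unfolding tract_hom_def
    proof (intro CollectI conjI ballI)
      show "involution ?T \<in> hom ?T ?T" by (auto simp: hom_def involution_mult)
      fix m assume m: "m \<in> null ?T"
      have "min_part (image_mset (involution ?T) m) = image_mset (involution ?T) (min_part m)"
        by (rule min_part_image) auto
      moreover have "image_mset fst (image_mset (involution ?T) (min_part m)) =
          image_mset (involution F) (image_mset fst (min_part m))"
        unfolding multiset.map_comp by (intro image_mset_cong) auto
      ultimately show "image_mset (involution ?T) m \<in> null ?T"
        using m involution_null[of "image_mset fst (min_part m)"] by (auto simp: null_trop)
    qed
    show "a \<in> carrier ?T \<Longrightarrow> involution ?T (involution ?T a) = a" for a
      using involution_involution by auto
  qed
qed

lemma (in tract) neg_one_trop: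
  "neg_one (trop F :: ('a \<times> 'g::linordered_ab_group_add) tract_struct) = (neg_one F, 0)"
proof -
  interpret T: tract "trop F :: ('a \<times> 'g) tract_struct" by (rule trop_tract)
  show ?thesis
    by (rule T.neg_one_unique[symmetric])
      (use neg_one_spec in \<open>simp_all add: null_trop min_part_def\<close>)
qed

lemma (in tract) sign_unit_trop:
  "sign_unit (trop F :: ('a \<times> 'g::linordered_ab_group_add) tract_struct) n =
    map_option (\<lambda>a. (a, 0)) (sign_unit F n)"
  by (simp add: sign_unit_def neg_one_trop)

text \<open>In the exponent, \<open>crossings J {j}\<close> and \<open>crossings I {j}\<close> count
  the elements of \<open>J\<close> and of \<open>I\<close> above \<open>j\<close>. The comparison is
  strict, so \<open>j\<close> itself, which lies in \<open>J\<close>, does not count.\<close>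

definition plucker_term ::
  "'a tract_struct \<Rightarrow> ('e::linorder set \<Rightarrow> 'a option) \<Rightarrow> 'e set \<Rightarrow> 'e set \<Rightarrow> 'e \<Rightarrow> 'a option" where
  "plucker_term F P I J j =
    sign_unit F (crossings J {j} + crossings I {j}) \<odot>\<^bsub>F\<^esub> (P (insert j I) \<odot>\<^bsub>F\<^esub> P (J - {j}))"

lemma plucker_term_eq_None_iff:
  "plucker_term F P I J j = None \<longleftrightarrow> P (insert j I) = None \<or> P (J - {j}) = None"
  by (simp add: plucker_term_def)

lemma nonzero_functionD:
  assumes "nonzero_function F E r P"
  shows "P I \<in> ocarrier F" "P I \<noteq> None \<Longrightarrow> I \<subseteq> E" "P I \<noteq> None \<Longrightarrow> card I = r"
  using assms unfolding nonzero_function_def subsets_def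
  by (cases "P I"; auto)+

context tract
begin

lemma plucker_term_closed [simp]: "(\<And>I. P I \<in> ocarrier F) \<Longrightarrow> plucker_term F P I J j \<in> ocarrier F"
  by (simp add: plucker_term_def)

lemma plucker_relation_iff:
  assumes "\<And>I. P I \<in> ocarrier F"
  shows "plucker_relation F P I J \<longleftrightarrow> formal_sum (plucker_term F P I J) (J - I) \<in> null F"
proof -
  have "formal_sum (\<lambda>j. signed F ((-1) ^ (card {j' \<in> J. j < j'} + card {i \<in> I. j < i}))
      (P (insert j I) \<odot> P (J - {j}))) (J - I) = formal_sum (plucker_term F P I J) (J - I)"
    unfolding crossings_singleton_right[symmetric] plucker_term_def
    by (intro formal_sum_cong refl signed_eq omult_closed assms)
  then show ?thesis unfolding plucker_relation_def by simp
qed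

lemma plucker_bases:
  assumes "plucker Weak F E r P"
  shows "bases E {I. P I \<noteq> None} r"
  using assms by unfold_locales (auto simp: nonzero_function_def subsets_def)

lemma plucker_nonzero_function: "plucker k F E r P \<Longrightarrow> nonzero_function F E r P"
  by (cases k) auto

text \<open>Only the exchange axiom for the support has to be shown. In the relation for
  \<open>A - {x}\<close> and \<open>insert x B\<close> the term at \<open>x\<close> is the product
  of the values at \<open>A\<close> and \<open>B\<close> up to sign; being nonzero, it forces
  another nonzero term, whose index is the element to exchange.\<close>

lemma plucker_imp_weak:
  assumes E: "finite E" and P: "plucker k F E r P"
  shows "plucker Weak F E r P"
proof (cases k)
  case Strong
  note nz = plucker_nonzero_function[OF P]
  have rel: "plucker_relation F P I J" if "I \<subseteq> E" "card I + 1 = r" "J \<in> subsets E (r + 1)" for I J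
    using P that Strong by simp
  have "\<exists>y\<in>B - A. P (insert y (A - {x})) \<noteq> None"
    if A: "P A \<noteq> None" and B: "P B \<noteq> None" and x: "x \<in> A - B" for A B x
  proof -
    have sub: "A \<subseteq> E" "B \<subseteq> E" "card A = r" "card B = r" using nonzero_functionD[OF nz] A B by auto
    then have fin: "finite A" "finite B" using E finite_subset by auto
    let ?I = "A - {x}" and ?J = "insert x B"
    have "card ?I + 1 = r" using x sub fin by (metis DiffD1 Suc_eq_plus1 card.remove)
    moreover have "?J \<in> subsets E (r + 1)" using x sub fin by (auto simp: subsets_def)
    ultimately have "plucker_relation F P ?I ?J" using sub by (intro rel) auto
    then have "formal_sum (plucker_term F P ?I ?J) (?J - ?I) \<in> null F"
      using plucker_relation_iff nonzero_functionD(1)[OF nz] by blast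
    moreover have "insert x ?I = A" "?J - {x} = B" using x by auto
    then have "plucker_term F P ?I ?J x \<noteq> None" using A B by (simp add: plucker_term_eq_None_iff)
    ultimately obtain j where "j \<in> ?J - ?I" "j \<noteq> x" "plucker_term F P ?I ?J j \<noteq> None"
      using null_sum_other_term[of "plucker_term F P ?I ?J" "?J - ?I" x] x
        nonzero_functionD(1)[OF nz] plucker_term_closed by blast
    then show ?thesis unfolding plucker_term_eq_None_iff by blast
  qed
  moreover have "{I. P I \<noteq> None} \<subseteq> Pow E" using nonzero_functionD[OF nz] by blast
  moreover have "{I. P I \<noteq> None} \<noteq> {}" using nz unfolding nonzero_function_def by blast
  ultimately have "matroid_bases E {I. P I \<noteq> None}" using E unfolding matroid_bases_def by blast
  then show ?thesis using nz rel by simp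
qed (use P in simp)

text \<open>Zero terms have valuation \<open>Infty\<close>, so as soon as one term is nonzero they
  are not minimal and the selected terms are those of the tropical null set. If all terms are zero,
  every index is minimal, but \<open>theta\<close> gives \<open>None\<close> and the sum is
  empty.\<close>

lemma trop_null_sum:
  fixes f :: "'e \<Rightarrow> ('a \<times> 'g::linordered_ab_group_add) option"
  assumes "formal_sum f J \<in> null (trop F)" "finite J"
  shows "formal_sum (\<lambda>j. if \<forall>i\<in>J. val (f j) \<le> val (f i) then theta (f j) else None) J \<in> null F"
    (is "formal_sum ?g J \<in> _")
proof (cases "\<forall>j\<in>J. f j = None")
  case True
  then have "formal_sum ?g J = {#}" by (intro formal_sum_empty) (simp add: theta_def)
  then show ?thesis using zero_null by simp
next
  case False
  let ?S = "{j \<in> J. f j \<noteq> None}" and ?m = "formal_sum f J"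
  let ?min = "\<lambda>j. \<forall>i\<in>?S. snd (the (f j)) \<le> snd (the (f i))"
  have fin: "finite ?S" using assms(2) by simp
  have set: "set_mset ?m = (\<lambda>i. the (f i)) ` ?S"
    using fin by (simp add: formal_sum_def)
  have "min_part ?m = image_mset (\<lambda>j. the (f j)) (filter_mset ?min (mset_set ?S))"
  proof -
    have "(\<forall>y\<in>#?m. snd x \<le> snd y) \<longleftrightarrow> (\<forall>i\<in>?S. snd x \<le> snd (the (f i)))" for x
      unfolding set by blast
    then have "min_part ?m = filter_mset (\<lambda>x. \<forall>i\<in>?S. snd x \<le> snd (the (f i))) ?m"
      unfolding min_part_def by (intro filter_mset_cong refl)
    then show ?thesis by (simp only: formal_sum_def filter_mset_image_mset)
  qed
  also have "filter_mset ?min (mset_set ?S) = mset_set {j \<in> ?S. ?min j}" using fin by simp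
  finally have mp: "image_mset fst (min_part ?m) =
      image_mset (\<lambda>j. fst (the (f j))) (mset_set {j \<in> ?S. ?min j})"
    by (simp add: multiset.map_comp comp_def)
  have le: "(\<forall>i\<in>J. val (f j) \<le> val (f i)) \<longleftrightarrow> j \<in> ?S \<and> ?min j" if "j \<in> J" for j
  proof (cases "f j")
    case None
    obtain i where "i \<in> J" "f i \<noteq> None" using False by blast
    moreover from this have "\<not> val (f j) \<le> val (f i)"
      using None by (auto simp: val_def less_eq_ext_def)
    ultimately show ?thesis using None by auto
  next
    case (Some x)
    have "val (f j) \<le> val (f i) \<longleftrightarrow> (f i \<noteq> None \<longrightarrow> snd (the (f j)) \<le> snd (the (f i)))" for i
      by (cases x; cases "f i") (auto simp: val_def less_eq_ext_def Some)
    then show ?thesis using that Some by auto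
  qed
  have "{j \<in> J. ?g j \<noteq> None} = {j \<in> ?S. ?min j}"
    using le by (auto simp: theta_def)
  moreover have "the (?g j) = fst (the (f j))" if "j \<in> {j \<in> ?S. ?min j}" for j
    using le[of j] that by (auto simp: theta_def)
  ultimately have "formal_sum ?g J = image_mset (\<lambda>j. fst (the (f j))) (mset_set {j \<in> ?S. ?min j})"
    unfolding formal_sum_def by (simp only:) (rule image_mset_cong, drule in_mset_setD, simp)
  moreover have "?m \<noteq> {#}" using set False by fastforce
  ultimately show ?thesis using assms(1) mp by (simp add: null_trop)
qed

text \<open>In a null tropical sum with a nonzero term the minimum is attained at least twice, since
  a single unit of \<open>F\<close> is not null. So no nonzero term lies strictly below all
  others.\<close>

lemma trop_null_sum_other_term:
  fixes f :: "'e \<Rightarrow> ('a \<times> 'g::linordered_ab_group_add) option"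
  assumes "formal_sum f J \<in> null (trop F)" "finite J" "z \<in> J" "f z = Some (a, g)"
    and closed: "\<And>j. j \<in> J \<Longrightarrow> f j \<in> ocarrier (trop F)"
  obtains j b h where "j \<in> J" "j \<noteq> z" "f j = Some (b, h)" "h \<le> g"
proof -
  let ?g = "\<lambda>j. if \<forall>i\<in>J. val (f j) \<le> val (f i) then theta (f j) else None"
  have null: "formal_sum ?g J \<in> null F" by (rule trop_null_sum[OF assms(1,2)])
  have cl: "?g j \<in> ocarrier F" if "j \<in> J" for j
    using closed[OF that] by (cases "f j") (auto simp: theta_def ocarrier_def)
  have "\<exists>j\<in>J. j \<noteq> z \<and> val (f j) \<le> val (f z)"
  proof (cases "?g z")
    case None
    then have "\<not> (\<forall>i\<in>J. val (f z) \<le> val (f i))" using assms(4) by (auto simp: theta_def split: if_splits)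
    then obtain i where "i \<in> J" "val (f i) < val (f z)" by (auto simp: not_le)
    then show ?thesis by (intro bexI[of _ i]) auto
  next
    case (Some c)
    then obtain j where j: "j \<in> J" "j \<noteq> z" "?g j \<noteq> None"
      using null_sum_other_term[OF null assms(3) _ cl[OF assms(3)]] by auto
    then have "val (f j) \<le> val (f z)" using assms(3) by (metis (mono_tags))
    then show ?thesis using j by blast
  qed
  then obtain j where j: "j \<in> J" "j \<noteq> z" "val (f j) \<le> val (f z)" by blast
  then obtain b h where "f j = Some (b, h)" "h \<le> g"
    using assms(4) by (cases "f j") (auto simp: val_def less_eq_ext_def)
  then show ?thesis using that j by blast
qed

end


section \<open>Initial vectors\<close>

text \<open>Sets with \<open>P B = None\<close> have weight \<open>Infty\<close> and impose no
  condition, and at such a set \<open>theta\<close> is \<open>None\<close>; the condition can thus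
  be stated within the value group.\<close>

lemma initial_vector_eq_Some_iff:
  fixes u :: "'e \<Rightarrow> 'g::linordered_ab_group_add"
  assumes nz: "nonzero_function (trop F) E r P"
  shows "initial_vector E r u P A = Some a \<longleftrightarrow>
    (\<exists>g. P A = Some (a, g) \<and> (\<forall>B b h. P B = Some (b, h) \<longrightarrow> g - sum u A \<le> h - sum u B))"
proof (cases "P A")
  case None
  then show ?thesis by (simp add: initial_vector_def theta_def)
next
  case (Some x)
  obtain a' g where x: "x = (a', g)" by (cases x)
  have sub: "B \<in> subsets E r" if "P B \<noteq> None" for B
    using that nonzero_functionD[OF nz] unfolding subsets_def by auto
  have val: "ext_minus (val (P B)) c = (case P B of None \<Rightarrow> Infty | Some (b, h) \<Rightarrow> Fin (h - c))" for B c
    by (simp add: val_def split: option.splits)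
  have "(\<forall>B\<in>subsets E r. ext_minus (val (P A)) (sum u A) \<le> ext_minus (val (P B)) (sum u B)) \<longleftrightarrow>
      (\<forall>B b h. P B = Some (b, h) \<longrightarrow> g - sum u A \<le> h - sum u B)"
  proof -
    have "ext_minus (val (P A)) (sum u A) \<le> ext_minus (val (P B)) (sum u B) \<longleftrightarrow>
        (\<forall>b h. P B = Some (b, h) \<longrightarrow> g - sum u A \<le> h - sum u B)" for B
      unfolding val by (auto simp: Some x less_eq_ext_def split: option.splits)
    then show ?thesis using sub by (metis option.distinct(1))
  qed
  moreover have "theta (P A) = Some a'" by (simp add: theta_def Some x)
  ultimately show ?thesis unfolding initial_vector_def using sub[of A] by (auto simp: Some x)
qed

context tract
begin

context
  fixes E :: "'e::linorder set" and r :: nat and u :: "'e \<Rightarrow> 'g::linordered_ab_group_add"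
    and P :: "'e set \<Rightarrow> ('a \<times> 'g) option" and Q :: "'e set \<Rightarrow> 'a option"
  assumes E: "finite E" and nz: "nonzero_function (trop F) E r P"
  defines "Q \<equiv> initial_vector E r u P"
begin

interpretation T: tract "trop F :: ('a \<times> 'g) tract_struct" by (rule trop_tract)

lemma initial_eq_Some_iff: "Q A = Some a \<longleftrightarrow>
    (\<exists>g. P A = Some (a, g) \<and> (\<forall>B b h. P B = Some (b, h) \<longrightarrow> g - sum u A \<le> h - sum u B))"
  unfolding Q_def by (rule initial_vector_eq_Some_iff[OF nz])

lemma vector_closed: "P A \<in> ocarrier (trop F)"
  by (rule nonzero_functionD[OF nz])

lemma initial_closed: "Q A \<in> ocarrier F"
proof (cases "Q A")
  case (Some a)
  then obtain g where "P A = Some (a, g)" unfolding initial_eq_Some_iff by blast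
  then show ?thesis using vector_closed[of A] Some by simp
qed simp

lemma finite_support: "finite {A. P A \<noteq> None}"
proof (rule finite_subset)
  show "{A. P A \<noteq> None} \<subseteq> Pow E" using nonzero_functionD(2)[OF nz] by blast
qed (simp add: E)

lemma support_nonempty: "{A. P A \<noteq> None} \<noteq> {}"
  using nz unfolding nonzero_function_def by auto

text \<open>Meaningful only on the support of \<open>P\<close>, to which its uses are restricted;
  elsewhere \<open>the None\<close> is an unspecified value.\<close>

definition twisted_weight :: "'e set \<Rightarrow> 'g" where
  "twisted_weight A = snd (the (P A)) - sum u A"

lemma initial_support: "{A. Q A \<noteq> None} = {A \<in> {A. P A \<noteq> None}. \<forall>B\<in>{A. P A \<noteq> None}. twisted_weight A \<le> twisted_weight B}"
proof -
  have "Q A \<noteq> None \<longleftrightarrow> P A \<noteq> None \<and> (\<forall>B. P B \<noteq> None \<longrightarrow> twisted_weight A \<le> twisted_weight B)" for A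
  proof (cases "P A")
    case None
    then show ?thesis using initial_eq_Some_iff[of A] by (cases "Q A") auto
  next
    case (Some x)
    then obtain a g where x: "P A = Some (a, g)" by (cases x) auto
    then have "(\<forall>B b h. P B = Some (b, h) \<longrightarrow> g - sum u A \<le> h - sum u B) \<longleftrightarrow>
        (\<forall>B. P B \<noteq> None \<longrightarrow> twisted_weight A \<le> twisted_weight B)"
      unfolding twisted_weight_def using x by (metis (mono_tags, opaque_lifting) not_None_eq option.sel prod.collapse snd_conv)
    then show ?thesis using initial_eq_Some_iff[of A] x by (cases "Q A") auto
  qed
  then show ?thesis by auto
qed

lemma initial_nonzero_function: "nonzero_function F E r Q"
proof -
  have "Min (twisted_weight ` {A. P A \<noteq> None}) \<in> twisted_weight ` {A. P A \<noteq> None}"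
    using finite_support support_nonempty by (intro Min_in) auto
  then obtain A where "P A \<noteq> None" "Min (twisted_weight ` {A. P A \<noteq> None}) = twisted_weight A" by blast
  moreover have "Min (twisted_weight ` {A. P A \<noteq> None}) \<le> twisted_weight B" if "P B \<noteq> None" for B
    using finite_support that by (intro Min_le) auto
  ultimately have "A \<in> {A. Q A \<noteq> None}" unfolding initial_support by simp
  then have "\<exists>I. Q I \<noteq> None" by blast
  moreover have "a \<in> carrier F" if "Q I = Some a" for I a using initial_closed[of I] that by simp
  moreover have "Q I = None" if "I \<notin> subsets E r" for I using that by (simp add: Q_def initial_vector_def)
  ultimately show ?thesis unfolding nonzero_function_def by blast
qed

text \<open>Moving \<open>j\<close> from \<open>J\<close> to \<open>I\<close> keeps the total
  weight, so the twist by \<open>u\<close> shifts all terms of one Pluecker relation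
  equally.\<close>

lemma sum_plucker_pair:
  assumes "finite I" "finite J" "j \<in> J - I"
  shows "sum u (insert j I) + sum u (J - {j}) = sum u I + sum u J"
  using assms by (simp add: sum.remove[of J j] algebra_simps)

lemma trop_plucker_term:
  assumes "P (insert j I) = Some (a, g)" "P (J - {j}) = Some (b, h)"
  obtains c where "plucker_term (trop F) P I J j = Some (c, g + h)"
    "sign_unit F (crossings J {j} + crossings I {j}) \<odot> (Some a \<odot> Some b) = Some c"
proof -
  obtain s where "sign_unit F (crossings J {j} + crossings I {j}) = Some s"
    using sign_unit_carrier by metis
  then show ?thesis using that assms by (simp add: plucker_term_def sign_unit_trop)
qed

text \<open>If some term of the initial relation is nonzero, both of its factors attain the global
  minimum of the twisted weight. A term of the tropical relation is then of least valuation exactly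
  when both of its factors attain that minimum, so the initial relation is the part of least
  valuation. If no such term exists, the sum is empty.\<close>

lemma initial_plucker_relation:
  assumes IJ: "finite I" "finite J" and rel: "plucker_relation (trop F) P I J"
  shows "plucker_relation F Q I J"
proof (cases "\<forall>j\<in>J - I. plucker_term F Q I J j = None")
  case True
  then show ?thesis
    unfolding plucker_relation_iff[OF initial_closed]
    using zero_null formal_sum_empty[of "J - I" "plucker_term F Q I J"] by simp
next
  case False
  let ?t = "plucker_term (trop F) P I J"
  obtain k a0 b0 where k: "k \<in> J - I" "Q (insert k I) = Some a0" "Q (J - {k}) = Some b0"
    using False by (auto simp: plucker_term_eq_None_iff)
  obtain g0 h0 where g0: "P (insert k I) = Some (a0, g0)"
      "\<And>B b h. P B = Some (b, h) \<Longrightarrow> g0 - sum u (insert k I) \<le> h - sum u B"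
    and h0: "P (J - {k}) = Some (b0, h0)"
      "\<And>B b h. P B = Some (b, h) \<Longrightarrow> h0 - sum u (J - {k}) \<le> h - sum u B"
    using k(2,3) unfolding initial_eq_Some_iff by blast
  obtain c0 where c0: "?t k = Some (c0, g0 + h0)" using trop_plucker_term[OF g0(1) h0(1)] by blast
  have eq: "plucker_term F Q I J j =
      (if \<forall>i\<in>J - I. val (?t j) \<le> val (?t i) then theta (?t j) else None)" if j: "j \<in> J - I" for j
  proof (cases "P (insert j I) = None \<or> P (J - {j}) = None")
    case True
    then have "Q (insert j I) = None \<or> Q (J - {j}) = None"
      using initial_eq_Some_iff by (metis option.distinct(1) not_Some_eq)
    then have "plucker_term F Q I J j = None" "?t j = None"
      using True by (simp_all add: plucker_term_eq_None_iff)
    then show ?thesis by (simp add: theta_def)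
  next
    case False
    then obtain a g b h where P: "P (insert j I) = Some (a, g)" "P (J - {j}) = Some (b, h)" by auto
    obtain c where c: "?t j = Some (c, g + h)"
        "sign_unit F (crossings J {j} + crossings I {j}) \<odot> (Some a \<odot> Some b) = Some c"
      using trop_plucker_term[OF P] by blast
    define x y where "x = g - sum u (insert j I)" and "y = h - sum u (J - {j})"
    define x0 y0 where "x0 = g0 - sum u (insert k I)" and "y0 = h0 - sum u (J - {k})"
    \<comment> \<open>Both \<open>x0\<close> and \<open>y0\<close> equal the least twisted weight,
      because both factors at \<open>k\<close> survive in the initial vector.\<close>
    have xy: "x0 \<le> x" "y0 \<le> x" "x0 \<le> y" "y0 \<le> y" "x0 = y0"
      unfolding x_def y_def x0_def y0_def using P g0 h0 by (auto intro: antisym)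
    have gh: "g + h = x + y + (sum u I + sum u J)" "g0 + h0 = x0 + y0 + (sum u I + sum u J)"
      using sum_plucker_pair[OF IJ j] sum_plucker_pair[OF IJ k(1)]
      by (simp_all add: x_def y_def x0_def y0_def algebra_simps)
    have min: "x0 + y0 + (sum u I + sum u J) \<le> g'" if i: "i \<in> J - I" and ti: "?t i = Some (c', g')" for i c' g'
    proof -
      obtain a1 g1 b1 h1 where P1: "P (insert i I) = Some (a1, g1)" "P (J - {i}) = Some (b1, h1)"
        using ti by (cases "P (insert i I)"; cases "P (J - {i})") (auto simp: plucker_term_def)
      then have "g' = g1 + h1" using ti trop_plucker_term[OF P1] by auto
      also have "\<dots> = (g1 - sum u (insert i I)) + (h1 - sum u (J - {i})) + (sum u I + sum u J)"
        using sum_plucker_pair[OF IJ i] by (simp add: algebra_simps)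
      finally show ?thesis using add_mono[OF g0(2)[OF P1(1)] h0(2)[OF P1(2)]]
        by (simp add: x0_def y0_def)
    qed
    show ?thesis
    proof (cases "x = x0 \<and> y = y0")
      case True
      have "Q (insert j I) = Some a" "Q (J - {j}) = Some b"
        unfolding initial_eq_Some_iff using P True xy(5) g0(2) h0(2)
        by (auto simp: x_def y_def x0_def y0_def)
      then have "plucker_term F Q I J j = Some c" using c(2) by (simp add: plucker_term_def)
      moreover have "val (?t j) \<le> val (?t i)" if "i \<in> J - I" for i
        using min[OF that] c(1) gh True
        by (cases "?t i") (auto simp: val_def less_eq_ext_def)
      ultimately show ?thesis using c(1) by (simp add: theta_def)
    next
      case False
      \<comment> \<open>A factor above the minimum cannot be compensated by the other one, which is
        at least the minimum.\<close>
      then have "x0 + y0 < x + y"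
        using xy by (metis add_less_le_mono add_le_less_mono order_le_less)
      then have "\<not> val (?t j) \<le> val (?t k)" using c(1) c0 gh by (simp add: val_def less_eq_ext_def)
      moreover have "Q (insert j I) = None \<or> Q (J - {j}) = None"
      proof (rule ccontr)
        assume "\<not> ?thesis"
        then obtain a' b' where "Q (insert j I) = Some a'" "Q (J - {j}) = Some b'" by auto
        then have "x \<le> x0" "y \<le> y0"
          unfolding initial_eq_Some_iff x_def y_def x0_def y0_def using P g0(1) h0(1) by auto
        then show False using xy False by auto
      qed
      ultimately show ?thesis using k(1) by (auto simp: plucker_term_eq_None_iff)
    qed
  qed
  have "formal_sum ?t (J - I) \<in> null (trop F)"
    using rel T.plucker_relation_iff[of P] vector_closed by blast
  from trop_null_sum[OF this] IJ have
    "formal_sum (\<lambda>j. if \<forall>i\<in>J - I. val (?t j) \<le> val (?t i) then theta (?t j) else None) (J - I) \<in> null F"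
    by simp
  moreover have "formal_sum (plucker_term F Q I J) (J - I) =
      formal_sum (\<lambda>j. if \<forall>i\<in>J - I. val (?t j) \<le> val (?t i) then theta (?t j) else None) (J - I)"
    by (rule formal_sum_cong[OF refl eq])
  ultimately show ?thesis unfolding plucker_relation_iff[OF initial_closed] by (simp only:)
qed

text \<open>At distance two the sets \<open>C - {z}\<close> and \<open>insert z C'\<close> have a
  difference of three elements, so the relation is one that weak vectors satisfy. Its term at
  \<open>z\<close> has the valuation of \<open>C\<close> plus that of \<open>C'\<close>; some other
  term has valuation no larger and yields the exchange.\<close>

lemma local_weight_exchange:
  assumes P: "plucker Weak (trop F) E r P" and C: "P C \<noteq> None" "P C' \<noteq> None" "z \<in> C - C'" "card (C - C') = 2"
  shows "valuated_exchange {A. P A \<noteq> None} twisted_weight C C' z"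
proof -
  have sub: "C \<subseteq> E" "C' \<subseteq> E" "card C = r" "card C' = r" using nonzero_functionD[OF nz] C by auto
  then have fin: "finite C" "finite C'" using E finite_subset by auto
  let ?I = "C - {z}" and ?J = "insert z C'"
  have JI: "?J - ?I = insert z (C' - C)" using C by auto
  have "card (C' - C) = 2"
    using card_le_sym_Diff[OF fin] card_le_sym_Diff[OF fin(2,1)] sub C(4) by simp
  then have card3: "card (?J - ?I) = 3" unfolding JI using fin C by simp
  have "card ?I + 1 = r" using C sub fin by (metis DiffD1 Suc_eq_plus1 card.remove)
  moreover have "?J \<in> subsets E (r + 1)" using C sub fin by (auto simp: subsets_def)
  moreover have "?I \<subseteq> E" using sub by blast
  ultimately have "plucker_relation (trop F) P ?I ?J"
    using P card3 unfolding plucker.simps by blast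
  then have null: "formal_sum (plucker_term (trop F) P ?I ?J) (?J - ?I) \<in> null (trop F)"
    using T.plucker_relation_iff[of P] vector_closed by blast
  obtain a g b h where ab: "P C = Some (a, g)" "P C' = Some (b, h)" using C(1,2) by auto
  have z: "insert z ?I = C" "?J - {z} = C'" using C(3) by auto
  obtain c where c: "plucker_term (trop F) P ?I ?J z = Some (c, g + h)"
    using trop_plucker_term[of z ?I a g ?J b h] ab z by metis
  have fin': "finite (?J - ?I)" and zJ: "z \<in> ?J - ?I" using fin by auto
  obtain j b' h' where j: "j \<in> ?J - ?I" "j \<noteq> z" "plucker_term (trop F) P ?I ?J j = Some (b', h')"
    "h' \<le> g + h"
    using trop_null_sum_other_term[OF null fin' zJ c T.plucker_term_closed[OF vector_closed]] by blast
  then have jC: "j \<in> C' - C" using JI by blast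
  obtain a1 g1 b1 h1 where P1: "P (insert j ?I) = Some (a1, g1)" "P (?J - {j}) = Some (b1, h1)"
    using j(3) by (cases "P (insert j ?I)"; cases "P (?J - {j})") (auto simp: plucker_term_def)
  have "h' = g1 + h1" using j(3) trop_plucker_term[OF P1] by auto
  then have le: "g1 + h1 \<le> g + h" using j(4) by simp
  have eq: "?J - {j} = insert z (C' - {j})" using j(2) by blast
  have "sum u (insert j ?I) + sum u (?J - {j}) = sum u C + sum u C'"
    using sum_plucker_pair[of ?I ?J j] sum_plucker_pair[of ?I ?J z] fin j(1) C(3) z by simp
  then have "twisted_weight (insert j ?I) + twisted_weight (?J - {j}) \<le> twisted_weight C + twisted_weight C'"
    unfolding twisted_weight_def P1 ab using le by (simp add: algebra_simps)
  then show ?thesis unfolding valuated_exchange_def using jC P1 eq by (intro bexI[of _ j]) auto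
qed

lemma initial_plucker:
  assumes "plucker k (trop F) E r P"
  shows "plucker k F E r Q"
proof -
  have rel: "plucker_relation F Q I J"
    if "I \<subseteq> E" "J \<in> subsets E (r + 1)" "plucker_relation (trop F) P I J" for I J
    using initial_plucker_relation[OF _ _ that(3)] that E finite_subset unfolding subsets_def by blast
  show ?thesis
  proof (cases k)
    case Strong
    then show ?thesis using assms rel initial_nonzero_function by simp
  next
    case Weak
    then have P: "plucker Weak (trop F) E r P" using assms by simp
    interpret bases E "{A. P A \<noteq> None}" r by (rule T.plucker_bases[OF P])
    have "matroid_bases E {A. Q A \<noteq> None}"
      unfolding initial_support
      by (rule minimizers_matroid_bases) (use local_weight_exchange[OF P] in auto)
    then show ?thesis using Weak P rel initial_nonzero_function by simp
  qed
qed

end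

end


section \<open>Minor vectors and dual vectors\<close>

text \<open>The sign sorts \<open>I\<close> followed by \<open>S\<close>. The same formula serves
  both minors: \<open>S\<close> is a largest possible part of a basis in the contracted set, or a
  smallest possible part in the deleted set.\<close>

definition minor_vector ::
  "'a tract_struct \<Rightarrow> 'e::linorder set \<Rightarrow> 'e set \<Rightarrow> ('e set \<Rightarrow> 'a option) \<Rightarrow> 'e set \<Rightarrow> 'a option" where
  "minor_vector F E S P I =
    (if I \<subseteq> E then sign_unit F (crossings I S) \<odot>\<^bsub>F\<^esub> P (I \<union> S) else None)"

lemma minor_vector_eq_None_iff:
  "minor_vector F E S P I = None \<longleftrightarrow> \<not> I \<subseteq> E \<or> P (I \<union> S) = None"
  by (simp add: minor_vector_def)

lemma dual_vector_eq_None_iff: "dual_vector F E P I = None \<longleftrightarrow> \<not> I \<subseteq> E \<or> P (E - I) = None"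
  by (simp add: dual_vector_def)

lemma crossings_self:
  assumes "finite X" "a \<in> X"
  shows "crossings X {a} + crossings {a} X = card X - 1"
proof -
  obtain Y where Y: "X = insert a Y" "a \<notin> Y" using assms(2) by (metis Set.set_insert)
  then have fin: "finite Y" using assms(1) by simp
  have "crossings X {a} = crossings Y {a}" "crossings {a} X = crossings {a} Y"
    using Y fin crossings_insert_left[of Y "{a}" a] crossings_insert_right[of "{a}" Y a] by simp_all
  then show ?thesis using crossings_commute[of Y "{a}"] Y fin by simp
qed

context tract
begin

lemma sign_unit_omult_eq_swap:
  assumes "sign_unit F m \<odot> x = sign_unit F n \<odot> y" "even (m + n + p + q)"
    and "x \<in> ocarrier F" "y \<in> ocarrier F"
  shows "sign_unit F p \<odot> x = sign_unit F q \<odot> y"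
proof -
  have "sign_unit F (p + m) \<odot> (sign_unit F m \<odot> x) = sign_unit F (p + m) \<odot> (sign_unit F n \<odot> y)"
    using assms(1) by simp
  then have "sign_unit F (p + m + m) \<odot> x = sign_unit F (p + m + n) \<odot> y"
    using assms(3,4) by (simp add: sign_unit_left_add)
  moreover have "sign_unit F (p + m + m) = sign_unit F p" "sign_unit F (p + m + n) = sign_unit F q"
    using assms(2) by (auto intro!: sign_unit_cong)
  ultimately show ?thesis by simp
qed

lemma minor_vector_closed: "(\<And>I. P I \<in> ocarrier F) \<Longrightarrow> minor_vector F E S P I \<in> ocarrier F"
  by (simp add: minor_vector_def)

text \<open>The factor relating the two terms does not depend on \<open>j\<close>, so the two sums
  differ by a common unit.\<close>

lemma plucker_term_minor_vector:
  assumes P: "\<And>I. P I \<in> ocarrier F" and E: "finite E" "finite S" "E \<inter> S = {}"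
    and IJ: "I \<subseteq> E" "J \<subseteq> E" "j \<in> J - I"
  shows "plucker_term F (minor_vector F E S P) I J j =
    sign_unit F (crossings I S + crossings J S) \<odot> plucker_term F P (I \<union> S) (J \<union> S) j"
proof -
  have fin: "finite I" "finite J" using IJ E finite_subset by auto
  have eq: "insert j I \<union> S = insert j (I \<union> S)" "J - {j} \<union> S = J \<union> S - {j}" using IJ E by auto
  define L where "L = J - {j}"
  have finL: "finite L" and jL: "j \<notin> L" and L: "J = insert j L" using fin IJ by (auto simp: L_def)
  have dis: "I \<inter> S = {}" "J \<inter> S = {}" and jI: "j \<notin> I" using IJ E by auto
  have crJ: "crossings J S = crossings {j} S + crossings L S"
    unfolding L by (rule crossings_insert_left[OF finL E(2) jL])
  note cr = crossings_insert_left[OF fin(1) E(2) jI] crJ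
    crossings_Un_left[OF fin(2) E(2) finite.insertI[OF finite.emptyI] dis(2), of j]
    crossings_Un_left[OF fin(1) E(2) finite.insertI[OF finite.emptyI] dis(1), of j]
  define X where "X = P (insert j (I \<union> S)) \<odot> P (J \<union> S - {j})"
  have X: "X \<in> ocarrier F" using P by (simp add: X_def)
  have "plucker_term F (minor_vector F E S P) I J j =
      sign_unit F (crossings J {j} + crossings I {j}) \<odot>
        ((sign_unit F (crossings (insert j I) S) \<odot> P (insert j (I \<union> S))) \<odot>
          (sign_unit F (crossings L S) \<odot> P (J \<union> S - {j})))"
    using IJ eq by (auto simp: plucker_term_def minor_vector_def L_def)
  also have "\<dots> = sign_unit F (crossings J {j} + crossings I {j} +
      (crossings (insert j I) S + crossings L S)) \<odot> X"
    using P by (simp add: omult_sign_unit_left sign_unit_left_add X_def)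
  also have "\<dots> = sign_unit F (crossings I S + crossings J S +
      (crossings (J \<union> S) {j} + crossings (I \<union> S) {j})) \<odot> X"
    unfolding cr by (intro arg_cong2[of _ _ _ _ "(\<odot>)"] sign_unit_cong refl) (simp, argo)
  also have "\<dots> = sign_unit F (crossings I S + crossings J S) \<odot> plucker_term F P (I \<union> S) (J \<union> S) j"
    unfolding plucker_term_def X_def[symmetric] using X by (simp add: sign_unit_left_add)
  finally show ?thesis .
qed

lemma null_sum_sign_unit:
  assumes "\<And>j. j \<in> J \<Longrightarrow> f j \<in> ocarrier F"
  shows "formal_sum (\<lambda>j. sign_unit F n \<odot> f j) J \<in> null F \<longleftrightarrow> formal_sum f J \<in> null F"
proof -
  obtain c where "c \<in> carrier F" "sign_unit F n = Some c" by (rule sign_unit_carrier)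
  then show ?thesis using formal_sum_scale[OF _ assms] by simp
qed

lemma plucker_relation_minor_vector:
  assumes P: "\<And>I. P I \<in> ocarrier F" and E: "finite E" "finite S" "E \<inter> S = {}"
    and IJ: "I \<subseteq> E" "J \<subseteq> E"
  shows "plucker_relation F (minor_vector F E S P) I J \<longleftrightarrow> plucker_relation F P (I \<union> S) (J \<union> S)"
proof -
  have "J \<union> S - (I \<union> S) = J - I" using IJ E by auto
  then have "plucker_relation F P (I \<union> S) (J \<union> S) \<longleftrightarrow>
      formal_sum (plucker_term F P (I \<union> S) (J \<union> S)) (J - I) \<in> null F"
    using plucker_relation_iff[of P] P by simp
  also have "\<dots> \<longleftrightarrow> formal_sum (\<lambda>j. sign_unit F (crossings I S + crossings J S) \<odot>
      plucker_term F P (I \<union> S) (J \<union> S) j) (J - I) \<in> null F"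
    by (rule null_sum_sign_unit[symmetric]) (use P in simp)
  also have "\<dots> \<longleftrightarrow> formal_sum (plucker_term F (minor_vector F E S P) I J) (J - I) \<in> null F"
    by (simp only: formal_sum_cong[OF refl plucker_term_minor_vector[OF P E IJ, symmetric]])
  also have "\<dots> \<longleftrightarrow> plucker_relation F (minor_vector F E S P) I J"
    using plucker_relation_iff[of "minor_vector F E S P"] minor_vector_closed P by blast
  finally show ?thesis by simp
qed

text \<open>Adjoining \<open>S\<close> to both index sets does not change \<open>J - I\<close>, so
  three-term relations come from three-term relations. The basis \<open>T\<close> between
  \<open>S\<close> and \<open>E' \<union> S\<close> guarantees a nonzero value, at
  \<open>T - S\<close>.\<close>

lemma minor_vector_plucker:
  assumes E: "finite E" "E' \<inter> S = {}" "E' \<union> S \<subseteq> E" and P: "plucker k F E r P"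
    and T: "P T \<noteq> None" "S \<subseteq> T" "T \<subseteq> E' \<union> S"
  shows "plucker k F E' (r - card S) (minor_vector F E' S P)"
proof -
  let ?Q = "minor_vector F E' S P"
  note nz = plucker_nonzero_function[OF P]
  note cl = nonzero_functionD(1)[OF nz]
  have fin: "finite E'" "finite S" using E finite_subset by auto
  have "card S \<le> card T"
    using T nonzero_functionD(2)[OF nz] E by (meson card_mono finite_subset)
  then have Sr: "card S \<le> r" using nonzero_functionD(3)[OF nz T(1)] by simp
  have card: "card (I \<union> S) = card I + card S" if "I \<subseteq> E'" for I
    using that E fin by (intro card_Un_disjoint) (auto intro: finite_subset)
  have "nonzero_function F E' (r - card S) ?Q"
    unfolding nonzero_function_def
  proof (intro conjI allI impI)
    fix I assume I: "I \<notin> subsets E' (r - card S)"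
    show "?Q I = None"
    proof (rule ccontr)
      assume "\<not> ?thesis"
      then have "I \<subseteq> E'" "P (I \<union> S) \<noteq> None" by (auto simp: minor_vector_eq_None_iff)
      then show False using I nonzero_functionD(3)[OF nz, of "I \<union> S"] card unfolding subsets_def by auto
    qed
  next
    fix I a assume "?Q I = Some a"
    then show "a \<in> carrier F" using minor_vector_closed[of P E' S I] cl by simp
  next
    have "T - S \<subseteq> E'" "T - S \<union> S = T" using T by auto
    then have "?Q (T - S) \<noteq> None" using T by (simp add: minor_vector_eq_None_iff)
    then show "\<exists>I. ?Q I \<noteq> None" by blast
  qed
  moreover have "plucker_relation F ?Q I J"
    if IJ: "I \<subseteq> E'" "card I + 1 = r - card S" "J \<in> subsets E' (r - card S + 1)"
      and k: "k = Weak \<Longrightarrow> card (J - I) = 3" for I J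
  proof -
    have J: "J \<subseteq> E'" "card J = r - card S + 1" using IJ unfolding subsets_def by auto
    have "J \<union> S - (I \<union> S) = J - I" using J E by auto
    moreover have "I \<union> S \<subseteq> E" "card (I \<union> S) + 1 = r" "J \<union> S \<in> subsets E (r + 1)"
      using IJ J E Sr card by (auto simp: subsets_def)
    ultimately have "plucker_relation F P (I \<union> S) (J \<union> S)" using P k by (cases k) auto
    then show ?thesis using plucker_relation_minor_vector[OF cl fin E(2) IJ(1) J(1)] by simp
  qed
  moreover have "matroid_bases E' {I. ?Q I \<noteq> None}" if "k = Weak"
  proof -
    interpret bases E "{I. P I \<noteq> None}" r by (rule plucker_bases) (use P that in simp)
    have ex: "\<exists>y\<in>B - A. P (insert y (A - {x})) \<noteq> None"
      if "P A \<noteq> None" "P B \<noteq> None" "x \<in> A - B" for A B x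
    proof -
      obtain y where "y \<in> B" "y \<notin> A" "insert y (A - {x}) \<in> {I. P I \<noteq> None}"
        using exchange[of A B x] \<open>P A \<noteq> None\<close> \<open>P B \<noteq> None\<close> \<open>x \<in> A - B\<close> by blast
      then show ?thesis by blast
    qed
    have "\<exists>y\<in>B - A. ?Q (insert y (A - {x})) \<noteq> None"
      if "?Q A \<noteq> None" "?Q B \<noteq> None" "x \<in> A - B" for A B x
    proof -
      have AB: "A \<subseteq> E'" "B \<subseteq> E'" "P (A \<union> S) \<noteq> None" "P (B \<union> S) \<noteq> None"
        using that by (auto simp: minor_vector_eq_None_iff)
      have "x \<in> (A \<union> S) - (B \<union> S)" using AB(1) that(3) E(2) by auto
      then obtain y where y: "y \<in> (B \<union> S) - (A \<union> S)" "P (insert y (A \<union> S - {x})) \<noteq> None"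
        using ex[OF AB(3,4)] by blast
      have "insert y (A \<union> S - {x}) = insert y (A - {x}) \<union> S" using AB(1) that(3) E(2) by auto
      then show ?thesis using y AB by (intro bexI[of _ y]) (auto simp: minor_vector_eq_None_iff)
    qed
    moreover have "{I. ?Q I \<noteq> None} \<subseteq> Pow E'" by (auto simp: minor_vector_eq_None_iff)
    moreover have "{I. ?Q I \<noteq> None} \<noteq> {}"
      using calculation(1) \<open>nonzero_function F E' (r - card S) ?Q\<close>
      unfolding nonzero_function_def by blast
    ultimately show ?thesis using fin(1) unfolding matroid_bases_def by blast
  qed
  ultimately show ?thesis by (cases k) auto
qed

section \<open>Pluecker relations of the dual vector\<close>

lemma dual_vector_eq:
  assumes "finite E" "P (E - I) \<in> ocarrier F"
  shows "dual_vector F E P I =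
    (if I \<subseteq> E then sign_unit F (crossings I (E - I)) \<odot> conj_opt (P (E - I)) else None)"
  using assms by (simp add: dual_vector_def split_sign_eq signed_eq)

lemma dual_vector_closed:
  "finite E \<Longrightarrow> (\<And>I. P I \<in> ocarrier F) \<Longrightarrow> dual_vector F E P I \<in> ocarrier F"
  by (simp add: dual_vector_eq)

text \<open>Complementation turns \<open>insert j I\<close> into \<open>E - I\<close> without
  \<open>j\<close>, and \<open>J\<close> without \<open>j\<close> into
  \<open>insert j (E - J)\<close>. The index sets of the relation are thus exchanged, and the terms
  agree up to the involution and a sign independent of \<open>j\<close>.\<close>

lemma plucker_term_dual_vector:
  assumes P: "\<And>I. P I \<in> ocarrier F" and E: "finite E" and IJ: "I \<subseteq> E" "J \<subseteq> E" "j \<in> J - I"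
  shows "plucker_term F (dual_vector F E P) I J j =
    sign_unit F (crossings I (E - I) + crossings J (E - J) + card (E - I) - 1 + card (E - J)) \<odot>
      conj_opt (plucker_term F P (E - J) (E - I) j)"
proof -
  define K where "K = E - insert j I"
  define L where "L = J - {j}"
  have fin: "finite I" "finite J" "finite K" "finite L" "finite (E - J)" "finite (E - I)"
    using IJ E finite_subset by (auto simp: K_def L_def)
  have sets: "E - I = insert j K" "j \<notin> K" "J = insert j L" "j \<notin> L" "E - L = insert j (E - J)"
    "j \<notin> I" "j \<notin> E - J" "E - I - {j} = K" "insert j I \<subseteq> E" "L \<subseteq> E"
    using IJ by (auto simp: K_def L_def)
  have cK: "card (E - I) = Suc (card K)" using sets(1,2) fin by simp
  have finj: "finite {j}" by simp
  have crI: "crossings I (E - I) = crossings I {j} + crossings I K"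
    unfolding sets(1) by (rule crossings_insert_right[OF fin(1,3) sets(2)])
  have crL: "crossings L (E - L) = crossings L {j} + crossings L (E - J)"
    unfolding sets(5) by (rule crossings_insert_right[OF fin(4,5) sets(7)])
  have crJ: "crossings J B = crossings {j} B + crossings L B" if "finite B" for B
    unfolding sets(3) by (rule crossings_insert_left[OF fin(4) that sets(4)])
  have crK: "crossings (E - I) {j} = crossings {j} {j} + crossings K {j}"
    unfolding sets(1) by (rule crossings_insert_left[OF fin(3) finj sets(2)])
  note cr = crossings_insert_left[OF fin(1,3) sets(6)] crI crL crJ[OF fin(5)] crK crJ[OF finj]
  \<comment> \<open>Elements below \<open>j\<close> are traded for elements above \<open>j\<close>.
    This is the origin of the cardinalities in the sign; \<open>card K\<close> is
    \<open>card (E - I) - 1\<close>, as \<open>j\<close> lies in \<open>E - I\<close>.\<close>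
  have comm: "crossings {j} K + crossings K {j} = card K"
    "crossings {j} (E - J) + crossings (E - J) {j} = card (E - J)"
    using crossings_commute[of "{j}" K] crossings_commute[of "{j}" "E - J"] fin sets(2,7) by simp_all
  define X where "X = conj_opt (P (insert j (E - J)) \<odot> P K)"
  have X: "X \<in> ocarrier F" "X = conj_opt (P K) \<odot> conj_opt (P (insert j (E - J)))"
    using P by (simp_all add: X_def conj_opt_mult omult_commute)
  have "plucker_term F (dual_vector F E P) I J j =
      sign_unit F (crossings J {j} + crossings I {j}) \<odot>
        ((sign_unit F (crossings (insert j I) K) \<odot> conj_opt (P K)) \<odot>
          (sign_unit F (crossings L (E - L)) \<odot> conj_opt (P (insert j (E - J)))))"
    using sets(9,10) unfolding plucker_term_def L_def[symmetric]
    by (simp add: dual_vector_eq[OF E P] K_def[symmetric] sets(5)[symmetric])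
  also have "\<dots> = sign_unit F (crossings J {j} + crossings I {j} +
      (crossings (insert j I) K + crossings L (E - L))) \<odot> X"
    using P by (simp add: omult_sign_unit_left sign_unit_left_add X(2))
  also have "sign_unit F (crossings J {j} + crossings I {j} +
      (crossings (insert j I) K + crossings L (E - L))) =
    sign_unit F (crossings I (E - I) + crossings J (E - J) + card (E - I) - 1 + card (E - J) +
      (crossings (E - I) {j} + crossings (E - J) {j}))"
    unfolding cr cK comm[symmetric] by (intro sign_unit_cong) (simp, argo)
  also have "\<dots> \<odot> X = sign_unit F (crossings I (E - I) + crossings J (E - J) + card (E - I) - 1 +
      card (E - J)) \<odot> conj_opt (plucker_term F P (E - J) (E - I) j)"
    unfolding plucker_term_def sets(8) X_def using P
    by (simp add: conj_opt_mult conj_opt_sign_unit sign_unit_left_add)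
  finally show ?thesis .
qed

lemma plucker_relation_dual_vector:
  assumes P: "\<And>I. P I \<in> ocarrier F" and E: "finite E" and IJ: "I \<subseteq> E" "J \<subseteq> E"
    and rel: "plucker_relation F P (E - J) (E - I)"
  shows "plucker_relation F (dual_vector F E P) I J"
proof -
  let ?n = "crossings I (E - I) + crossings J (E - J) + card (E - I) - 1 + card (E - J)"
  have "E - I - (E - J) = J - I" using IJ by auto
  then have "formal_sum (plucker_term F P (E - J) (E - I)) (J - I) \<in> null F"
    using rel plucker_relation_iff[of P] P by simp
  then have "formal_sum (\<lambda>j. conj_opt (plucker_term F P (E - J) (E - I) j)) (J - I) \<in> null F"
    by (rule formal_sum_conj)
  then have "formal_sum (\<lambda>j. sign_unit F ?n \<odot> conj_opt (plucker_term F P (E - J) (E - I) j)) (J - I)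
      \<in> null F"
    using null_sum_sign_unit[of "J - I" "\<lambda>j. conj_opt (plucker_term F P (E - J) (E - I) j)"] P by simp
  moreover have "formal_sum (plucker_term F (dual_vector F E P) I J) (J - I) =
    formal_sum (\<lambda>j. sign_unit F ?n \<odot> conj_opt (plucker_term F P (E - J) (E - I) j)) (J - I)"
    by (rule formal_sum_cong[OF refl plucker_term_dual_vector[OF P E IJ]])
  ultimately have "formal_sum (plucker_term F (dual_vector F E P) I J) (J - I) \<in> null F"
    by (simp only:)
  then show ?thesis
    using plucker_relation_iff[of "dual_vector F E P"] dual_vector_closed[OF E] P by blast
qed

lemma dual_vector_plucker:
  assumes E: "finite E" and P: "plucker k F E r P"
  shows "plucker k F E (card E - r) (dual_vector F E P)"
proof -
  let ?Q = "dual_vector F E P"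
  note nz = plucker_nonzero_function[OF P]
  note cl = nonzero_functionD(1)[OF nz]
  have card: "card (E - I) = card E - card I" "card I \<le> card E" if "I \<subseteq> E" for I
    using that E by (auto simp: card_Diff_subset finite_subset card_mono)
  obtain T where T: "P T \<noteq> None" using nz unfolding nonzero_function_def by blast
  then have TE: "T \<subseteq> E" "card T = r" using nonzero_functionD[OF nz] by auto
  then have r: "r \<le> card E" using card by blast
  have "nonzero_function F E (card E - r) ?Q"
    unfolding nonzero_function_def
  proof (intro conjI allI impI)
    fix I assume I: "I \<notin> subsets E (card E - r)"
    show "?Q I = None"
    proof (rule ccontr)
      assume "\<not> ?thesis"
      then have "I \<subseteq> E" "P (E - I) \<noteq> None" by (auto simp: dual_vector_eq_None_iff)
      then show False using I nonzero_functionD(3)[OF nz, of "E - I"] card unfolding subsets_def by auto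
    qed
  next
    fix I a assume "?Q I = Some a"
    then show "a \<in> carrier F" using dual_vector_closed[of E P I] E cl by simp
  next
    have "E - (E - T) = T" using TE by blast
    then have "?Q (E - T) \<noteq> None" using T by (simp add: dual_vector_eq_None_iff)
    then show "\<exists>I. ?Q I \<noteq> None" by blast
  qed
  moreover have "plucker_relation F ?Q I J"
    if IJ: "I \<subseteq> E" "card I + 1 = card E - r" "J \<in> subsets E (card E - r + 1)"
      and k: "k = Weak \<Longrightarrow> card (J - I) = 3" for I J
  proof -
    have J: "J \<subseteq> E" "card J = card E - r + 1" using IJ unfolding subsets_def by auto
    have "E - I - (E - J) = J - I" using IJ J by auto
    moreover have "E - J \<subseteq> E" "card (E - J) + 1 = r" "E - I \<in> subsets E (r + 1)"
      using IJ J r card[OF IJ(1)] card[OF J(1)] by (auto simp: subsets_def)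
    ultimately have "plucker_relation F P (E - J) (E - I)" using P k by (cases k) auto
    then show ?thesis using plucker_relation_dual_vector[OF cl E IJ(1) J(1)] by simp
  qed
  moreover have "matroid_bases E {I. ?Q I \<noteq> None}" if "k = Weak"
  proof -
    interpret bases E "{I. P I \<noteq> None}" r by (rule plucker_bases) (use P that in simp)
    have "{I. ?Q I \<noteq> None} = {B. B \<subseteq> E \<and> E - B \<in> {I. P I \<noteq> None}}"
      by (auto simp: dual_vector_eq_None_iff)
    then show ?thesis using dual_matroid_bases by simp
  qed
  ultimately show ?thesis by (cases k) auto
qed

end


section \<open>Proportionality of circuit vectors\<close>

lemma circuit_vector_eq_None_iff:
  "circuit_vector F P \<tau> i = None \<longleftrightarrow> i \<notin> circuit_in {I. P I \<noteq> None} \<tau>"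
  by (simp add: circuit_vector_def circuit_in_def)

lemma supp_circuit_vector: "supp (circuit_vector F P \<tau>) = circuit_in {I. P I \<noteq> None} \<tau>"
  unfolding supp_def circuit_vector_eq_None_iff by simp

context tract
begin

lemma circuit_vector_eq:
  assumes "\<And>I. P I \<in> ocarrier F" "i \<in> \<tau>"
  shows "circuit_vector F P \<tau> i = sign_unit F (crossings {i} \<tau>) \<odot> P (\<tau> - {i})"
  using assms by (simp add: circuit_vector_def crossings_singleton_left[symmetric] signed_eq)

lemma circuit_vector_closed: "(\<And>I. P I \<in> ocarrier F) \<Longrightarrow> circuit_vector F P \<tau> i \<in> ocarrier F"
  using circuit_vector_eq[of P i \<tau>] by (cases "i \<in> \<tau>") (simp_all add: circuit_vector_def)

text \<open>
  The third product in the three-term relation vanishes, so that it expresses the equality of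
  two ratios.
\<close>

lemma circuit_vector_exchange:
  assumes E: "finite E" and P: "plucker Weak F E r P" and tau: "\<tau> \<subseteq> E" "card \<tau> = r + 1"
    and xy: "x \<in> \<tau>" "y \<in> E - \<tau>" and ai: "a \<in> \<tau>" "i \<in> \<tau>" "a \<noteq> i" "a \<noteq> x" "i \<noteq> x"
    and vanish: "P (\<tau> - {x}) = None \<or> P (insert y (\<tau> - {a, i})) = None"
  defines "\<sigma> \<equiv> insert y (\<tau> - {x})"
  shows "circuit_vector F P \<sigma> i \<odot> circuit_vector F P \<tau> a =
    circuit_vector F P \<sigma> a \<odot> circuit_vector F P \<tau> i"
proof -
  note cl = nonzero_functionD(1)[OF plucker_nonzero_function[OF P]]
  \<comment> \<open>With \<sigma> obtained from \<tau> by trading \<open>x\<close> for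
    \<open>y\<close>, this choice makes \<open>\<tau> - I\<close> equal to \<open>{a, i, x}\<close>,
    hence the relation a three-term one.\<close>
  define I where "I = \<sigma> - {a, i}"
  have fin: "finite \<tau>" "finite \<sigma>" "finite I"
    using tau(1) E finite_subset by (auto simp: \<sigma>_def I_def)
  have card: "card \<sigma> = r + 1"
    unfolding \<sigma>_def using fin(1) xy tau(2) by (subst card_exchange) auto
  have sig: "a \<in> \<sigma>" "i \<in> \<sigma>" "\<sigma> \<subseteq> E" using ai xy tau(1) by (auto simp: \<sigma>_def)
  have "card I = r + 1 - 2"
    unfolding I_def using sig ai fin card by (subst card_Diff_subset) auto
  moreover have "r + 1 \<ge> 2"
    using card card_mono[of \<sigma> "{a, i}"] sig ai fin by auto
  ultimately have cI: "card I + 1 = r" by simp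
  have JI: "\<tau> - I = {a, i, x}" using ai xy by (auto simp: I_def \<sigma>_def)
  have ins: "insert a I = \<sigma> - {i}" "insert i I = \<sigma> - {a}" "insert x I = insert y (\<tau> - {a, i})"
    using sig ai xy by (auto simp: I_def \<sigma>_def)
  have I: "a \<notin> I" "i \<notin> I" "\<sigma> = insert a (insert i I)" using sig by (auto simp: I_def)
  have "card (\<tau> - I) = 3" unfolding JI using ai by simp
  moreover have "I \<subseteq> E" "\<tau> \<in> subsets E (r + 1)" using sig(3) tau by (auto simp: I_def subsets_def)
  ultimately have "plucker_relation F P I \<tau>" using P cI unfolding plucker.simps by blast
  then have "formal_sum (plucker_term F P I \<tau>) {a, i, x} \<in> null F"
    using plucker_relation_iff[of P] cl JI by simp
  then have "plucker_term F P I \<tau> i = sign_unit F 1 \<odot> plucker_term F P I \<tau> a"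
  proof (rule null_sum_two_terms)
    show "plucker_term F P I \<tau> j = None" if "j \<in> {a, i, x}" "j \<noteq> a" "j \<noteq> i" for j
    proof -
      have "j = x" using that by blast
      show ?thesis
        unfolding plucker_term_eq_None_iff \<open>j = x\<close> ins(3)
        using vanish by (rule disj_commute[THEN iffD1])
    qed
  qed (use ai cl in auto)
  then have eq: "sign_unit F (crossings \<tau> {i} + crossings I {i}) \<odot> (P (\<sigma> - {a}) \<odot> P (\<tau> - {i})) =
      sign_unit F (1 + (crossings \<tau> {a} + crossings I {a})) \<odot> (P (\<sigma> - {i}) \<odot> P (\<tau> - {a}))"
    unfolding plucker_term_def ins using cl by (simp add: sign_unit_left_add)
  have "crossings \<sigma> {a} = crossings {i} {a} + crossings I {a}"
    "crossings \<sigma> {i} = crossings {a} {i} + crossings I {i}"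
    unfolding I(3) using fin I(1,2) ai(3)
      crossings_insert_left[of "insert i I" "{a}" a] crossings_insert_left[of I "{a}" i]
      crossings_insert_left[of "insert i I" "{i}" a] crossings_insert_left[of I "{i}" i] by simp_all
  moreover have "crossings {i} {a} + crossings {a} {i} = 1" using ai(3) by auto
  moreover have "crossings \<sigma> {a} + crossings {a} \<sigma> = r" "crossings \<sigma> {i} + crossings {i} \<sigma> = r"
    "crossings \<tau> {a} + crossings {a} \<tau> = r" "crossings \<tau> {i} + crossings {i} \<tau> = r"
    using crossings_self[OF fin(2) sig(1)] crossings_self[OF fin(2) sig(2)]
      crossings_self[OF fin(1) ai(1)] crossings_self[OF fin(1) ai(2)] tau(2) card by simp_all
  \<comment> \<open>Each of \<tau> and \<sigma> paired with each of \<open>a\<close> and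
    \<open>i\<close> contributes \<open>r\<close>. The summand 1 is the crossing between
    \<open>a\<close> and \<open>i\<close> that \<open>I\<close> lacks in comparison with
    \<sigma>.\<close>
  ultimately have sum: "crossings \<tau> {i} + crossings I {i} + (1 + (crossings \<tau> {a} + crossings I {a})) +
      (crossings {a} \<sigma> + crossings {i} \<tau>) + (crossings {i} \<sigma> + crossings {a} \<tau>) = 4 * r"
    by linarith
  have ev: "even (crossings \<tau> {i} + crossings I {i} + (1 + (crossings \<tau> {a} + crossings I {a})) +
      (crossings {a} \<sigma> + crossings {i} \<tau>) + (crossings {i} \<sigma> + crossings {a} \<tau>))"
    unfolding sum by simp
  have "sign_unit F (crossings {a} \<sigma> + crossings {i} \<tau>) \<odot> (P (\<sigma> - {a}) \<odot> P (\<tau> - {i})) =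
      sign_unit F (crossings {i} \<sigma> + crossings {a} \<tau>) \<odot> (P (\<sigma> - {i}) \<odot> P (\<tau> - {a}))"
    by (rule sign_unit_omult_eq_swap[OF eq ev]) (use cl in simp_all)
  then show ?thesis
    using cl by (simp add: circuit_vector_eq[of P, OF cl] sig ai omult_sign_unit_left)
qed

text \<open>
  With \<open>A\<close> empty: two circuit vectors with the same support are proportional. In general, two
  circuit vectors of the contraction by \<open>A\<close> that arise from different bases of \<open>A\<close> are.
\<close>

lemma circuit_vectors_proportional:
  assumes E: "finite E" and P: "plucker Weak F E r P"
    and max: "\<And>T. P T \<noteq> None \<Longrightarrow> card (T \<inter> A) \<le> m"
    and "\<tau> \<subseteq> E" "card \<tau> = r + 1" "card (\<tau> \<inter> A) = m"
    and "\<sigma> \<subseteq> E" "card \<sigma> = r + 1" "card (\<sigma> \<inter> A) = m"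
    and "i \<in> \<tau>" "i \<in> \<sigma>" "i \<notin> A" "P (\<tau> - {i}) \<noteq> None" "P (\<sigma> - {i}) \<noteq> None"
    and "circuit_in {I. P I \<noteq> None} \<tau> - A \<subseteq> \<sigma>"
  shows "\<exists>c\<in>carrier F. \<forall>a. a \<notin> A \<longrightarrow> circuit_vector F P \<sigma> a = Some c \<odot> circuit_vector F P \<tau> a"
  using assms(4-)
proof (induction "card (\<tau> - \<sigma>)" arbitrary: \<tau> rule: less_induct)
  case less
  note tau = less.prems(1-3) and sig = less.prems(4-6) and i = less.prems(7-11) and sub = less.prems(12)
  note cl = nonzero_functionD(1)[OF plucker_nonzero_function[OF P]]
  have cvcl: "circuit_vector F P \<tau>' a \<in> ocarrier F" for \<tau>' a
    by (rule circuit_vector_closed) (rule cl)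
  interpret B: bases E "{I. P I \<noteq> None}" r by (rule plucker_bases[OF P])
  have fin: "finite \<tau>" "finite \<sigma>" using tau sig E finite_subset by auto
  show ?case
  proof (cases "\<tau> \<subseteq> \<sigma>")
    case True
    then have "\<tau> = \<sigma>" using tau(2) sig(2) fin by (simp add: card_subset_eq)
    then show ?thesis using cvcl by (intro bexI[of _ \<one>]) auto
  next
    case False
    \<comment> \<open>Elements outside \<open>A\<close> are exchanged before those in
      \<open>A\<close>: \<open>x \<in> A\<close> is chosen only when all of
      \<open>\<tau> - \<sigma>\<close> lies in \<open>A\<close>.\<close>
    then obtain x where x: "x \<in> \<tau>" "x \<notin> \<sigma>" "x \<in> A \<Longrightarrow> \<tau> - \<sigma> \<subseteq> A" by blast
    have xi: "x \<noteq> i" using x i by auto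
    obtain y where y: "y \<in> \<sigma> - {i}" "y \<notin> \<tau> - {i}" "insert y (\<tau> - {i} - {x}) \<in> {I. P I \<noteq> None}"
      using B.exchange[of "\<tau> - {i}" "\<sigma> - {i}" x] x(1,2) xi i(4,5) by blast
    have yt: "y \<notin> \<tau>" "y \<noteq> i" "y \<in> \<sigma>" using y(1,2) i(1) by auto
    let ?\<rho> = "insert y (\<tau> - {x})"
    have rhoi: "?\<rho> - {i} = insert y (\<tau> - {i} - {x})" using yt by auto
    have Prhoi: "P (?\<rho> - {i}) \<noteq> None" unfolding rhoi using y(3) by simp
    have finA: "finite (\<tau> \<inter> A)" using fin by simp
    \<comment> \<open>The exchange stays inside \<open>A\<close> or outside it. If
      \<open>x \<in> A\<close>, then \<tau> and \<sigma> already agree outside \<open>A\<close>. If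
      \<open>x \<notin> A\<close>, a new element in \<open>A\<close> would give a basis meeting
      \<open>A\<close> in more than \<open>m\<close> elements.\<close>
    have yx: "y \<in> A \<longleftrightarrow> x \<in> A"
    proof (cases "x \<in> A")
      case True
      have fA: "finite (\<tau> - A)" "finite (\<sigma> - A)" using fin by auto
      have "\<tau> - A \<subseteq> \<sigma> - A" using x(3)[OF True] by blast
      moreover have "card (\<tau> - A) = card (\<sigma> - A)"
        using tau(2,3) sig(2,3) fin by (simp add: card_Diff_subset_Int)
      ultimately have "\<tau> - A = \<sigma> - A" using fA by (simp add: card_subset_eq)
      then show ?thesis using True yt by blast
    next
      case False
      have "y \<notin> A"
      proof
        assume "y \<in> A"
        then have "(?\<rho> - {i}) \<inter> A = insert y (\<tau> \<inter> A)" using False i(3) yt by auto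
        then have "card (insert y (\<tau> \<inter> A)) \<le> m" using max[OF Prhoi] by simp
        then show False using finA yt tau(3) by simp
      qed
      then show ?thesis using False by simp
    qed
    have rho: "?\<rho> \<subseteq> E" "card ?\<rho> = r + 1" "i \<in> ?\<rho>"
    proof -
      show "?\<rho> \<subseteq> E" using tau(1) sig(1) yt(3) by blast
      show "card ?\<rho> = r + 1" using card_exchange[OF fin(1) x(1) yt(1)] tau(2) by simp
      show "i \<in> ?\<rho>" using i(1) xi by blast
    qed
    have cardA: "card (?\<rho> \<inter> A) = m"
    proof (cases "x \<in> A")
      case True
      then have "?\<rho> \<inter> A = insert y (\<tau> \<inter> A - {x})" using yx by auto
      moreover have "card (insert y (\<tau> \<inter> A - {x})) = card (\<tau> \<inter> A)"
        using True x yt finA by (intro card_exchange) auto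
      ultimately show ?thesis using tau(3) by simp
    next
      case False
      then have "?\<rho> \<inter> A = \<tau> \<inter> A" using yx by auto
      then show ?thesis using tau(3) by simp
    qed
    have xN: "P (\<tau> - {x}) = None" if "x \<notin> A"
      using sub that x unfolding circuit_in_def by blast
    have ratio: "circuit_vector F P ?\<rho> i \<odot> circuit_vector F P \<tau> a =
        circuit_vector F P ?\<rho> a \<odot> circuit_vector F P \<tau> i"
      if a: "a \<in> \<tau>" "a \<notin> A" "a \<noteq> i" "a \<noteq> x" for a
    proof (rule circuit_vector_exchange[OF E P tau(1,2) x(1) _ a(1) i(1) a(3,4) xi[symmetric]])
      show "y \<in> E - \<tau>" using yt sig(1) by auto
      \<comment> \<open>The vanishing factor depends on the position of \<open>x\<close>: outside
        \<open>A\<close> it is not in the circuit of \<tau>, while inside \<open>A\<close> the other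
        factor would belong to a basis meeting \<open>A\<close> in \<open>m + 1\<close>
        elements.\<close>
      show "P (\<tau> - {x}) = None \<or> P (insert y (\<tau> - {a, i})) = None"
      proof (cases "x \<in> A")
        case True
        then have "insert y (\<tau> - {a, i}) \<inter> A = insert y (\<tau> \<inter> A)" using yx a i(3) by auto
        then have "card (insert y (\<tau> - {a, i}) \<inter> A) = m + 1" using finA yt tau(3) by simp
        then have "P (insert y (\<tau> - {a, i})) = None"
          using max[of "insert y (\<tau> - {a, i})"] by (metis Suc_eq_plus1 not_less_eq_eq order_refl)
        then show ?thesis ..
      qed (use xN in simp)
    qed
    obtain p where p: "circuit_vector F P ?\<rho> i = Some p" "p \<in> carrier F"
      using cvcl[of ?\<rho> i] Prhoi rho(3) by (cases "circuit_vector F P ?\<rho> i")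
        (auto simp: circuit_vector_eq_None_iff circuit_in_def)
    obtain q where q: "circuit_vector F P \<tau> i = Some q" "q \<in> carrier F"
      using cvcl[of \<tau> i] i(1,4) by (cases "circuit_vector F P \<tau> i")
        (auto simp: circuit_vector_eq_None_iff circuit_in_def)
    \<comment> \<open>The factor is forced by the common coordinate \<open>i\<close>, where both
      circuit vectors are nonzero.\<close>
    let ?c = "inv q \<otimes> p"
    have c: "?c \<in> carrier F" using p q by simp
    have eq: "circuit_vector F P ?\<rho> a = Some ?c \<odot> circuit_vector F P \<tau> a" if a: "a \<notin> A" for a
    proof -
      consider "a = i" | "a = x" | "a = y" | "a \<notin> \<tau>" "a \<noteq> y" | "a \<in> \<tau>" "a \<noteq> i" "a \<noteq> x" by blast
      then show ?thesis
      proof cases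
        case 1
        have "p = inv q \<otimes> p \<otimes> q" using p q by (simp add: m_ac)
        then show ?thesis using 1 p q by simp
      next
        case 2
        then have "circuit_vector F P \<tau> a = None" "circuit_vector F P ?\<rho> a = None"
          using xN a x yt by (auto simp: circuit_vector_eq_None_iff circuit_in_def)
        then show ?thesis by simp
      next
        case 3
        have "?\<rho> - {y} = \<tau> - {x}" using yt by auto
        then have "circuit_vector F P \<tau> a = None" "circuit_vector F P ?\<rho> a = None"
          using xN 3 a yx yt by (auto simp: circuit_vector_eq_None_iff circuit_in_def)
        then show ?thesis by simp
      next
        case 4
        then have "circuit_vector F P \<tau> a = None" "circuit_vector F P ?\<rho> a = None"
          by (auto simp: circuit_vector_eq_None_iff circuit_in_def)
        then show ?thesis by simp
      next
        case 5
        have "Some p \<odot> circuit_vector F P \<tau> a = circuit_vector F P ?\<rho> a \<odot> Some q"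
          using ratio[OF 5(1) a 5(2,3)] p q by simp
        then have "Some (inv q) \<odot> (circuit_vector F P ?\<rho> a \<odot> Some q) =
            Some (inv q) \<odot> (Some p \<odot> circuit_vector F P \<tau> a)" by simp
        moreover have "Some (inv q) \<odot> (circuit_vector F P ?\<rho> a \<odot> Some q) = circuit_vector F P ?\<rho> a"
          using q(2) cvcl[of ?\<rho> a] by (auto simp: ocarrier_def m_ac)
        moreover have "Some (inv q) \<odot> (Some p \<odot> circuit_vector F P \<tau> a) =
            Some ?c \<odot> circuit_vector F P \<tau> a"
          using p(2) q(2) cvcl[of \<tau> a] by (auto simp: ocarrier_def m_assoc)
        ultimately show ?thesis by simp
      qed
    qed
    \<comment> \<open>Proportional vectors have the same support outside \<open>A\<close>, so the
      hypothesis of the induction passes from \<tau> to the exchanged set.\<close>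
    have "circuit_in {I. P I \<noteq> None} ?\<rho> - A \<subseteq> \<sigma>"
    proof
      fix a assume a: "a \<in> circuit_in {I. P I \<noteq> None} ?\<rho> - A"
      then have "circuit_vector F P ?\<rho> a \<noteq> None" by (simp add: circuit_vector_eq_None_iff)
      then have "circuit_vector F P \<tau> a \<noteq> None" using eq[of a] a by (cases "circuit_vector F P \<tau> a") auto
      then show "a \<in> \<sigma>" using sub a by (auto simp: circuit_vector_eq_None_iff)
    qed
    moreover have "card (?\<rho> - \<sigma>) < card (\<tau> - \<sigma>)"
    proof (rule psubset_card_mono)
      have "?\<rho> - \<sigma> = \<tau> - \<sigma> - {x}" using yt(3) by blast
      then show "?\<rho> - \<sigma> \<subset> \<tau> - \<sigma>" using x(1,2) by blast
    qed (use fin in simp)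
    ultimately obtain d where d: "d \<in> carrier F"
      "\<And>a. a \<notin> A \<Longrightarrow> circuit_vector F P \<sigma> a = Some d \<odot> circuit_vector F P ?\<rho> a"
      using less.hyps[of ?\<rho>] rho cardA sig i Prhoi by blast
    have "circuit_vector F P \<sigma> a = Some (d \<otimes> ?c) \<odot> circuit_vector F P \<tau> a" if "a \<notin> A" for a
      using d(2)[OF that] eq[OF that] d(1) c cvcl[of \<tau> a] omult_assoc[of "Some d" "Some ?c"] by simp
    then show ?thesis using d(1) c by blast
  qed
qed

text \<open>By \<open>circuit_in_eq\<close> the two circuits coincide, which supplies a common
  coordinate; the rest is the case of empty \<open>A\<close> and \<open>m = 0\<close>.\<close>

lemma circuit_vectors_proportional_subset:
  assumes E: "finite E" and P: "plucker Weak F E r P"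
    and tau: "\<tau> \<subseteq> E" "card \<tau> = r + 1" "i \<in> circuit_in {I. P I \<noteq> None} \<tau>"
    and sig: "\<sigma> \<subseteq> E" "card \<sigma> = r + 1" "j \<in> circuit_in {I. P I \<noteq> None} \<sigma>"
    and sub: "circuit_in {I. P I \<noteq> None} \<tau> \<subseteq> \<sigma>"
  shows "\<exists>c\<in>carrier F. circuit_vector F P \<sigma> = scale F c (circuit_vector F P \<tau>)"
proof -
  interpret B: bases E "{I. P I \<noteq> None}" r by (rule plucker_bases[OF P])
  have eq: "circuit_in {I. P I \<noteq> None} \<sigma> = circuit_in {I. P I \<noteq> None} \<tau>"
    by (rule B.circuit_in_eq[OF tau(2) sig(2) tau(3) sig(3) sub])
  then have i: "i \<in> \<tau>" "i \<in> \<sigma>" "P (\<tau> - {i}) \<noteq> None" "P (\<sigma> - {i}) \<noteq> None"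
    using tau(3) by (auto simp: circuit_in_def set_eq_iff)
  have "\<exists>c\<in>carrier F. \<forall>a. a \<notin> {} \<longrightarrow> circuit_vector F P \<sigma> a = Some c \<odot> circuit_vector F P \<tau> a"
    by (rule circuit_vectors_proportional[OF E P, of "{}" 0 \<tau> \<sigma> i]) (use tau sig i sub in auto)
  then show ?thesis by (auto simp: scale_def)
qed

end


section \<open>Matroids are determined by their circuits\<close>

definition matroid_of ::
  "'a tract_struct \<Rightarrow> 'e set \<Rightarrow> nat \<Rightarrow> ('e set \<Rightarrow> 'a option) \<Rightarrow> ('e, 'a) fmatroid" where
  "matroid_of F E r P = \<lparr> ground = E, rank = r, vectors = {scale F c P |c. c \<in> carrier F} \<rparr>"

lemma matroid_of_simps [simp]:
  "ground (matroid_of F E r P) = E"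
  "rank (matroid_of F E r P) = r"
  "vectors (matroid_of F E r P) = {scale F c P |c. c \<in> carrier F}"
  by (simp_all add: matroid_of_def)

lemma is_matroidE:
  assumes "is_matroid k F M"
  obtains P where "finite (ground M)" "plucker k F (ground M) (rank M) P"
    "M = matroid_of F (ground M) (rank M) P"
  using assms unfolding is_matroid_def matroid_of_def by auto

context tract
begin

lemma scale_closed: "c \<in> carrier F \<Longrightarrow> f i \<in> ocarrier F \<Longrightarrow> scale F c f i \<in> ocarrier F"
  by (simp add: scale_apply)

lemma scale_scale:
  assumes "c \<in> carrier F" "d \<in> carrier F" "\<And>i. f i \<in> ocarrier F"
  shows "scale F c (scale F d f) = scale F (c \<otimes> d) f"
  using assms omult_assoc[of "Some c" "Some d"] by (simp add: fun_eq_iff scale_apply)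

lemma scale_one: "(\<And>i. f i \<in> ocarrier F) \<Longrightarrow> scale F \<one> f = f"
  by (simp add: fun_eq_iff scale_apply)

lemma scale_range:
  assumes "c \<in> carrier F" "\<And>i. f i \<in> ocarrier F"
  shows "{scale F d (scale F c f) |d. d \<in> carrier F} = {scale F d f |d. d \<in> carrier F}"
proof (intro subset_antisym subsetI)
  fix x assume "x \<in> {scale F d f |d. d \<in> carrier F}"
  then obtain d where d: "d \<in> carrier F" "x = scale F d f" by blast
  then have "x = scale F (d \<otimes> inv c) (scale F c f)"
    using assms by (simp add: scale_scale m_assoc)
  then show "x \<in> {scale F d (scale F c f) |d. d \<in> carrier F}" using d assms(1) by blast
qed (use assms in \<open>auto simp: scale_scale\<close>)

lemma matroid_of_scale:
  "c \<in> carrier F \<Longrightarrow> (\<And>I. P I \<in> ocarrier F) \<Longrightarrow> matroid_of F E r (scale F c P) = matroid_of F E r P"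
  unfolding matroid_of_def by (simp add: scale_range)

text \<open>A global sign is a unit and disappears in the scaling class. The duality identities
  between vectors are used only in this weakened form.\<close>

lemma matroid_of_sign_unit:
  assumes "\<And>I. P I \<in> ocarrier F" "\<And>I. Q I = sign_unit F n \<odot> P I"
  shows "matroid_of F E r Q = matroid_of F E r P"
proof -
  obtain c where c: "c \<in> carrier F" "sign_unit F n = Some c" by (rule sign_unit_carrier)
  then have "Q = scale F c P" using assms(2) by (simp add: fun_eq_iff scale_apply)
  then show ?thesis using matroid_of_scale[OF c(1), of P] assms(1) by simp
qed

lemma is_matroid_matroid_of:
  assumes "finite E" "plucker k F E r P"
  shows "is_matroid k F (matroid_of F E r P)"
proof -
  note nz = plucker_nonzero_function[OF assms(2)]
  obtain T where "P T \<noteq> None" using nz unfolding nonzero_function_def by blast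
  then have "r \<le> card E" using nonzero_functionD[OF nz] assms(1) card_mono by metis
  then show ?thesis unfolding is_matroid_def using assms by auto
qed

lemma circuit_vector_scale:
  assumes "c \<in> carrier F" "\<And>I. P I \<in> ocarrier F"
  shows "circuit_vector F (scale F c P) \<tau> = scale F c (circuit_vector F P \<tau>)"
proof
  fix i
  have cl: "scale F c P I \<in> ocarrier F" for I by (rule scale_closed) (rule assms)+
  show "circuit_vector F (scale F c P) \<tau> i = scale F c (circuit_vector F P \<tau>) i"
  proof (cases "i \<in> \<tau>")
    case True
    then show ?thesis
      using assms omult_left_commute[of "sign_unit F (crossings {i} \<tau>)" "Some c" "P (\<tau> - {i})"]
      by (simp only: circuit_vector_eq[of "scale F c P", OF cl] circuit_vector_eq[of P, OF assms(2)]
          scale_apply) simp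
  qed (simp add: circuit_vector_def scale_apply)
qed

lemma circuits_matroid_of:
  assumes cl: "\<And>I. P I \<in> ocarrier F"
  shows "circuits F (matroid_of F E r P) =
    {scale F c (circuit_vector F P \<tau>) |c \<tau>. c \<in> carrier F \<and> \<tau> \<subseteq> E \<and> card \<tau> = r + 1 \<and>
      circuit_in {I. P I \<noteq> None} \<tau> \<noteq> {}}" (is "_ = ?R")
proof (intro subset_antisym subsetI)
  have cvcl: "circuit_vector F P \<tau> i \<in> ocarrier F" for \<tau> i by (rule circuit_vector_closed) (rule cl)
  have supp: "supp (scale F c f) = supp f" for c and f :: "'e \<Rightarrow> 'a option"
    by (simp add: supp_def scale_apply)
  {
    fix X assume "X \<in> circuits F (matroid_of F E r P)"
    then obtain c d \<tau> where X: "X = scale F c (circuit_vector F (scale F d P) \<tau>)"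
      and *: "c \<in> carrier F" "d \<in> carrier F" "\<tau> \<in> subsets E (r + 1)"
        "supp (circuit_vector F (scale F d P) \<tau>) \<noteq> {}"
      unfolding circuits_def by auto
    have "X = scale F (c \<otimes> d) (circuit_vector F P \<tau>)"
      unfolding X circuit_vector_scale[OF *(2) cl] using * cvcl by (simp add: scale_scale)
    moreover have "circuit_in {I. P I \<noteq> None} \<tau> \<noteq> {}"
      using *(4) unfolding circuit_vector_scale[OF *(2) cl] supp supp_circuit_vector .
    ultimately show "X \<in> ?R" using * unfolding subsets_def by blast
  next
    fix X assume "X \<in> ?R"
    then obtain c \<tau> where X: "X = scale F c (circuit_vector F P \<tau>)" "c \<in> carrier F"
      "\<tau> \<in> subsets E (r + 1)" "supp (circuit_vector F P \<tau>) \<noteq> {}"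
      unfolding subsets_def supp_circuit_vector by blast
    moreover have "P = scale F \<one> P" by (rule scale_one[symmetric]) (rule cl)
    then have "P \<in> vectors (matroid_of F E r P)" unfolding matroid_of_simps using one_closed by blast
    ultimately show "X \<in> circuits F (matroid_of F E r P)" unfolding circuits_def by force
  }
qed

lemma circuit_vector_in_circuits:
  assumes "\<And>I. P I \<in> ocarrier F" "\<tau> \<subseteq> E" "card \<tau> = r + 1" "i \<in> circuit_in {I. P I \<noteq> None} \<tau>"
  shows "circuit_vector F P \<tau> \<in> circuits F (matroid_of F E r P)"
proof -
  have "circuit_vector F P \<tau> = scale F \<one> (circuit_vector F P \<tau>)"
    by (rule scale_one[symmetric]) (rule circuit_vector_closed, rule assms(1))
  then show ?thesis unfolding circuits_matroid_of[of P, OF assms(1)] using assms(2-4) by blast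
qed

lemma circuits_memE:
  assumes "\<And>I. P I \<in> ocarrier F" "X \<in> circuits F (matroid_of F E r P)"
  obtains c \<tau> i where "c \<in> carrier F" "\<tau> \<subseteq> E" "card \<tau> = r + 1" "i \<in> circuit_in {I. P I \<noteq> None} \<tau>"
    "X = scale F c (circuit_vector F P \<tau>)" "supp X = circuit_in {I. P I \<noteq> None} \<tau>"
proof -
  obtain c \<tau> where *: "c \<in> carrier F" "\<tau> \<subseteq> E" "card \<tau> = r + 1" "circuit_in {I. P I \<noteq> None} \<tau> \<noteq> {}"
    "X = scale F c (circuit_vector F P \<tau>)"
    using assms(2) unfolding circuits_matroid_of[of P, OF assms(1)] by blast
  moreover have "supp X = circuit_in {I. P I \<noteq> None} \<tau>"
    unfolding *(5) supp_circuit_vector[of F P \<tau>, symmetric] by (simp add: supp_def scale_apply)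
  ultimately show ?thesis using that by blast
qed

text \<open>A set \<open>T'\<close> in no basis of \<open>P\<close> would contain a circuit of
  \<open>P\<close>. That circuit is the support of a circuit of \<open>P'\<close> as well, which a
  basis of \<open>P'\<close> cannot contain.\<close>

lemma basis_extends_of_circuits_subset:
  assumes P: "plucker Weak F E r P" and P': "plucker Weak F E r' P'"
    and sub: "circuits F (matroid_of F E r P) \<subseteq> circuits F (matroid_of F E r' P')"
    and T': "P' T' \<noteq> None"
  shows "\<exists>T. P T \<noteq> None \<and> T' \<subseteq> T"
proof (rule ccontr)
  assume neg: "\<nexists>T. P T \<noteq> None \<and> T' \<subseteq> T"
  interpret B: bases E "{I. P I \<noteq> None}" r by (rule plucker_bases[OF P])
  interpret B': bases E "{I. P' I \<noteq> None}" r' by (rule plucker_bases[OF P'])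
  note cl = nonzero_functionD(1)[OF plucker_nonzero_function[OF P]]
  note cl' = nonzero_functionD(1)[OF plucker_nonzero_function[OF P']]
  have "T' \<subseteq> E" using B'.basis_subset T' by simp
  moreover have "\<not> T' \<subseteq> T" if "T \<in> {I. P I \<noteq> None}" for T using neg that by blast
  ultimately obtain \<tau> i where \<tau>: "\<tau> \<subseteq> E" "card \<tau> = r + 1" "i \<in> circuit_in {I. P I \<noteq> None} \<tau>"
    "circuit_in {I. P I \<noteq> None} \<tau> \<subseteq> T'"
    using B.dependent_contains_circuit by blast
  have "circuit_vector F P \<tau> \<in> circuits F (matroid_of F E r' P')"
    using circuit_vector_in_circuits[of P, OF cl \<tau>(1-3)] sub by blast
  then obtain \<sigma> j where "card \<sigma> = r' + 1" "j \<in> circuit_in {I. P' I \<noteq> None} \<sigma>"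
    "supp (circuit_vector F P \<tau>) = circuit_in {I. P' I \<noteq> None} \<sigma>"
    using circuits_memE[of P', OF cl'] by metis
  then show False
    using B'.circuit_not_subset_basis[of \<sigma> j T'] T' \<tau>(4) unfolding supp_circuit_vector by simp
qed

lemma matroid_of_eqI:
  assumes E: "finite E" and P: "plucker Weak F E r P" and P': "plucker Weak F E r' P'"
    and eq: "circuits F (matroid_of F E r P) = circuits F (matroid_of F E r' P')"
  shows "matroid_of F E r P = matroid_of F E r' P'"
proof -
  interpret B: bases E "{I. P I \<noteq> None}" r by (rule plucker_bases[OF P])
  interpret B': bases E "{I. P' I \<noteq> None}" r' by (rule plucker_bases[OF P'])
  note cl = nonzero_functionD(1)[OF plucker_nonzero_function[OF P]]
  note cl' = nonzero_functionD(1)[OF plucker_nonzero_function[OF P']]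
  \<comment> \<open>Stated for an arbitrary ordered pair of vectors because it is applied in both
    directions: once to equate the ranks, then to equate the supports.\<close>
  have le: "s' \<le> s" "s' = s \<Longrightarrow> Q' T \<noteq> None \<Longrightarrow> Q T \<noteq> None"
    if Q: "plucker Weak F E s Q" and Q': "plucker Weak F E s' Q'"
      and eq: "circuits F (matroid_of F E s Q) = circuits F (matroid_of F E s' Q')" for Q Q' s s' T
  proof -
    interpret Q: bases E "{I. Q I \<noteq> None}" s by (rule plucker_bases[OF Q])
    interpret Q': bases E "{I. Q' I \<noteq> None}" s' by (rule plucker_bases[OF Q'])
    have sub: "circuits F (matroid_of F E s Q) \<subseteq> circuits F (matroid_of F E s' Q')" using eq by simp
    have ext: "\<exists>S. Q S \<noteq> None \<and> T \<subseteq> S \<and> card S = s \<and> card T = s' \<and> finite S" if T: "Q' T \<noteq> None" for T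
    proof -
      obtain S where "Q S \<noteq> None" "T \<subseteq> S"
        using basis_extends_of_circuits_subset[OF Q Q' sub T] by blast
      then show ?thesis using Q.card_basis[of S] Q'.card_basis[of T] Q.finite_basis[of S] T by auto
    qed
    obtain T0 where "Q' T0 \<noteq> None" using Q'.bases_nonempty by blast
    then show "s' \<le> s" using ext card_mono by metis
    assume "s' = s" "Q' T \<noteq> None"
    then show "Q T \<noteq> None" using ext card_subset_eq by metis
  qed
  have rr: "r' = r" using le(1)[OF P P' eq] le(1)[OF P' P eq[symmetric]] by simp
  have supp: "P T \<noteq> None \<longleftrightarrow> P' T \<noteq> None" for T
    using le(2)[OF P P' eq rr] le(2)[OF P' P eq[symmetric] rr[symmetric]] by blast
  then have supp_eq: "{I. P' I \<noteq> None} = {I. P I \<noteq> None}" by blast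
  note P'r = P'[unfolded rr]
  obtain T0 where T0: "P T0 \<noteq> None" using B.bases_nonempty by blast
  obtain p where p: "P T0 = Some p" "p \<in> carrier F" using T0 cl[of T0] by (cases "P T0") auto
  obtain p' where p': "P' T0 = Some p'" "p' \<in> carrier F"
    using T0 supp cl'[of T0] by (cases "P' T0") auto
  \<comment> \<open>The scalar is fixed at one basis \<open>T0\<close> and then carried to every
    other basis along exchanges that approach \<open>T0\<close>.\<close>
  let ?c = "p' \<otimes> inv p"
  have c: "?c \<in> carrier F" using p p' by simp
  have "P' T = Some ?c \<odot> P T" if "P T \<noteq> None" for T
    using that
  proof (induction "card (T - T0)" arbitrary: T rule: less_induct)
    case less
    have fin: "finite T" "finite T0" using B.finite_basis less.prems T0 by auto
    have cards: "card T = r" "card T0 = r" using B.card_basis less.prems T0 by auto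
    show ?case
    proof (cases "T \<subseteq> T0")
      case True
      then have "T = T0" using cards fin by (simp add: card_subset_eq)
      moreover have "p' = p' \<otimes> inv p \<otimes> p" using p p' by (simp add: m_assoc)
      ultimately show ?thesis using p p' by simp
    next
      case False
      then obtain x where x: "x \<in> T" "x \<notin> T0" by blast
      obtain y where y: "y \<in> T0" "y \<notin> T" "P (insert y (T - {x})) \<noteq> None"
        using B.exchange[of T T0 x] less.prems T0 x by auto
      \<comment> \<open>\<open>?T1\<close> is closer to \<open>T0\<close> than \<open>T\<close>, and
        the set \<open>?\<tau>\<close> gives \<open>T\<close> on removing \<open>y\<close> and
        \<open>?T1\<close> on removing \<open>x\<close>, so one circuit vector compares the
        two.\<close>
      let ?T1 = "insert y (T - {x})" and ?\<tau> = "insert y T"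
      have IH: "P' ?T1 = Some ?c \<odot> P ?T1"
      proof (rule less.hyps[OF _ y(3)])
        show "card (?T1 - T0) < card (T - T0)"
          by (rule psubset_card_mono) (use fin x y in auto)
      qed
      have \<tau>: "?\<tau> \<subseteq> E" "card ?\<tau> = r + 1" "y \<in> circuit_in {I. P I \<noteq> None} ?\<tau>"
        using B.fundamental_circuit[of T y] less.prems y B.basis_subset[of T] B.basis_subset[of T0] T0
        by auto
      have "circuit_vector F P ?\<tau> \<in> circuits F (matroid_of F E r P')"
        using circuit_vector_in_circuits[of P, OF cl \<tau>] eq rr by simp
      then obtain d \<sigma> j where d: "d \<in> carrier F" "\<sigma> \<subseteq> E" "card \<sigma> = r + 1"
        "j \<in> circuit_in {I. P' I \<noteq> None} \<sigma>" "circuit_vector F P ?\<tau> = scale F d (circuit_vector F P' \<sigma>)"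
        "supp (circuit_vector F P ?\<tau>) = circuit_in {I. P' I \<noteq> None} \<sigma>"
        using circuits_memE[of P', OF cl'] by metis
      have "circuit_in {I. P' I \<noteq> None} \<sigma> \<subseteq> ?\<tau>"
        using d(6) circuit_in_subset unfolding supp_circuit_vector by metis
      \<comment> \<open>The common circuit may come from a different set \<sigma> on the side of
        \<open>P'\<close>. Proportionality within \<open>P'\<close> allows \<sigma> to be replaced
        by \<open>?\<tau>\<close>.\<close>
      then obtain e where e: "e \<in> carrier F" "circuit_vector F P' ?\<tau> = scale F e (circuit_vector F P' \<sigma>)"
        using circuit_vectors_proportional_subset[OF E P'r d(2-4) \<tau>(1,2)] \<tau>(3)
        unfolding supp_eq by blast
      let ?d = "d \<otimes> inv e"
      have dcl: "?d \<in> carrier F" using d e by simp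
      have cv': "circuit_vector F P' \<sigma>' i \<in> ocarrier F" for \<sigma>' i
        by (rule circuit_vector_closed) (rule cl')
      have "scale F ?d (circuit_vector F P' ?\<tau>) = circuit_vector F P ?\<tau>"
        unfolding e(2) d(5) using d(1) e(1) cv' by (simp add: scale_scale m_assoc)
      then have cv: "circuit_vector F P ?\<tau> i = Some ?d \<odot> circuit_vector F P' ?\<tau> i" for i
        by (metis scale_apply)
      have eqd: "P (?\<tau> - {i}) = Some ?d \<odot> P' (?\<tau> - {i})" if "i \<in> ?\<tau>" for i
      proof -
        obtain s where s: "s \<in> carrier F" "sign_unit F (crossings {i} ?\<tau>) = Some s"
          by (rule sign_unit_carrier)
        have "Some s \<odot> P (?\<tau> - {i}) = Some ?d \<odot> (Some s \<odot> P' (?\<tau> - {i}))"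
          using cv[of i] that by (simp only: circuit_vector_eq[of P, OF cl]
            circuit_vector_eq[of P', OF cl'] s)
        also have "\<dots> = Some s \<odot> (Some ?d \<odot> P' (?\<tau> - {i}))"
          using s(1) dcl cl' by (intro omult_left_commute) auto
        finally show ?thesis
          using omult_left_cancel[OF s(1) cl[of "?\<tau> - {i}"], of "Some ?d \<odot> P' (?\<tau> - {i})"] dcl cl' by simp
      qed
      have "?\<tau> - {y} = T" "?\<tau> - {x} = ?T1" using x y by auto
      then have PT: "P T = Some ?d \<odot> P' T" and PT1: "P ?T1 = Some ?d \<odot> P' ?T1"
        using eqd[of y] eqd[of x] x by auto
      obtain q where q: "P' ?T1 = Some q" "q \<in> carrier F"
        using y(3) supp cl'[of ?T1] by (cases "P' ?T1") auto
      have "Some q = Some ?c \<odot> (Some ?d \<odot> Some q)" using IH unfolding PT1 q(1) .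
      then have "q = ?c \<otimes> ?d \<otimes> q" using c dcl q(2) by (simp add: m_assoc)
      \<comment> \<open>At \<open>?T1\<close> both ratios are known, so the ratio read off from the
        circuit vector is the inverse of the fixed scalar.\<close>
      then have "?c \<otimes> ?d = \<one>"
        using c dcl q(2) by (metis m_closed one_unique r_cancel_one' )
      then have "Some ?c \<odot> (Some ?d \<odot> P' T) = P' T"
        using omult_assoc[of "Some ?c" "Some ?d" "P' T"] c dcl cl' by simp
      then show ?thesis unfolding PT by simp
    qed
  qed
  moreover have "P' T = Some ?c \<odot> P T" if "P T = None" for T
  proof -
    have "P' T = None" using supp[of T] that by blast
    then show ?thesis using that by simp
  qed
  ultimately have "P' = scale F ?c P" unfolding fun_eq_iff scale_apply by blast
  then show ?thesis using matroid_of_scale[of ?c P, OF c cl] rr by simp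
qed

text \<open>The definite description prescribes circuits and ground set but not the rank; uniqueness
  therefore rests on a comparison of vectors of possibly different ranks.\<close>

lemma matroid_with_circuits_eq:
  assumes E: "finite E" and P: "plucker k F E r P" and C: "circuits F (matroid_of F E r P) = C"
  shows "matroid_with_circuits k F E C = matroid_of F E r P"
  unfolding matroid_with_circuits_def
proof (rule the_equality)
  show "is_matroid k F (matroid_of F E r P) \<and> ground (matroid_of F E r P) = E \<and>
      circuits F (matroid_of F E r P) = C"
    using is_matroid_matroid_of[OF E P] C by simp
  fix N assume N: "is_matroid k F N \<and> ground N = E \<and> circuits F N = C"
  then obtain Q where Q: "plucker k F E (rank N) Q" "N = matroid_of F E (rank N) Q"
    using is_matroidE by metis
  then show "N = matroid_of F E r P"
    using matroid_of_eqI[OF E plucker_imp_weak[OF E Q(1)] plucker_imp_weak[OF E P]] C N by metis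
qed

section \<open>Duals and initial forms of scaling classes\<close>

lemma dual_vector_scale:
  assumes E: "finite E" and cl: "\<And>I. P I \<in> ocarrier F" and c: "c \<in> carrier F"
  shows "dual_vector F E (scale F c P) = scale F (involution F c) (dual_vector F E P)"
proof
  fix I
  have "conj_opt (Some c \<odot> P (E - I)) = Some (involution F c) \<odot> conj_opt (P (E - I))"
    using conj_opt_mult[of "Some c" "P (E - I)"] cl c by simp
  then show "dual_vector F E (scale F c P) I = scale F (involution F c) (dual_vector F E P) I"
    using cl c omult_left_commute[of "sign_unit F (crossings I (E - I))" "Some (involution F c)"]
    by (simp add: dual_vector_eq[OF E] scale_apply)
qed

lemma dual_matroid_of:
  assumes E: "finite E" and cl: "\<And>I. P I \<in> ocarrier F"
  shows "dual F (matroid_of F E r P) = matroid_of F E (card E - r) (dual_vector F E P)"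
proof -
  have "dual_vector F E ` {scale F c P |c. c \<in> carrier F} =
      {scale F (involution F c) (dual_vector F E P) |c. c \<in> carrier F}"
  proof -
    have "dual_vector F E ` {scale F c P |c. c \<in> carrier F} =
        (\<lambda>c. dual_vector F E (scale F c P)) ` carrier F" by blast
    also have "\<dots> = (\<lambda>c. scale F (involution F c) (dual_vector F E P)) ` carrier F"
      by (rule image_cong[OF refl]) (rule dual_vector_scale[OF E cl])
    finally show ?thesis by blast
  qed
  also have "\<dots> = {scale F c (dual_vector F E P) |c. c \<in> carrier F}"
  proof -
    have "involution F ` carrier F = carrier F"
      using involution_closed involution_involution by (metis image_iff subsetI subset_antisym)
    then have "(\<lambda>c. scale F c (dual_vector F E P)) ` involution F ` carrier F =
        (\<lambda>c. scale F c (dual_vector F E P)) ` carrier F" by simp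
    then show ?thesis by (simp only: image_image) blast
  qed
  finally show ?thesis unfolding dual_def matroid_of_def by simp
qed

text \<open>Scaling by \<open>(c, g)\<close> adds \<open>g\<close> to every valuation, so the same
  sets are minimal. Scalars of valuation zero already give the whole class over
  \<open>F\<close>.\<close>

lemma initial_matroid_of:
  fixes P :: "'e set \<Rightarrow> ('a \<times> 'g::linordered_ab_group_add) option"
  assumes nz: "nonzero_function (trop F) E r P"
  shows "initial (matroid_of (trop F) E r P) u = matroid_of F E r (initial_vector E r u P)"
proof -
  have *: "initial_vector E r u (scale (trop F) (c, g) P) = scale F c (initial_vector E r u P)"
    for c and g :: 'g
  proof
    fix I
    have val: "ext_minus (val (scale (trop F) (c, g) P A)) s =
        (case ext_minus (val (P A)) s of Infty \<Rightarrow> Infty | Fin h \<Rightarrow> Fin (g + h))" for A s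
      by (auto simp: scale_apply val_def split: option.splits)
    have "ext_minus (val (scale (trop F) (c, g) P A)) s \<le> ext_minus (val (scale (trop F) (c, g) P B)) t \<longleftrightarrow>
        ext_minus (val (P A)) s \<le> ext_minus (val (P B)) t" for A B s t
      unfolding val by (auto simp: less_eq_ext_def split: ext.splits)
    moreover have "theta (scale (trop F) (c, g) P I) = Some c \<odot> theta (P I)"
      by (cases "P I") (auto simp: scale_apply theta_def)
    ultimately show "initial_vector E r u (scale (trop F) (c, g) P) I =
        scale F c (initial_vector E r u P) I"
      unfolding initial_vector_def scale_apply by simp
  qed
  have "initial_vector E r u ` {scale (trop F) x P |x. x \<in> carrier (trop F)} =
      {scale F c (initial_vector E r u P) |c. c \<in> carrier F}"
  proof (intro subset_antisym subsetI)
    fix Q assume "Q \<in> {scale F c (initial_vector E r u P) |c. c \<in> carrier F}"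
    then obtain c where "c \<in> carrier F" "Q = scale F c (initial_vector E r u P)" by blast
    then show "Q \<in> initial_vector E r u ` {scale (trop F) x P |x. x \<in> carrier (trop F)}"
      using *[of c 0, symmetric] by auto
  qed (auto simp: *)
  then show ?thesis unfolding initial_def matroid_of_def by simp
qed

end


section \<open>Deletion and contraction\<close>

lemma supp_scale: "supp (scale F c f) = supp f"
  by (simp add: supp_def scale_apply)

lemma supp_delete_coords: "supp (delete_coords f A) = supp f - A"
  by (auto simp: supp_def delete_coords_def)

lemma delete_coords_scale: "delete_coords (scale F c f) A = scale F c (delete_coords f A)"
  by (auto simp: delete_coords_def scale_apply)

lemma delete_coords_id:
  assumes "supp f \<inter> A = {}"
  shows "delete_coords f A = f"
proof -
  have "f x = None" if "x \<in> A" for x using assms that by (auto simp: supp_def)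
  then show ?thesis by (simp add: delete_coords_def fun_eq_iff)
qed

lemma delete_coords_cong: "supp f \<inter> A = supp f \<inter> B \<Longrightarrow> delete_coords f A = delete_coords f B"
  by (auto simp: delete_coords_def supp_def fun_eq_iff)

context tract
begin

lemma scale_inverse:
  assumes "f = scale F c g" "c \<in> carrier F" "\<And>i. g i \<in> ocarrier F"
  shows "g = scale F (inv c) f"
  unfolding assms(1) using assms(2,3) by (simp add: scale_scale scale_one)

lemma scale_in_circuits:
  assumes cl: "\<And>I. P I \<in> ocarrier F" and X: "X \<in> circuits F (matroid_of F E r P)" and d: "d \<in> carrier F"
  shows "scale F d X \<in> circuits F (matroid_of F E r P)"
proof -
  have cvcl: "circuit_vector F P \<tau> i \<in> ocarrier F" for \<tau> i by (rule circuit_vector_closed) (rule cl)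
  obtain c \<tau> where *: "c \<in> carrier F" "\<tau> \<subseteq> E" "card \<tau> = r + 1" "circuit_in {I. P I \<noteq> None} \<tau> \<noteq> {}"
    "X = scale F c (circuit_vector F P \<tau>)"
    using X unfolding circuits_matroid_of[of P, OF cl] by blast
  have "scale F d X = scale F (d \<otimes> c) (circuit_vector F P \<tau>)"
    unfolding *(5) using d *(1) cvcl by (simp add: scale_scale)
  then show ?thesis unfolding circuits_matroid_of[of P, OF cl] using * d by blast
qed

text \<open>The elements of \<open>S\<close> below \<open>i\<close> enter the sign of the circuit
  vector of \<open>\<tau> \<union> S\<close> and are made up for by the sign in
  \<open>minor_vector\<close>; the remaining factor depends on \<tau> only.\<close>

lemma circuit_vector_minor_vector:
  assumes cl: "\<And>I. P I \<in> ocarrier F" and fin: "finite E'" "finite S" "E' \<inter> S = {}" and tau: "\<tau> \<subseteq> E'"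
  obtains s where "s \<in> carrier F"
    "circuit_vector F (minor_vector F E' S P) \<tau> =
      scale F s (delete_coords (circuit_vector F P (\<tau> \<union> S)) S)"
proof -
  obtain s where s: "s \<in> carrier F" "sign_unit F (crossings \<tau> S) = Some s" by (rule sign_unit_carrier)
  have ft: "finite \<tau>" "\<tau> \<inter> S = {}" using fin tau finite_subset by auto
  note mcl = minor_vector_closed[of P E' S, OF cl]
  have "circuit_vector F (minor_vector F E' S P) \<tau> i =
      Some s \<odot> delete_coords (circuit_vector F P (\<tau> \<union> S)) S i" for i
  proof (cases "i \<in> \<tau>")
    case True
    then have iS: "i \<notin> S" using ft(2) by blast
    define L where "L = \<tau> - {i}"
    have L: "\<tau> = insert i L" "i \<notin> L" "finite L" "L \<subseteq> E'" using True ft tau by (auto simp: L_def)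
    have cr: "crossings \<tau> S = crossings {i} S + crossings L S"
      unfolding L(1) by (rule crossings_insert_left[OF L(3) fin(2) L(2)])
    have cr2: "crossings {i} (\<tau> \<union> S) = crossings {i} \<tau> + crossings {i} S"
      by (rule crossings_Un_right) (use ft fin in auto)
    have eq: "\<tau> \<union> S - {i} = L \<union> S" using iS by (auto simp: L_def)
    have "circuit_vector F (minor_vector F E' S P) \<tau> i =
        sign_unit F (crossings {i} \<tau>) \<odot> (sign_unit F (crossings L S) \<odot> P (L \<union> S))"
      unfolding circuit_vector_eq[of "minor_vector F E' S P", OF mcl True] L_def[symmetric]
      using L(4) by (simp add: minor_vector_def)
    also have "\<dots> = sign_unit F (crossings \<tau> S + (crossings {i} (\<tau> \<union> S))) \<odot> P (L \<union> S)"
      unfolding sign_unit_left_add[OF cl] cr cr2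
      by (intro arg_cong2[of _ _ _ _ "(\<odot>)"] sign_unit_cong refl) (simp, argo)
    also have "\<dots> = Some s \<odot> circuit_vector F P (\<tau> \<union> S) i"
      using circuit_vector_eq[of P i "\<tau> \<union> S", OF cl] True
      unfolding eq s(2)[symmetric] by (simp add: sign_unit_left_add cl)
    finally show ?thesis using iS by (simp add: delete_coords_def)
  next
    case False
    then show ?thesis by (auto simp: circuit_vector_def delete_coords_def)
  qed
  then show ?thesis using that[OF s(1)] by (simp add: fun_eq_iff scale_apply)
qed

text \<open>Minimality of the meet with \<open>A\<close> makes the circuit vectors of the sets
  \<open>\<tau> \<union> (T \<inter> A)\<close> vanish on \<open>A\<close>. Conversely, every
  circuit avoiding \<open>A\<close> is the fundamental circuit of an element over a basis whose meet
  with \<open>A\<close> is exactly \<open>T \<inter> A\<close>.\<close>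

lemma delete_matroid_of:
  assumes E: "finite E" and P: "plucker k F E r P" and A: "A \<subseteq> E"
    and T: "P T \<noteq> None" and min: "\<And>T'. P T' \<noteq> None \<Longrightarrow> card (T \<inter> A) \<le> card (T' \<inter> A)"
  shows "delete k F (matroid_of F E r P) A =
    matroid_of F (E - A) (r - card (T \<inter> A)) (minor_vector F (E - A) (T \<inter> A) P)"
proof -
  let ?B = "T \<inter> A" and ?E = "E - A"
  let ?D = "minor_vector F ?E ?B P" and ?d = "r - card (T \<inter> A)"
  note nz = plucker_nonzero_function[OF P]
  note cl = nonzero_functionD(1)[OF nz]
  note W = plucker_imp_weak[OF E P]
  interpret B: bases E "{I. P I \<noteq> None}" r by (rule plucker_bases[OF W])
  have TE: "T \<subseteq> E" "card T = r" "finite T" using B.basis_subset B.card_basis B.finite_basis T by auto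
  have fin: "finite ?E" "finite ?B" "?E \<inter> ?B = {}" using E TE by auto
  have Br: "card ?B \<le> r" using card_mono[OF TE(3), of ?B] TE(2) by simp
  have D: "plucker k F ?E ?d ?D"
    by (rule minor_vector_plucker[OF E _ _ P T]) (use TE in auto)
  have Dcl: "?D I \<in> ocarrier F" for I by (rule minor_vector_closed) (rule cl)
  have cv: "\<exists>s\<in>carrier F. circuit_vector F ?D \<tau> = scale F s (circuit_vector F P (\<tau> \<union> ?B))"
    if tau: "\<tau> \<subseteq> ?E" for \<tau>
  proof -
    obtain s where s: "s \<in> carrier F" "circuit_vector F ?D \<tau> =
        scale F s (delete_coords (circuit_vector F P (\<tau> \<union> ?B)) ?B)"
      by (rule circuit_vector_minor_vector[of P, OF cl fin tau])
    \<comment> \<open>Removing \<open>b\<close> would leave a basis with fewer elements in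
      \<open>A\<close> than \<open>T\<close> has.\<close>
    have "b \<notin> circuit_in {I. P I \<noteq> None} (\<tau> \<union> ?B)" if b: "b \<in> ?B" for b
    proof
      assume "b \<in> circuit_in {I. P I \<noteq> None} (\<tau> \<union> ?B)"
      then have "card ?B \<le> card ((\<tau> \<union> ?B - {b}) \<inter> A)" using min unfolding circuit_in_def by blast
      moreover have "(\<tau> \<union> ?B - {b}) \<inter> A = ?B - {b}" using tau by blast
      ultimately have "card ?B \<le> card (?B - {b})" by simp
      then show False using card_Diff1_less[OF fin(2) b] by simp
    qed
    then have "supp (circuit_vector F P (\<tau> \<union> ?B)) \<inter> ?B = {}" unfolding supp_circuit_vector by blast
    then show ?thesis using s delete_coords_id by metis
  qed
  have "circuits F (matroid_of F ?E ?d ?D) =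
      {delete_coords C A |C. C \<in> circuits F (matroid_of F E r P) \<and> supp C \<inter> A = {}}"
  proof (intro subset_antisym subsetI)
    fix X assume "X \<in> circuits F (matroid_of F ?E ?d ?D)"
    then obtain c \<tau> i where X: "c \<in> carrier F" "\<tau> \<subseteq> ?E" "card \<tau> = ?d + 1"
      "i \<in> circuit_in {I. ?D I \<noteq> None} \<tau>" "X = scale F c (circuit_vector F ?D \<tau>)"
      "supp X = circuit_in {I. ?D I \<noteq> None} \<tau>"
      by (rule circuits_memE[of ?D, OF Dcl])
    obtain s where s: "s \<in> carrier F" "circuit_vector F ?D \<tau> = scale F s (circuit_vector F P (\<tau> \<union> ?B))"
      using cv[OF X(2)] by blast
    have "finite \<tau>" using X(2) fin(1) finite_subset by blast
    then have "card (\<tau> \<union> ?B) = r + 1"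
      using card_Un_disjoint[of \<tau> ?B] X(2,3) fin(2) Br by auto
    moreover have "circuit_in {I. ?D I \<noteq> None} \<tau> = circuit_in {I. P I \<noteq> None} (\<tau> \<union> ?B)"
      using arg_cong[OF s(2), of supp] by (simp only: supp_scale supp_circuit_vector)
    moreover have "\<tau> \<union> ?B \<subseteq> E" using X(2) A by blast
    ultimately have "circuit_vector F P (\<tau> \<union> ?B) \<in> circuits F (matroid_of F E r P)"
      using circuit_vector_in_circuits[of P, OF cl] X(4) by blast
    then have "X \<in> circuits F (matroid_of F E r P)"
      unfolding X(5) s(2) using scale_in_circuits[of P, OF cl] X(1) s(1) by blast
    moreover have "supp X \<inter> A = {}"
      using X(2) circuit_in_subset[of "{I. ?D I \<noteq> None}" \<tau>] unfolding X(6) by blast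
    ultimately show "X \<in> {delete_coords C A |C. C \<in> circuits F (matroid_of F E r P) \<and> supp C \<inter> A = {}}"
      using delete_coords_id by (metis (mono_tags, lifting) mem_Collect_eq)
  next
    fix Y assume "Y \<in> {delete_coords C A |C. C \<in> circuits F (matroid_of F E r P) \<and> supp C \<inter> A = {}}"
    then obtain X where X: "X \<in> circuits F (matroid_of F E r P)" "supp X \<inter> A = {}" "Y = X"
      using delete_coords_id by blast
    obtain c \<sigma> i where c: "c \<in> carrier F" "\<sigma> \<subseteq> E" "card \<sigma> = r + 1" "i \<in> circuit_in {I. P I \<noteq> None} \<sigma>"
      "X = scale F c (circuit_vector F P \<sigma>)" "supp X = circuit_in {I. P I \<noteq> None} \<sigma>"
      by (rule circuits_memE[of P, OF cl X(1)])
    let ?S = "circuit_in {I. P I \<noteq> None} \<sigma>"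
    have SA: "?S \<inter> A = {}" using X(2) c(6) by simp
    have si: "\<sigma> - {i} \<in> {I. P I \<noteq> None}" "?S - {i} \<subseteq> \<sigma> - {i}" "T \<in> {I. P I \<noteq> None}"
      using c(4) T by (auto simp: circuit_in_def)
    obtain U where U: "U \<in> {I. P I \<noteq> None}" "?S - {i} \<subseteq> U" "U \<subseteq> ?S - {i} \<union> T"
      by (rule B.extend_to_basis[OF si])
    have iU: "i \<notin> U" using B.circuit_not_subset_basis[OF c(3,4) U(1)] U(2) by blast
    \<comment> \<open>\<open>U\<close> is built from the circuit, which avoids \<open>A\<close>, and
      from \<open>T\<close>, so its meet with \<open>A\<close> lies in that of \<open>T\<close>;
      minimality makes it equal.\<close>
    have UA: "U \<inter> A = ?B"
    proof (rule card_subset_eq)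
      show sub: "U \<inter> A \<subseteq> ?B" using U(3) SA by blast
      show "card (U \<inter> A) = card ?B"
        using min[of U] U(1) card_mono[OF fin(2) sub] by simp
    qed (rule fin)
    have iE: "i \<in> E" "i \<notin> A" "U \<subseteq> E"
      using c(2,4) SA B.basis_subset[OF U(1)] by (auto simp: circuit_in_def)
    note fund = B.fundamental_circuit[OF U(1) iU]
    have "?S \<subseteq> insert i U" using U(2) by blast
    moreover have "insert i U \<subseteq> E" using iE by blast
    ultimately obtain e where e: "e \<in> carrier F"
        "circuit_vector F P (insert i U) = scale F e (circuit_vector F P \<sigma>)"
      using circuit_vectors_proportional_subset[OF E W c(2-4) _ fund] by blast
    let ?\<tau> = "insert i U - A"
    have tau: "?\<tau> \<subseteq> ?E" "?\<tau> \<union> ?B = insert i U" using iE UA by auto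
    obtain s where s: "s \<in> carrier F" "circuit_vector F ?D ?\<tau> = scale F s (circuit_vector F P (insert i U))"
      using cv[OF tau(1)] tau(2) by auto
    have "finite U" using B.finite_basis U(1) by blast
    then have "card (insert i U) = card ?\<tau> + card ?B"
      using card_Un_disjoint[of ?\<tau> ?B] fin(2) tau(2) by auto
    then have card: "card ?\<tau> = ?d + 1" using fund(1) Br by simp
    have "circuit_in {I. ?D I \<noteq> None} ?\<tau> = circuit_in {I. P I \<noteq> None} (insert i U)"
      using arg_cong[OF s(2), of supp] by (simp only: supp_scale supp_circuit_vector)
    then have D': "circuit_vector F ?D ?\<tau> \<in> circuits F (matroid_of F ?E ?d ?D)"
      using circuit_vector_in_circuits[of ?D, OF Dcl tau(1) card] fund(2) by blast
    have cvcl: "circuit_vector F P \<tau> j \<in> ocarrier F" for \<tau> j by (rule circuit_vector_closed) (rule cl)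
    have "circuit_vector F ?D ?\<tau> = scale F (s \<otimes> e) (circuit_vector F P \<sigma>)"
      unfolding s(2) e(2) using s(1) e(1) cvcl by (simp add: scale_scale)
    then have "circuit_vector F P \<sigma> = scale F (inv (s \<otimes> e)) (circuit_vector F ?D ?\<tau>)"
      by (rule scale_inverse) (use s(1) e(1) cvcl in auto)
    then have "circuit_vector F P \<sigma> \<in> circuits F (matroid_of F ?E ?d ?D)"
      using scale_in_circuits[of ?D, OF Dcl D'] s(1) e(1) by simp
    then show "Y \<in> circuits F (matroid_of F ?E ?d ?D)"
      unfolding X(3) c(5) using scale_in_circuits[of ?D, OF Dcl] c(1) by blast
  qed
  then show ?thesis
    unfolding delete_def matroid_of_simps by (rule matroid_with_circuits_eq[OF fin(1) D])
qed

text \<open>A circuit restricted to the complement of \<open>A\<close> need not have minimal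
  support. It suffices that every nonempty restriction contains the support of a circuit of the
  minor vector, and that equal supports imply proportional vectors.\<close>

lemma contract_matroid_of:
  assumes E: "finite E" and P: "plucker k F E r P" and A: "A \<subseteq> E"
    and T: "P T \<noteq> None" and max: "\<And>T'. P T' \<noteq> None \<Longrightarrow> card (T' \<inter> A) \<le> card (T \<inter> A)"
  shows "contract k F (matroid_of F E r P) A =
    matroid_of F (E - A) (r - card (T \<inter> A)) (minor_vector F (E - A) (T \<inter> A) P)"
proof -
  let ?B = "T \<inter> A" and ?E = "E - A"
  let ?D = "minor_vector F ?E ?B P" and ?d = "r - card (T \<inter> A)"
  let ?\<B> = "{I. P I \<noteq> None}" and ?\<D> = "{I. ?D I \<noteq> None}"
  note nz = plucker_nonzero_function[OF P]
  note cl = nonzero_functionD(1)[OF nz]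
  note W = plucker_imp_weak[OF E P]
  interpret B: bases E ?\<B> r by (rule plucker_bases[OF W])
  have TE: "T \<subseteq> E" "card T = r" "finite T" using B.basis_subset B.card_basis B.finite_basis T by auto
  have fin: "finite ?E" "finite ?B" "?E \<inter> ?B = {}" using E TE by auto
  have Br: "card ?B \<le> r" using card_mono[OF TE(3), of ?B] TE(2) by simp
  have D: "plucker k F ?E ?d ?D"
    by (rule minor_vector_plucker[OF E _ _ P T]) (use TE in auto)
  interpret D: bases ?E ?\<D> ?d by (rule plucker_bases[OF plucker_imp_weak[OF fin(1) D]])
  have Dcl: "?D I \<in> ocarrier F" for I by (rule minor_vector_closed) (rule cl)
  have cvcl: "circuit_vector F P \<tau> j \<in> ocarrier F" for \<tau> j by (rule circuit_vector_closed) (rule cl)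
  have dccl: "delete_coords (circuit_vector F P \<tau>) A j \<in> ocarrier F" for \<tau> j
    using cvcl by (simp add: delete_coords_def)
  have cv: "\<exists>s\<in>carrier F. circuit_vector F ?D \<tau> =
      scale F s (delete_coords (circuit_vector F P (\<tau> \<union> ?B)) A)" if "\<tau> \<subseteq> ?E" for \<tau>
  proof -
    have "supp (circuit_vector F P (\<tau> \<union> ?B)) \<subseteq> \<tau> \<union> ?B"
      unfolding supp_circuit_vector by (rule circuit_in_subset)
    then have "supp (circuit_vector F P (\<tau> \<union> ?B)) \<inter> ?B = supp (circuit_vector F P (\<tau> \<union> ?B)) \<inter> A"
      using that by blast
    then have "delete_coords (circuit_vector F P (\<tau> \<union> ?B)) ?B =
        delete_coords (circuit_vector F P (\<tau> \<union> ?B)) A"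
      by (rule delete_coords_cong)
    then show ?thesis using circuit_vector_minor_vector[of P, OF cl fin that] by metis
  qed
  have circ: "circuit_in ?\<D> \<tau> = circuit_in ?\<B> (\<tau> \<union> ?B) - A" if tau: "\<tau> \<subseteq> ?E" for \<tau>
  proof -
    obtain s where "circuit_vector F ?D \<tau> = scale F s (delete_coords (circuit_vector F P (\<tau> \<union> ?B)) A)"
      using cv[OF tau] by blast
    from arg_cong[OF this, of supp] show ?thesis
      by (simp only: supp_scale supp_circuit_vector supp_delete_coords)
  qed
  have card: "card (\<tau> \<union> ?B) = r + 1" if "\<tau> \<subseteq> ?E" "card \<tau> = ?d + 1" for \<tau>
  proof -
    have "finite \<tau>" using that fin(1) finite_subset by blast
    then show ?thesis using card_Un_disjoint[of \<tau> ?B] that fin(2) Br by auto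
  qed
  have max': "card (T' \<inter> A) \<le> card ?B" if "T' \<in> ?\<B>" for T' using max that by blast
  \<comment> \<open>Otherwise the restriction lies in a basis of the minor. Its union with
    \<open>?B\<close> can be altered inside \<open>A\<close> to absorb the rest of the circuit,
    giving a basis that contains a whole circuit.\<close>
  have contains: "\<exists>\<tau> j. \<tau> \<subseteq> ?E \<and> card \<tau> = ?d + 1 \<and> j \<in> circuit_in ?\<D> \<tau> \<and>
      circuit_in ?\<D> \<tau> \<subseteq> circuit_in ?\<B> \<sigma> - A"
    if \<sigma>: "\<sigma> \<subseteq> E" "card \<sigma> = r + 1" and i: "i \<in> circuit_in ?\<B> \<sigma> - A" for \<sigma> i
  proof -
    have "\<not> circuit_in ?\<B> \<sigma> - A \<subseteq> I" if I: "I \<in> ?\<D>" for I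
    proof
      assume sub: "circuit_in ?\<B> \<sigma> - A \<subseteq> I"
      have I': "I \<subseteq> ?E" "I \<union> ?B \<in> ?\<B>" using I by (auto simp: minor_vector_eq_None_iff)
      have IA: "(I \<union> ?B) \<inter> A = ?B" "(I \<union> ?B) - A = I" using I'(1) by blast+
      obtain U where U: "U \<in> ?\<B>" "U - A = (I \<union> ?B) - A" "circuit_in ?\<B> \<sigma> \<inter> A \<subseteq> U"
        by (rule B.absorb_circuit[OF max' I'(2) arg_cong[OF IA(1), of card] \<sigma>(2), of i]) (use i in auto)
      have "circuit_in ?\<B> \<sigma> \<subseteq> U" using U(2,3) IA(2) sub by blast
      then show False using B.circuit_not_subset_basis[OF \<sigma>(2) _ U(1)] i by blast
    qed
    moreover have "circuit_in ?\<B> \<sigma> - A \<subseteq> ?E" using \<sigma>(1) circuit_in_subset[of ?\<B> \<sigma>] by blast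
    ultimately show ?thesis using D.dependent_contains_circuit[of "circuit_in ?\<B> \<sigma> - A"] by metis
  qed
  have proportional: "\<exists>c\<in>carrier F. delete_coords (circuit_vector F P \<sigma>) A = scale F c (circuit_vector F ?D \<tau>)"
    if \<sigma>: "\<sigma> \<subseteq> E" "card \<sigma> = r + 1" and i: "i \<in> circuit_in ?\<B> \<sigma> - A"
      and \<tau>: "\<tau> \<subseteq> ?E" "card \<tau> = ?d + 1" "circuit_in ?\<D> \<tau> = circuit_in ?\<B> \<sigma> - A" for \<sigma> \<tau> i
  proof -
    let ?S = "circuit_in ?\<B> \<sigma>"
    have i\<tau>: "i \<in> \<tau>" "i \<notin> A" "P (\<tau> - {i} \<union> ?B) \<noteq> None"
      using i \<tau>(3) unfolding circuit_in_def by (auto simp: minor_vector_eq_None_iff set_eq_iff)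
    let ?T1 = "\<tau> - {i} \<union> ?B"
    have T1: "?T1 \<inter> A = ?B" "?T1 - A = \<tau> - {i}" using \<tau>(1) by blast+
    obtain U where U: "U \<in> ?\<B>" "card (U \<inter> A) = card ?B" "U - A = ?T1 - A" "?S \<inter> A \<subseteq> U"
      by (rule B.absorb_circuit[OF max' _ arg_cong[OF T1(1), of card] \<sigma>(2), of i]) (use i i\<tau> in auto)
    have iU: "i \<notin> U" using U(3) T1(2) i\<tau>(2) by blast
    note fund = B.fundamental_circuit[OF U(1) iU]
    have S: "?S \<subseteq> insert i U"
      using U(3,4) T1(2) \<tau>(3) circuit_in_subset[of ?\<D> \<tau>] by blast
    have UE: "insert i U \<subseteq> E" using B.basis_subset[OF U(1)] i\<tau>(1) \<tau>(1) by blast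
    obtain e where e: "e \<in> carrier F"
        "circuit_vector F P (insert i U) = scale F e (circuit_vector F P \<sigma>)"
      using circuit_vectors_proportional_subset[OF E W \<sigma> _ UE fund S] i by blast
    have eq: "\<tau> \<union> ?B - {i} = ?T1" "insert i U - {i} = U" "insert i U \<inter> A = U \<inter> A"
      "(\<tau> \<union> ?B) \<inter> A = ?B" using i\<tau>(2) iU \<tau>(1) by auto
    \<comment> \<open>\<open>insert i U\<close> and \<open>\<tau> \<union> ?B\<close> agree outside
      \<open>A\<close> but may carry different bases of \<open>A\<close>, so proportionality is
      available, and required, only outside \<open>A\<close>.\<close>
    have "\<exists>c\<in>carrier F. \<forall>a. a \<notin> A \<longrightarrow>
        circuit_vector F P (insert i U) a = Some c \<odot> circuit_vector F P (\<tau> \<union> ?B) a"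
    proof (rule circuit_vectors_proportional[OF E W max, of "\<tau> \<union> ?B" "insert i U" i])
      show "\<tau> \<union> ?B \<subseteq> E" using \<tau>(1) A by blast
      show "card (\<tau> \<union> ?B) = r + 1" by (rule card[OF \<tau>(1,2)])
      show "circuit_in ?\<B> (\<tau> \<union> ?B) - A \<subseteq> insert i U"
        unfolding circ[OF \<tau>(1), symmetric] \<tau>(3) using S by blast
    qed (use eq i\<tau> U UE fund in auto)
    then obtain f where f: "f \<in> carrier F"
        "delete_coords (circuit_vector F P (insert i U)) A =
          scale F f (delete_coords (circuit_vector F P (\<tau> \<union> ?B)) A)"
      by (auto simp: delete_coords_def scale_apply fun_eq_iff)
    obtain s where s: "s \<in> carrier F" "circuit_vector F ?D \<tau> =
        scale F s (delete_coords (circuit_vector F P (\<tau> \<union> ?B)) A)"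
      using cv[OF \<tau>(1)] by blast
    have Ds: "circuit_vector F ?D \<tau> j \<in> ocarrier F" for j
      by (rule circuit_vector_closed) (rule Dcl)
    have 1: "delete_coords (circuit_vector F P (\<tau> \<union> ?B)) A = scale F (inv s) (circuit_vector F ?D \<tau>)"
      by (rule scale_inverse[OF s(2,1) dccl])
    have 2: "delete_coords (circuit_vector F P \<sigma>) A =
        scale F (inv e) (delete_coords (circuit_vector F P (insert i U)) A)"
      by (rule scale_inverse[OF _ e(1) dccl]) (simp add: e(2) delete_coords_scale)
    have "delete_coords (circuit_vector F P \<sigma>) A =
        scale F (inv e \<otimes> (f \<otimes> inv s)) (circuit_vector F ?D \<tau>)"
      unfolding 2 f(2) 1 using s(1) e(1) f(1) Ds by (simp add: scale_scale)
    then show ?thesis using s(1) e(1) f(1) by blast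
  qed
  let ?\<X> = "{delete_coords C A |C. C \<in> circuits F (matroid_of F E r P)}"
  have "circuits F (matroid_of F ?E ?d ?D) = MinSupp ?\<X>"
  proof (intro subset_antisym subsetI)
    fix X assume "X \<in> circuits F (matroid_of F ?E ?d ?D)"
    then obtain c \<tau> i where X: "c \<in> carrier F" "\<tau> \<subseteq> ?E" "card \<tau> = ?d + 1"
      "i \<in> circuit_in ?\<D> \<tau>" "X = scale F c (circuit_vector F ?D \<tau>)"
      "supp X = circuit_in ?\<D> \<tau>"
      by (rule circuits_memE[of ?D, OF Dcl])
    obtain s where s: "s \<in> carrier F" "circuit_vector F ?D \<tau> =
        scale F s (delete_coords (circuit_vector F P (\<tau> \<union> ?B)) A)"
      using cv[OF X(2)] by blast
    have "X = delete_coords (scale F c (scale F s (circuit_vector F P (\<tau> \<union> ?B)))) A"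
      unfolding X(5) s(2) delete_coords_scale ..
    moreover have "\<tau> \<union> ?B \<subseteq> E" using X(2) A by blast
    then have "circuit_vector F P (\<tau> \<union> ?B) \<in> circuits F (matroid_of F E r P)"
      using circuit_vector_in_circuits[of P, OF cl _ card[OF X(2,3)]] X(4) circ[OF X(2)] by blast
    then have "scale F c (scale F s (circuit_vector F P (\<tau> \<union> ?B))) \<in> circuits F (matroid_of F E r P)"
      using scale_in_circuits[of P, OF cl] X(1) s(1) by blast
    ultimately have "X \<in> ?\<X>" by blast
    \<comment> \<open>A smaller restriction would contain the support of a circuit of the minor
      vector strictly inside \<open>supp X\<close>, but circuits of one matroid are
      incomparable.\<close>
    moreover have "\<not> supp Y \<subset> supp X" if Y: "Y \<in> ?\<X>" "supp Y \<noteq> {}" for Y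
    proof
      assume sub: "supp Y \<subset> supp X"
      obtain C where C: "C \<in> circuits F (matroid_of F E r P)" "Y = delete_coords C A" using Y(1) by blast
      obtain \<sigma> where \<sigma>: "\<sigma> \<subseteq> E" "card \<sigma> = r + 1" "supp C = circuit_in ?\<B> \<sigma>"
        by (rule circuits_memE[of P, OF cl C(1)])
      have sY: "supp Y = circuit_in ?\<B> \<sigma> - A" unfolding C(2) supp_delete_coords \<sigma>(3) ..
      obtain \<tau>' j where \<tau>': "card \<tau>' = ?d + 1" "j \<in> circuit_in ?\<D> \<tau>'"
        "circuit_in ?\<D> \<tau>' \<subseteq> supp Y"
        using contains[OF \<sigma>(1,2)] Y(2) unfolding sY by blast
      have sub': "circuit_in ?\<D> \<tau>' \<subset> circuit_in ?\<D> \<tau>" using \<tau>'(3) sub X(6) by blast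
      then have "circuit_in ?\<D> \<tau>' \<subseteq> \<tau>" using circuit_in_subset[of ?\<D> \<tau>] by blast
      then have "circuit_in ?\<D> \<tau> = circuit_in ?\<D> \<tau>'"
        by (rule D.circuit_in_eq[OF \<tau>'(1) X(3) \<tau>'(2) X(4)])
      then show False using sub' by simp
    qed
    ultimately show "X \<in> MinSupp ?\<X>" unfolding MinSupp_def using X(4,6) by blast
  next
    fix Y assume Y: "Y \<in> MinSupp ?\<X>"
    then obtain C where C: "C \<in> circuits F (matroid_of F E r P)" "Y = delete_coords C A" "supp Y \<noteq> {}"
      unfolding MinSupp_def by blast
    obtain c \<sigma> where \<sigma>: "c \<in> carrier F" "\<sigma> \<subseteq> E" "card \<sigma> = r + 1"
        "C = scale F c (circuit_vector F P \<sigma>)" "supp C = circuit_in ?\<B> \<sigma>"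
      by (rule circuits_memE[of P, OF cl C(1)])
    have sY: "supp Y = circuit_in ?\<B> \<sigma> - A" unfolding C(2) supp_delete_coords \<sigma>(5) ..
    then obtain i where i: "i \<in> circuit_in ?\<B> \<sigma> - A" using C(3) by blast
    obtain \<tau> j where \<tau>: "\<tau> \<subseteq> ?E" "card \<tau> = ?d + 1" "j \<in> circuit_in ?\<D> \<tau>"
        "circuit_in ?\<D> \<tau> \<subseteq> circuit_in ?\<B> \<sigma> - A"
      using contains[OF \<sigma>(2,3) i] by blast
    have "\<tau> \<union> ?B \<subseteq> E" using \<tau>(1) A by blast
    then have "circuit_vector F P (\<tau> \<union> ?B) \<in> circuits F (matroid_of F E r P)"
      using circuit_vector_in_circuits[of P, OF cl _ card[OF \<tau>(1,2)]] \<tau>(3) circ[OF \<tau>(1)] by blast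
    then have "delete_coords (circuit_vector F P (\<tau> \<union> ?B)) A \<in> ?\<X>" by blast
    moreover have "supp (delete_coords (circuit_vector F P (\<tau> \<union> ?B)) A) = circuit_in ?\<D> \<tau>"
      unfolding supp_delete_coords supp_circuit_vector circ[OF \<tau>(1)] ..
    ultimately have "\<not> circuit_in ?\<D> \<tau> \<subset> supp Y"
      using Y \<tau>(3) unfolding MinSupp_def by blast
    then have eq: "circuit_in ?\<D> \<tau> = circuit_in ?\<B> \<sigma> - A" using \<tau>(4) sY by blast
    obtain d where d: "d \<in> carrier F"
        "delete_coords (circuit_vector F P \<sigma>) A = scale F d (circuit_vector F ?D \<tau>)"
      using proportional[OF \<sigma>(2,3) i \<tau>(1,2) eq] by blast
    have "Y = scale F c (scale F d (circuit_vector F ?D \<tau>))"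
      unfolding C(2) \<sigma>(4) delete_coords_scale d(2) ..
    moreover have "circuit_vector F ?D \<tau> \<in> circuits F (matroid_of F ?E ?d ?D)"
      by (rule circuit_vector_in_circuits[of ?D, OF Dcl \<tau>(1-3)])
    ultimately show "Y \<in> circuits F (matroid_of F ?E ?d ?D)"
      using scale_in_circuits[of ?D, OF Dcl] \<sigma>(1) d(1) by blast
  qed
  then show ?thesis
    unfolding contract_def matroid_of_simps by (rule matroid_with_circuits_eq[OF fin(1) D])
qed

end


section \<open>Loops and coloops\<close>

text \<open>It has the same sign exponent as \<open>minor_vector\<close> with \<open>S = A\<close>
  and is thus undone by it, so results on \<open>minor_vector\<close> can be read backwards.\<close>

definition coloop_vector ::
  "'a tract_struct \<Rightarrow> 'e::linorder set \<Rightarrow> ('e set \<Rightarrow> 'a option) \<Rightarrow> 'e set \<Rightarrow> 'a option" where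
  "coloop_vector F A P I =
    (if A \<subseteq> I then sign_unit F (crossings (I - A) A) \<odot>\<^bsub>F\<^esub> P (I - A) else None)"

lemma coloop_vector_eq_None_iff:
  "coloop_vector F A P I = None \<longleftrightarrow> \<not> A \<subseteq> I \<or> P (I - A) = None"
  by (simp add: coloop_vector_def)

context tract
begin

lemma coloop_vector_closed: "(\<And>I. P I \<in> ocarrier F) \<Longrightarrow> coloop_vector F A P I \<in> ocarrier F"
  by (simp add: coloop_vector_def)

lemma minor_vector_coloop_vector:
  assumes nz: "nonzero_function F E r P" and "E \<inter> A = {}"
  shows "minor_vector F E A (coloop_vector F A P) = P"
proof
  fix I
  show "minor_vector F E A (coloop_vector F A P) I = P I"
  proof (cases "I \<subseteq> E")
    case True
    then have "I \<union> A - A = I" using assms(2) by blast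
    then show ?thesis
      using True nonzero_functionD(1)[OF nz]
      by (simp add: minor_vector_def coloop_vector_def sign_unit_left_add sign_unit_even)
  next
    case False
    then have "P I = None" using nonzero_functionD(2)[OF nz] by blast
    then show ?thesis using False by (simp add: minor_vector_def)
  qed
qed

text \<open>The vector stays the same on the larger ground set. A relation whose index sets are not
  both inside \<open>E\<close> has only zero terms, and a set containing an element \<open>i\<close>
  of \<open>A\<close> can have a nonzero circuit vector only at the coordinate
  \<open>i\<close>.\<close>

lemma add_loops_matroid_of:
  assumes E: "finite E" "finite A" "E \<inter> A = {}" and P: "plucker k F E r P"
  shows "plucker k F (E \<union> A) r P"
    and "add_loops k F (matroid_of F E r P) A = matroid_of F (E \<union> A) r P"
proof -
  note nz = plucker_nonzero_function[OF P]
  note cl = nonzero_functionD(1)[OF nz]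
  have sub: "I \<subseteq> E" if "P I \<noteq> None" for I using that nonzero_functionD(2)[OF nz] by blast
  have nz': "nonzero_function F (E \<union> A) r P"
    using nz unfolding nonzero_function_def subsets_def by blast
  have rel: "plucker_relation F P I J"
    if "I \<subseteq> E \<Longrightarrow> J \<subseteq> E \<Longrightarrow> plucker_relation F P I J" for I J
  proof (cases "I \<subseteq> E \<and> J \<subseteq> E")
    case False
    have "plucker_term F P I J j = None" if "j \<in> J - I" for j
    proof (rule ccontr)
      assume "plucker_term F P I J j \<noteq> None"
      then have "insert j I \<subseteq> E" "J - {j} \<subseteq> E"
        using sub unfolding plucker_term_eq_None_iff by blast+
      then show False using False by blast
    qed
    then show ?thesis
      using plucker_relation_iff[of P, OF cl] formal_sum_empty[of "J - I" "plucker_term F P I J"]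
        zero_null by simp
  qed (use that in blast)
  show P': "plucker k F (E \<union> A) r P"
  proof (cases k)
    case Strong
    then have P': "plucker_relation F P I J"
      if "I \<subseteq> E" "card I + 1 = r" "J \<in> subsets E (r + 1)" for I J
      using P that by simp
    have "plucker_relation F P I J"
      if IJ: "card I + 1 = r" "J \<in> subsets (E \<union> A) (r + 1)" for I J
    proof (rule rel)
      assume "I \<subseteq> E" "J \<subseteq> E"
      then show "plucker_relation F P I J" using P'[of I J] IJ unfolding subsets_def by blast
    qed
    then show ?thesis using Strong nz' by simp
  next
    case Weak
    then have P': "plucker_relation F P I J"
      if "I \<subseteq> E" "card I + 1 = r" "J \<in> subsets E (r + 1)" "card (J - I) = 3" for I J
      using P that by simp
    have "plucker_relation F P I J"
      if IJ: "card I + 1 = r" "J \<in> subsets (E \<union> A) (r + 1)" "card (J - I) = 3" for I J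
    proof (rule rel)
      assume "I \<subseteq> E" "J \<subseteq> E"
      then show "plucker_relation F P I J" using P'[of I J] IJ unfolding subsets_def by blast
    qed
    moreover have "matroid_bases (E \<union> A) {I. P I \<noteq> None}"
    proof -
      have "matroid_bases E {I. P I \<noteq> None}" using P Weak by simp
      then show ?thesis using E(2) sub unfolding matroid_bases_def by blast
    qed
    ultimately show ?thesis using Weak nz' by simp
  qed
  have loop: "circuit_vector F P \<tau> = (\<lambda>j. if j = i then circuit_vector F P \<tau> i else None)"
    if "i \<in> \<tau>" "i \<in> A" for \<tau> i
  proof
    fix j
    have "circuit_vector F P \<tau> j = None" if j: "j \<noteq> i"
    proof (rule ccontr)
      assume "circuit_vector F P \<tau> j \<noteq> None"
      then have "\<tau> - {j} \<subseteq> E" using sub by (simp add: circuit_vector_eq_None_iff circuit_in_def)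
      then show False using \<open>i \<in> \<tau>\<close> \<open>i \<in> A\<close> j E(3) by blast
    qed
    then show "circuit_vector F P \<tau> j = (if j = i then circuit_vector F P \<tau> i else None)" by simp
  qed
  have cvcl: "circuit_vector F P \<tau> j \<in> ocarrier F" for \<tau> j by (rule circuit_vector_closed) (rule cl)
  have "circuits F (matroid_of F (E \<union> A) r P) = circuits F (matroid_of F E r P) \<union>
      {(\<lambda>j. if j = i then Some \<alpha> else None) |i \<alpha>. i \<in> A \<and> \<alpha> \<in> carrier F}" (is "?L = ?C \<union> ?loops")
  proof (intro subset_antisym subsetI)
    fix X assume "X \<in> ?L"
    then obtain c \<tau> i where X: "c \<in> carrier F" "\<tau> \<subseteq> E \<union> A" "card \<tau> = r + 1"
      "i \<in> circuit_in {I. P I \<noteq> None} \<tau>" "X = scale F c (circuit_vector F P \<tau>)"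
      by (rule circuits_memE[of P, OF cl])
    have i: "i \<in> \<tau>" "P (\<tau> - {i}) \<noteq> None" using X(4) by (auto simp: circuit_in_def)
    show "X \<in> ?C \<union> ?loops"
    proof (cases "i \<in> A")
      case False
      then have "\<tau> \<subseteq> E" using sub[OF i(2)] i(1) X(2) by blast
      then have "circuit_vector F P \<tau> \<in> ?C"
        using circuit_vector_in_circuits[of P, OF cl _ X(3,4)] by blast
      then show ?thesis unfolding X(5) using scale_in_circuits[of P, OF cl] X(1) by blast
    next
      case True
      obtain a where a: "circuit_vector F P \<tau> i = Some a" "a \<in> carrier F"
        using cvcl[of \<tau> i] X(4) by (cases "circuit_vector F P \<tau> i") (auto simp: circuit_vector_eq_None_iff)
      have "X j = (if j = i then Some (c \<otimes> a) else None)" for j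
        using fun_cong[OF loop[OF i(1) True], of j] a(1) unfolding X(5) scale_apply by auto
      then have "X = (\<lambda>j. if j = i then Some (c \<otimes> a) else None)" by blast
      then show ?thesis using True X(1) a(2) by blast
    qed
  next
    fix X assume "X \<in> ?C \<union> ?loops"
    then consider "X \<in> ?C" | i \<alpha> where "i \<in> A" "\<alpha> \<in> carrier F" "X = (\<lambda>j. if j = i then Some \<alpha> else None)"
      by blast
    then show "X \<in> ?L"
    proof cases
      case 1
      then obtain c \<tau> i where X: "c \<in> carrier F" "\<tau> \<subseteq> E" "card \<tau> = r + 1"
        "i \<in> circuit_in {I. P I \<noteq> None} \<tau>" "X = scale F c (circuit_vector F P \<tau>)"
        by (rule circuits_memE[of P, OF cl])
      have "circuit_vector F P \<tau> \<in> ?L"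
        using circuit_vector_in_circuits[of P \<tau> "E \<union> A", OF cl _ X(3,4)] X(2) by blast
      then show ?thesis unfolding X(5) using scale_in_circuits[of P, OF cl] X(1) by blast
    next
      case 2
      \<comment> \<open>Adjoining \<open>i\<close> to any basis realizes the loop at
        \<open>i\<close>; rescaling by \<open>\<alpha> \<otimes> inv a\<close> gives the prescribed
        coefficient.\<close>
      obtain T where T: "P T \<noteq> None" using nz unfolding nonzero_function_def by blast
      then have TE: "T \<subseteq> E" "card T = r" using nonzero_functionD[OF nz] by auto
      have iT: "i \<notin> T" using TE(1) 2(1) E(3) by blast
      let ?\<tau> = "insert i T"
      have "insert i T - {i} = T" using iT by blast
      then have i: "i \<in> circuit_in {I. P I \<noteq> None} ?\<tau>" using T by (simp add: circuit_in_def)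
      have "finite T" using TE(1) E(1) finite_subset by blast
      then have card: "card ?\<tau> = r + 1" using iT TE(2) by simp
      have "?\<tau> \<subseteq> E \<union> A" using TE(1) 2(1) by blast
      then have cv: "circuit_vector F P ?\<tau> \<in> ?L"
        using circuit_vector_in_circuits[of P, OF cl _ card i] by blast
      obtain a where a: "circuit_vector F P ?\<tau> i = Some a" "a \<in> carrier F"
        using cvcl[of ?\<tau> i] i by (cases "circuit_vector F P ?\<tau> i") (auto simp: circuit_vector_eq_None_iff)
      have "\<alpha> = \<alpha> \<otimes> inv a \<otimes> a" using a(2) 2(2) by (simp add: m_assoc)
      then have "X j = scale F (\<alpha> \<otimes> inv a) (circuit_vector F P ?\<tau>) j" for j
        using fun_cong[OF loop[OF insertI1 2(1), of T], of j] a(1) unfolding 2(3) scale_apply by auto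
      then have "X = scale F (\<alpha> \<otimes> inv a) (circuit_vector F P ?\<tau>)" by blast
      then show ?thesis using scale_in_circuits[of P, OF cl cv] a(2) 2(2) by simp
    qed
  qed
  then show "add_loops k F (matroid_of F E r P) A = matroid_of F (E \<union> A) r P"
    unfolding add_loops_def matroid_of_simps
    by (rule matroid_with_circuits_eq[OF finite_UnI[OF E(1,2)] P'])
qed

text \<open>A relation has nonzero terms only if both index sets contain \<open>A\<close>, and it
  then comes from a relation of \<open>P\<close>. Circuit vectors vanish on \<open>A\<close>, since
  a set from which an element of \<open>A\<close> has been removed no longer contains
  \<open>A\<close>.\<close>

lemma add_coloops_matroid_of:
  assumes E: "finite E" "finite A" "E \<inter> A = {}" and P: "plucker k F E r P"
  shows "add_coloops k F (matroid_of F E r P) A =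
    matroid_of F (E \<union> A) (r + card A) (coloop_vector F A P)"
proof -
  let ?Q = "coloop_vector F A P"
  note nz = plucker_nonzero_function[OF P]
  note cl = nonzero_functionD(1)[OF nz]
  have Qcl: "?Q I \<in> ocarrier F" for I by (rule coloop_vector_closed) (rule cl)
  note minor = minor_vector_coloop_vector[OF nz E(3)]
  have supp: "?Q I \<noteq> None \<longleftrightarrow> A \<subseteq> I \<and> P (I - A) \<noteq> None" for I by (simp add: coloop_vector_eq_None_iff)
  have card: "card (I \<union> A) = card I + card A" if "I \<subseteq> E" for I
    using card_Un_disjoint[of I A] that E finite_subset[of I E] by blast
  have decomp: "I = I - A \<union> A" if "A \<subseteq> I" for I using that by blast
  have nzQ: "nonzero_function F (E \<union> A) (r + card A) ?Q"
    unfolding nonzero_function_def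
  proof (intro conjI allI impI)
    fix I assume I: "I \<notin> subsets (E \<union> A) (r + card A)"
    show "?Q I = None"
    proof (rule ccontr)
      assume "?Q I \<noteq> None"
      then have *: "A \<subseteq> I" "P (I - A) \<noteq> None" using supp by blast+
      then have "I - A \<subseteq> E" "card (I - A) = r" using nonzero_functionD[OF nz] by blast+
      then show False using I card[of "I - A"] decomp[OF *(1)] unfolding subsets_def by auto
    qed
  next
    fix I a assume "?Q I = Some a"
    then show "a \<in> carrier F" using Qcl[of I] by simp
  next
    obtain T where T: "P T \<noteq> None" using nz unfolding nonzero_function_def by blast
    then have "T \<union> A - A = T" using nonzero_functionD(2)[OF nz T] E(3) by blast
    then have "?Q (T \<union> A) \<noteq> None" using T supp by simp
    then show "\<exists>I. ?Q I \<noteq> None" by blast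
  qed
  have rel: "plucker_relation F ?Q I J"
    if IJ: "I \<subseteq> E \<union> A" "J \<subseteq> E \<union> A"
      and imp: "A \<subseteq> I \<Longrightarrow> A \<subseteq> J \<Longrightarrow> plucker_relation F P (I - A) (J - A)" for I J
  proof (cases "A \<subseteq> I \<and> A \<subseteq> J")
    case True
    have "I - A \<subseteq> E" "J - A \<subseteq> E" using IJ by blast+
    then have "plucker_relation F ?Q (I - A \<union> A) (J - A \<union> A)"
      using plucker_relation_minor_vector[of ?Q E A "I - A" "J - A", OF Qcl E] imp True
      unfolding minor by blast
    then show ?thesis using decomp True by metis
  next
    case False
    have "plucker_term F ?Q I J j = None" if "j \<in> J - I" for j
      unfolding plucker_term_eq_None_iff coloop_vector_eq_None_iff using False that by blast
    then show ?thesis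
      using plucker_relation_iff[of ?Q, OF Qcl] formal_sum_empty[of "J - I" "plucker_term F ?Q I J"]
        zero_null by simp
  qed
  have sizes: "I - A \<subseteq> E" "J - A \<subseteq> E" "card (I - A) + 1 = r" "J - A \<in> subsets E (r + 1)"
    "J - A - (I - A) = J - I"
    if "I \<subseteq> E \<union> A" "card I + 1 = r + card A" "J \<in> subsets (E \<union> A) (r + card A + 1)" "A \<subseteq> I" "A \<subseteq> J"
    for I J
  proof -
    have J: "J \<subseteq> E \<union> A" "card J = r + card A + 1" using that(3) unfolding subsets_def by blast+
    show 1: "I - A \<subseteq> E" "J - A \<subseteq> E" "J - A - (I - A) = J - I" using that J by blast+
    show "card (I - A) + 1 = r" using card[OF 1(1)] decomp[OF that(4)] that(2) by simp
    have "card (J - A) = r + 1" using card[OF 1(2)] decomp[OF that(5)] J(2) by simp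
    then show "J - A \<in> subsets E (r + 1)" using 1(2) unfolding subsets_def by blast
  qed
  have Q: "plucker k F (E \<union> A) (r + card A) ?Q"
  proof (cases k)
    case Strong
    then have P': "plucker_relation F P I J"
      if "I \<subseteq> E" "card I + 1 = r" "J \<in> subsets E (r + 1)" for I J
      using P that by simp
    have "plucker_relation F ?Q I J"
      if "I \<subseteq> E \<union> A" "card I + 1 = r + card A" "J \<in> subsets (E \<union> A) (r + card A + 1)" for I J
      using rel[of I J] P' sizes[OF that] that unfolding subsets_def by blast
    then show ?thesis using Strong nzQ by simp
  next
    case Weak
    then have P': "plucker_relation F P I J"
      if "I \<subseteq> E" "card I + 1 = r" "J \<in> subsets E (r + 1)" "card (J - I) = 3" for I J
      using P that by simp
    have "plucker_relation F ?Q I J"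
      if IJ: "I \<subseteq> E \<union> A" "card I + 1 = r + card A" "J \<in> subsets (E \<union> A) (r + card A + 1)"
        and 3: "card (J - I) = 3" for I J
    proof (rule rel)
      show "J \<subseteq> E \<union> A" using IJ(3) unfolding subsets_def by blast
      assume A: "A \<subseteq> I" "A \<subseteq> J"
      show "plucker_relation F P (I - A) (J - A)"
        using P'[of "I - A" "J - A"] sizes[OF IJ A] 3 by simp
    qed (rule IJ)
    moreover have "matroid_bases (E \<union> A) {I. ?Q I \<noteq> None}"
    proof -
      have "matroid_bases E {I. P I \<noteq> None}" using P Weak by simp
      then interpret bases E "{I. P I \<noteq> None}" r
        by unfold_locales (use nonzero_functionD(3)[OF nz] in auto)
      have "\<exists>y\<in>J - I. ?Q (insert y (I - {x})) \<noteq> None"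
        if I: "?Q I \<noteq> None" and J: "?Q J \<noteq> None" and x: "x \<in> I - J" for I J x
      proof -
        have IJ: "A \<subseteq> I" "A \<subseteq> J" "I - A \<in> {I. P I \<noteq> None}" "J - A \<in> {I. P I \<noteq> None}"
          using I J supp by blast+
        have xA: "x \<in> I - A" "x \<notin> J - A" "x \<notin> A" using x IJ by blast+
        obtain y where y: "y \<in> J - A" "y \<notin> I - A" "insert y (I - A - {x}) \<in> {I. P I \<noteq> None}"
          by (rule exchange[OF IJ(3,4) xA(1,2)])
        have "insert y (I - {x}) - A = insert y (I - A - {x})" using y(1) by blast
        moreover have "A \<subseteq> insert y (I - {x})" using IJ(1) xA(3) by blast
        ultimately have "?Q (insert y (I - {x})) \<noteq> None" using y(3) supp by simp
        then show ?thesis using y(1,2) by blast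
      qed
      moreover have "{I. ?Q I \<noteq> None} \<subseteq> Pow (E \<union> A)" using nonzero_functionD(2)[OF nzQ] by blast
      moreover have "{I. ?Q I \<noteq> None} \<noteq> {}" using nzQ unfolding nonzero_function_def by blast
      moreover have "finite (E \<union> A)" using E by simp
      ultimately show ?thesis unfolding matroid_bases_def by blast
    qed
    ultimately show ?thesis using Weak nzQ by simp
  qed
  have cv: "\<exists>s\<in>carrier F. circuit_vector F P \<tau> = scale F s (circuit_vector F ?Q (\<tau> \<union> A))"
    if tau: "\<tau> \<subseteq> E" for \<tau>
  proof -
    obtain s where s: "s \<in> carrier F"
        "circuit_vector F P \<tau> = scale F s (delete_coords (circuit_vector F ?Q (\<tau> \<union> A)) A)"
      using circuit_vector_minor_vector[of ?Q, OF Qcl E tau] unfolding minor by blast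
    have "supp (circuit_vector F ?Q (\<tau> \<union> A)) \<inter> A = {}"
      unfolding supp_circuit_vector circuit_in_def using supp by blast
    then show ?thesis using s delete_coords_id by metis
  qed
  have circ: "circuit_in {I. P I \<noteq> None} \<tau> = circuit_in {I. ?Q I \<noteq> None} (\<tau> \<union> A)"
    if tau: "\<tau> \<subseteq> E" for \<tau>
  proof -
    obtain s where "circuit_vector F P \<tau> = scale F s (circuit_vector F ?Q (\<tau> \<union> A))"
      using cv[OF tau] by blast
    from arg_cong[OF this, of supp] show ?thesis by (simp only: supp_scale supp_circuit_vector)
  qed
  have Qcv: "circuit_vector F ?Q \<tau> j \<in> ocarrier F" for \<tau> j by (rule circuit_vector_closed) (rule Qcl)
  have "circuits F (matroid_of F (E \<union> A) (r + card A) ?Q) = circuits F (matroid_of F E r P)"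
  proof (intro subset_antisym subsetI)
    fix X assume "X \<in> circuits F (matroid_of F (E \<union> A) (r + card A) ?Q)"
    then obtain c \<sigma> i where X: "c \<in> carrier F" "\<sigma> \<subseteq> E \<union> A" "card \<sigma> = r + card A + 1"
      "i \<in> circuit_in {I. ?Q I \<noteq> None} \<sigma>" "X = scale F c (circuit_vector F ?Q \<sigma>)"
      by (rule circuits_memE[of ?Q, OF Qcl])
    have "A \<subseteq> \<sigma>" using X(4) supp unfolding circuit_in_def by blast
    then have s: "\<sigma> - A \<subseteq> E" "\<sigma> - A \<union> A = \<sigma>" using X(2) by blast+
    have "card (\<sigma> - A) = r + 1" using card[OF s(1)] s(2) X(3) by simp
    then have "circuit_vector F P (\<sigma> - A) \<in> circuits F (matroid_of F E r P)"
      using circuit_vector_in_circuits[of P, OF cl s(1)] X(4) circ[OF s(1)] s(2) by simp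
    moreover obtain d where d: "d \<in> carrier F"
        "circuit_vector F P (\<sigma> - A) = scale F d (circuit_vector F ?Q \<sigma>)"
      using cv[OF s(1)] s(2) by auto
    then have "circuit_vector F ?Q \<sigma> = scale F (inv d) (circuit_vector F P (\<sigma> - A))"
      by (intro scale_inverse[OF d(2,1) Qcv])
    ultimately have "circuit_vector F ?Q \<sigma> \<in> circuits F (matroid_of F E r P)"
      using scale_in_circuits[of P, OF cl] d(1) by simp
    then show "X \<in> circuits F (matroid_of F E r P)"
      unfolding X(5) using scale_in_circuits[of P, OF cl] X(1) by blast
  next
    fix X assume "X \<in> circuits F (matroid_of F E r P)"
    then obtain c \<tau> i where X: "c \<in> carrier F" "\<tau> \<subseteq> E" "card \<tau> = r + 1"
      "i \<in> circuit_in {I. P I \<noteq> None} \<tau>" "X = scale F c (circuit_vector F P \<tau>)"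
      by (rule circuits_memE[of P, OF cl])
    have "\<tau> \<union> A \<subseteq> E \<union> A" "card (\<tau> \<union> A) = r + card A + 1" using X(2,3) card[OF X(2)] by auto
    then have "circuit_vector F ?Q (\<tau> \<union> A) \<in> circuits F (matroid_of F (E \<union> A) (r + card A) ?Q)"
      using circuit_vector_in_circuits[of ?Q, OF Qcl] X(4) unfolding circ[OF X(2)] by blast
    then show "X \<in> circuits F (matroid_of F (E \<union> A) (r + card A) ?Q)"
      unfolding X(5) using cv[OF X(2)] scale_in_circuits[of ?Q, OF Qcl] X(1) by metis
  qed
  then show ?thesis
    unfolding add_coloops_def matroid_of_simps
    by (rule matroid_with_circuits_eq[OF finite_UnI[OF E(1,2)] Q])
qed

end


section \<open>Duality\<close>

context tract
begin

text \<open>If \<open>I\<close> meets \<open>Z\<close>, its complement misses part of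
  \<open>Z\<close> and both sides vanish. Otherwise the crossings of \<open>I\<close> and of its
  complement in \<open>E - Z\<close> with \<open>Z\<close> add up to those of \<open>E - Z\<close>
  with \<open>Z\<close>, which do not depend on \<open>I\<close>.\<close>

lemma dual_vector_coloop_vector:
  assumes E: "finite E" and Z: "Z \<subseteq> E" and nz: "nonzero_function F (E - Z) r Q"
  shows "dual_vector F E (coloop_vector F Z Q) I =
    sign_unit F (crossings (E - Z) Z) \<odot> dual_vector F (E - Z) Q I"
proof -
  note cl = nonzero_functionD(1)[OF nz]
  have ccl: "coloop_vector F Z Q I \<in> ocarrier F" for I by (rule coloop_vector_closed) (rule cl)
  show ?thesis
  proof (cases "I \<subseteq> E - Z")
    case False
    then have "\<not> I \<subseteq> E \<or> \<not> Z \<subseteq> E - I" using Z by blast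
    then have "dual_vector F E (coloop_vector F Z Q) I = None"
      unfolding dual_vector_eq_None_iff coloop_vector_eq_None_iff by blast
    then show ?thesis using False by (simp add: dual_vector_def)
  next
    case True
    define K where "K = E - Z - I"
    have fin: "finite I" "finite K" "finite Z" 
      using finite_subset[OF _ E, of I] finite_subset[OF Z E] True E by (auto simp: K_def)
    have K: "E - I = K \<union> Z" "K \<inter> Z = {}" "E - Z = I \<union> K" "I \<inter> K = {}" "E - I - Z = K" "Z \<subseteq> E - I"
      "I \<subseteq> E"
      using True Z by (auto simp: K_def)
    have "crossings I (K \<union> Z) = crossings I K + crossings I Z"
      by (rule crossings_Un_right[OF fin(1,2,3) K(2)])
    moreover have "crossings (I \<union> K) Z = crossings I Z + crossings K Z"
      by (rule crossings_Un_left[OF fin K(4)])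
    ultimately have sign: "sign_unit F (crossings I (E - I) + crossings K Z) =
        sign_unit F (crossings (E - Z) Z + crossings I K)"
      unfolding K(1,3) by (intro sign_unit_cong) (simp, argo)
    have "dual_vector F E (coloop_vector F Z Q) I =
        sign_unit F (crossings I (E - I)) \<odot> conj_opt (sign_unit F (crossings K Z) \<odot> Q K)"
      unfolding dual_vector_eq[of E "coloop_vector F Z Q", OF E ccl] using K(5,6,7)
      by (simp add: coloop_vector_def)
    also have "\<dots> = sign_unit F (crossings I (E - I) + crossings K Z) \<odot> conj_opt (Q K)"
      using cl by (simp add: conj_opt_mult conj_opt_sign_unit sign_unit_left_add)
    also have "\<dots> = sign_unit F (crossings (E - Z) Z) \<odot> (sign_unit F (crossings I K) \<odot> conj_opt (Q K))"
      unfolding sign using cl by (simp add: sign_unit_left_add)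
    also have "sign_unit F (crossings I K) \<odot> conj_opt (Q K) = dual_vector F (E - Z) Q I"
      using dual_vector_eq[of "E - Z" Q I] E cl True by (simp add: K_def)
    finally show ?thesis .
  qed
qed

text \<open>With \<open>K\<close> the complement of \<open>I\<close> in \<open>E - Z\<close>, the
  complement of \<open>I \<union> (Z - B)\<close> in \<open>E\<close> is
  \<open>K \<union> B\<close>. Both sides thus read off the same value of \<open>P\<close>, and only
  the sign has to be seen to be independent of \<open>I\<close>.\<close>

lemma dual_vector_minor_vector:
  assumes E: "finite E" and Z: "Z \<subseteq> E" "B \<subseteq> Z" and nz: "nonzero_function F E r P"
  obtains n where "\<And>I. dual_vector F (E - Z) (minor_vector F (E - Z) B P) I =
    sign_unit F n \<odot> minor_vector F (E - Z) (Z - B) (dual_vector F E P) I"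
proof
  fix I
  let ?B = "Z - B"
  \<comment> \<open>The product comes from interchanging \<open>K\<close> and \<open>Z - B\<close>,
    where \<open>K\<close> has \<open>r - card B\<close> elements whenever the value is nonzero. The
    other summands collect the remaining crossings between blocks, completed to all of
    \<open>E - Z\<close>.\<close>
  let ?n = "crossings (E - Z) B + crossings (E - Z) ?B + (r - card B) * card ?B + crossings ?B B"
  note cl = nonzero_functionD(1)[OF nz]
  have mcl: "minor_vector F (E - Z) B P I \<in> ocarrier F" for I by (rule minor_vector_closed) (rule cl)
  define K where "K = E - Z - I"
  show "dual_vector F (E - Z) (minor_vector F (E - Z) B P) I =
    sign_unit F ?n \<odot> minor_vector F (E - Z) ?B (dual_vector F E P) I"
  proof (cases "I \<subseteq> E - Z")
    case False
    then show ?thesis by (simp add: dual_vector_def minor_vector_def)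
  next
    case True
    have fin: "finite I" "finite K" "finite B" "finite ?B"
      using finite_subset[OF _ E, of I] finite_subset[OF _ E, of Z] finite_subset[of B Z] True Z E
      by (auto simp: K_def)
    have sets: "E - Z = I \<union> K" "I \<inter> K = {}" "I \<inter> ?B = {}" "K \<inter> B = {}" "K \<inter> ?B = {}"
      "E - (I \<union> ?B) = K \<union> B" "I \<union> ?B \<subseteq> E" "E - Z - I = K" "K \<subseteq> E - Z"
      using True Z by (auto simp: K_def)
    have L: "dual_vector F (E - Z) (minor_vector F (E - Z) B P) I =
        sign_unit F (crossings I K + crossings K B) \<odot> conj_opt (P (K \<union> B))"
    proof -
      have "dual_vector F (E - Z) (minor_vector F (E - Z) B P) I =
          sign_unit F (crossings I K) \<odot> conj_opt (minor_vector F (E - Z) B P K)"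
        using dual_vector_eq[of "E - Z" "minor_vector F (E - Z) B P" I] E mcl True sets(8) by simp
      also have "minor_vector F (E - Z) B P K = sign_unit F (crossings K B) \<odot> P (K \<union> B)"
        using sets(9) by (simp add: minor_vector_def)
      finally show ?thesis using cl by (simp add: conj_opt_mult conj_opt_sign_unit sign_unit_left_add)
    qed
    have R: "sign_unit F ?n \<odot> minor_vector F (E - Z) ?B (dual_vector F E P) I =
        sign_unit F (?n + (crossings I ?B + crossings (I \<union> ?B) (K \<union> B))) \<odot> conj_opt (P (K \<union> B))"
      using dual_vector_eq[of E P "I \<union> ?B"] E cl True sets(6,7)
      by (simp add: minor_vector_def sign_unit_left_add)
    show ?thesis
    \<comment> \<open>If the value vanishes, the size of \<open>K\<close> is unknown, but no sign
      has to be compared.\<close>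
    proof (cases "P (K \<union> B)")
      case None
      then show ?thesis unfolding L R by simp
    next
      case (Some a)
      then have "card (K \<union> B) = r" using nonzero_functionD(3)[OF nz, of "K \<union> B"] by simp
      then have cK: "r - card B = card K" using card_Un_disjoint[OF fin(2,3) sets(4)] by simp
      have cr: "crossings (I \<union> ?B) (K \<union> B) =
          crossings I K + crossings I B + (crossings ?B K + crossings ?B B)"
        "crossings (I \<union> K) B = crossings I B + crossings K B"
        "crossings (I \<union> K) ?B = crossings I ?B + crossings K ?B"
        using crossings_Un_left[OF fin(1,4) finite_UnI[OF fin(2,3)] sets(3)]
          crossings_Un_right[OF fin(1,2,3) sets(4)] crossings_Un_right[OF fin(4,2,3) sets(4)]
          crossings_Un_left[OF fin(1,2,3) sets(2)] crossings_Un_left[OF fin(1,2,4) sets(2)]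
        by simp_all
      have comm: "crossings K ?B + crossings ?B K = card K * card ?B"
        by (rule crossings_commute[OF fin(2,4) sets(5)])
      have "sign_unit F (crossings I K + crossings K B) =
          sign_unit F (?n + (crossings I ?B + crossings (I \<union> ?B) (K \<union> B)))"
        unfolding sets(1) cK comm[symmetric] cr by (intro sign_unit_cong) (simp, argo)
      then show ?thesis unfolding L R by simp
    qed
  qed
qed

text \<open>Signs have valuation zero and the involution fixes valuations, so the dual vector at
  \<open>J\<close> has the valuation of \<open>P\<close> at \<open>E - J\<close>. The two minimality
  conditions therefore range over complementary sets with the same values.\<close>

lemma dual_initial_vector:
  fixes u :: "'e::linorder \<Rightarrow> 'g::linordered_ab_group_add"
  assumes E: "finite E" and nz: "nonzero_function (trop F) E r P"
    and nzd: "nonzero_function (trop F) E (card E - r) (dual_vector (trop F) E P)"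
  shows "dual_vector F E (initial_vector E r u P) =
    initial_vector E (card E - r) (\<lambda>i. - u i) (dual_vector (trop F) E P)"
proof
  fix I
  interpret T: tract "trop F :: ('a \<times> 'g) tract_struct" by (rule trop_tract)
  let ?Q = "initial_vector E r u P" and ?R = "dual_vector (trop F) E P"
  let ?v = "\<lambda>i. - u i"
  have cl: "P I \<in> ocarrier (trop F)" for I by (rule nonzero_functionD[OF nz])
  have Qcl: "?Q J \<in> ocarrier F" for J
  proof (cases "?Q J")
    case (Some a)
    then obtain g where "P J = Some (a, g)" unfolding initial_vector_eq_Some_iff[OF nz] by blast
    then show ?thesis using cl[of J] Some by simp
  qed simp
  have R: "?R J = (if J \<subseteq> E then map_option (\<lambda>(a, g). (the (sign_unit F (crossings J (E - J))) \<otimes> involution F a, g))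
      (P (E - J)) else None)" for J
    unfolding T.dual_vector_eq[OF E cl] sign_unit_trop
    by (cases "P (E - J)") (auto simp: sign_unit_def)
  show "dual_vector F E ?Q I = initial_vector E (card E - r) ?v ?R I"
  proof (cases "I \<subseteq> E \<and> P (E - I) \<noteq> None")
    case False
    then have "?R I = None" unfolding dual_vector_eq_None_iff by blast
    then have "initial_vector E (card E - r) ?v ?R I = None"
      using initial_vector_eq_Some_iff[OF nzd, of ?v I]
      by (cases "initial_vector E (card E - r) ?v ?R I") auto
    moreover have "?Q (E - I) = None" if "P (E - I) = None"
      using that initial_vector_eq_Some_iff[OF nz, of u "E - I"] by (cases "?Q (E - I)") auto
    then have "dual_vector F E ?Q I = None" using False unfolding dual_vector_eq_None_iff by metis
    ultimately show ?thesis by simp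
  next
    case True
    then obtain a g where Pa: "P (E - I) = Some (a, g)" by auto
    define b where "b = the (sign_unit F (crossings I (E - I))) \<otimes> involution F a"
    have Rb: "?R I = Some (b, g)" using R True Pa by (simp add: b_def)
    have neg: "sum ?v J = sum u (E - J) - sum u E" if "J \<subseteq> E" for J
      using sum.subset_diff[OF that E, of u] by (simp add: sum_negf algebra_simps)
    have cond: "(\<forall>J c h. ?R J = Some (c, h) \<longrightarrow> g - sum ?v I \<le> h - sum ?v J) \<longleftrightarrow>
        (\<forall>J c h. P J = Some (c, h) \<longrightarrow> g - sum u (E - I) \<le> h - sum u J)" (is "?l \<longleftrightarrow> ?r")
    proof
      assume l: ?l
      show ?r
      proof (intro allI impI)
        fix J c h assume J: "P J = Some (c, h)"
        then have JE: "J \<subseteq> E" "E - (E - J) = J" using nonzero_functionD(2)[OF nz, of J] by auto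
        then have "?R (E - J) = Some (the (sign_unit F (crossings (E - J) J)) \<otimes> involution F c, h)"
          using R[of "E - J"] J by simp
        then have "g - sum ?v I \<le> h - sum ?v (E - J)" using l by blast
        then show "g - sum u (E - I) \<le> h - sum u J"
          using neg[of I] neg[of "E - J"] True JE(2) by (simp add: algebra_simps)
      qed
    next
      assume r: ?r
      show ?l
      proof (intro allI impI)
        fix J c h assume J: "?R J = Some (c, h)"
        then have JE: "J \<subseteq> E" using R[of J] by (auto split: if_splits)
        obtain c' where "P (E - J) = Some (c', h)" using J R[of J] JE by auto
        then have "g - sum u (E - I) \<le> h - sum u (E - J)" using r by blast
        moreover have "I \<subseteq> E" using True by blast
        ultimately show "g - sum ?v I \<le> h - sum ?v J"
          unfolding neg[OF JE] neg[OF \<open>I \<subseteq> E\<close>] by (simp add: algebra_simps)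
      qed
    qed
    have "dual_vector F E ?Q I = (if ?r then Some b else None)"
    proof (cases ?r)
      case True
      then have Qa: "?Q (E - I) = Some a"
        using initial_vector_eq_Some_iff[OF nz, of u "E - I" a] Pa by blast
      then have "a \<in> carrier F" using Qcl[of "E - I"] by simp
      then have "dual_vector F E ?Q I = sign_unit F (crossings I (E - I)) \<odot> Some (involution F a)"
        using dual_vector_eq[of E ?Q I] E Qa \<open>I \<subseteq> E \<and> P (E - I) \<noteq> None\<close> by simp
      also have "\<dots> = Some b" by (simp add: b_def sign_unit_def)
      finally show ?thesis using True by simp
    next
      case False
      then have "?Q (E - I) = None"
        using initial_vector_eq_Some_iff[OF nz, of u "E - I"] Pa by (cases "?Q (E - I)") auto
      then have "dual_vector F E ?Q I = None" by (simp add: dual_vector_eq_None_iff)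
      then show ?thesis using False by (simp only: if_False)
    qed
    also have "\<dots> = initial_vector E (card E - r) ?v ?R I"
    proof (cases ?r)
      case True
      then have "initial_vector E (card E - r) ?v ?R I = Some b"
        using initial_vector_eq_Some_iff[OF nzd, of ?v I b] Rb cond by blast
      then show ?thesis using True by simp
    next
      case False
      then have "\<not> ?l" using cond by blast
      then have "initial_vector E (card E - r) ?v ?R I = None"
        using initial_vector_eq_Some_iff[OF nzd, of ?v I] Rb
        by (cases "initial_vector E (card E - r) ?v ?R I") auto
      then show ?thesis using False by (simp only: if_False)
    qed
    finally show ?thesis .
  qed
qed

lemma dual_initial_matroid_of:
  fixes u :: "'e::linorder \<Rightarrow> 'g::linordered_ab_group_add"
  assumes E: "finite E" and P: "plucker k (trop F) E r P"
  shows "dual F (initial (matroid_of (trop F) E r P) u) =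
    initial (dual (trop F) (matroid_of (trop F) E r P)) (\<lambda>i. - u i)"
proof -
  interpret T: tract "trop F :: ('a \<times> 'g) tract_struct" by (rule trop_tract)
  note nz = T.plucker_nonzero_function[OF P]
  note nzd = T.plucker_nonzero_function[OF T.dual_vector_plucker[OF E P]]
  have Q: "plucker k F E r (initial_vector E r u P)" by (rule initial_plucker[OF E nz P])
  have "dual F (initial (matroid_of (trop F) E r P) u) =
      matroid_of F E (card E - r) (dual_vector F E (initial_vector E r u P))"
    unfolding initial_matroid_of[OF nz]
    by (rule dual_matroid_of[OF E]) (rule nonzero_functionD(1)[OF plucker_nonzero_function[OF Q]])
  also have "\<dots> = initial (matroid_of (trop F) E (card E - r) (dual_vector (trop F) E P)) (\<lambda>i. - u i)"
    unfolding dual_initial_vector[OF E nz nzd] initial_matroid_of[OF nzd] ..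
  also have "matroid_of (trop F) E (card E - r) (dual_vector (trop F) E P) =
      dual (trop F) (matroid_of (trop F) E r P)"
    by (rule T.dual_matroid_of[symmetric, OF E]) (rule nonzero_functionD(1)[OF nz])
  finally show ?thesis .
qed

end

section \<open>Infinite weights: comparing the coloop and loop extensions\<close>

theorem proposition3p11:
  fixes F :: "'a tract_struct"
    and k :: kind
    and E :: "'e::linorder set"
    and M :: "('e, 'a \<times> 'g::linordered_ab_group_add) fmatroid"
  assumes "tract F"
    and "finite E"
    and "is_matroid k (trop F) M"
    and "ground M = E"
  shows "(\<forall>u :: 'e \<Rightarrow> 'g ext.
            dual F (initial_ext k F M u) =
            add_loops k F
              (initial (delete k (trop F) (dual (trop F) M) (inf_set E u)) (\<lambda>i. - fin (u i)))
              (inf_set E u)) \<and>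
         (\<forall>u :: 'e \<Rightarrow> 'g. dual F (initial M u) = initial (dual (trop F) M) (\<lambda>i. - u i))"
proof (intro conjI allI)
  interpret tract F by (rule assms(1))
  interpret T: tract "trop F :: ('a \<times> 'g) tract_struct" by (rule trop_tract)
  note E = assms(2)
  let ?r = "rank M"
  obtain P where P: "plucker k (trop F) E ?r P" and M: "M = matroid_of (trop F) E ?r P"
    using is_matroidE[OF assms(3)] assms(4) by metis
  note nz = T.plucker_nonzero_function[OF P]
  have cl: "P I \<in> ocarrier (trop F)" for I by (rule nonzero_functionD(1)[OF nz])
  interpret B: bases E "{I. P I \<noteq> None}" ?r by (rule T.plucker_bases[OF T.plucker_imp_weak[OF E P]])
  show "dual F (initial M u) = initial (dual (trop F) M) (\<lambda>i. - u i)" for u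
    by (subst (1 2) M) (rule dual_initial_matroid_of[OF E P])
  fix u :: "'e \<Rightarrow> 'g ext"
  define Z where "Z = inf_set E u"
  define v where "v = (\<lambda>i. fin (u i))"
  have Z: "Z \<subseteq> E" "finite Z" "finite (E - Z)" using E finite_subset by (auto simp: Z_def inf_set_def)
  \<comment> \<open>One basis serves both sides: its largest meet with \<open>Z\<close> computes the
    contraction, and its complement computes the deletion in the dual.\<close>
  obtain T where T: "P T \<noteq> None"
    and max: "\<And>T'. P T' \<noteq> None \<Longrightarrow> card (T' \<inter> Z) \<le> card (T \<inter> Z)"
  proof -
    define \<B> where "\<B> = {I. P I \<noteq> None}"
    obtain S where "S \<in> \<B>" using B.bases_nonempty unfolding \<B>_def by blast
    then obtain T where "T \<in> \<B>" "\<And>A. A \<in> \<B> \<Longrightarrow> card (A \<inter> Z) \<le> card (T \<inter> Z)"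
      using B.basis_maximizing[of S "\<lambda>_. True" "\<lambda>T. card (T \<inter> Z)", folded \<B>_def] by auto
    then show ?thesis using that unfolding \<B>_def by blast
  qed
  have TE: "T \<subseteq> E" "card T = ?r" "finite T" using B.basis_subset B.card_basis B.finite_basis T by auto
  let ?B = "T \<inter> Z" and ?E = "E - Z"
  define d where "d = ?r - card ?B"
  define D where "D = minor_vector (trop F) ?E ?B P"
  have D: "plucker k (trop F) ?E d D"
    unfolding d_def D_def by (rule T.minor_vector_plucker[OF E _ _ P T]) (use TE in auto)
  note nzD = T.plucker_nonzero_function[OF D]
  have Dcl: "D I \<in> ocarrier (trop F)" for I by (rule nonzero_functionD(1)[OF nzD])
  have contr: "contract k (trop F) M Z = matroid_of (trop F) ?E d D"
    unfolding d_def D_def by (subst M) (rule T.contract_matroid_of[OF E P Z(1) T max])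
  define Q where "Q = initial_vector ?E d v D"
  have Q: "plucker k F ?E d Q" unfolding Q_def by (rule initial_plucker[OF Z(3) nzD D])
  note nzQ = plucker_nonzero_function[OF Q]
  have Qcl: "Q I \<in> ocarrier F" for I by (rule nonzero_functionD(1)[OF nzQ])
  have init: "initial (matroid_of (trop F) ?E d D) v = matroid_of F ?E d Q"
    unfolding Q_def by (rule initial_matroid_of[OF nzD])
  have EZ: "?E \<inter> Z = {}" "?E \<union> Z = E" using Z(1) by auto

  have "initial_ext k F M u = add_coloops k F (matroid_of F ?E d Q) Z"
    unfolding initial_ext_def Let_def assms(4) Z_def[symmetric] v_def[symmetric] contr init ..
  also have "\<dots> = matroid_of F E (d + card Z) (coloop_vector F Z Q)"
    using add_coloops_matroid_of[OF Z(3,2) EZ(1) Q] unfolding EZ(2) .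
  finally have "dual F (initial_ext k F M u) =
      matroid_of F E (card E - (d + card Z)) (dual_vector F E (coloop_vector F Z Q))"
    using dual_matroid_of[of E "coloop_vector F Z Q", OF E coloop_vector_closed[of Q Z, OF Qcl]] by simp
  also have "\<dots> = matroid_of F E (card E - (d + card Z)) (dual_vector F ?E Q)"
    by (rule matroid_of_sign_unit[OF _ dual_vector_coloop_vector[OF E Z(1) nzQ]])
      (rule dual_vector_closed[OF Z(3) Qcl])
  finally have lhs: "dual F (initial_ext k F M u) =
      matroid_of F E (card E - (d + card Z)) (dual_vector F ?E Q)" .

  let ?P' = "dual_vector (trop F) E P"
  have P': "plucker k (trop F) E (card E - ?r) ?P'" by (rule T.dual_vector_plucker[OF E P])
  have T': "E - (E - T) = T" "(E - T) \<inter> Z = Z - ?B" using TE(1) Z(1) by auto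
  have T'_basis: "?P' (E - T) \<noteq> None" using T T'(1) by (simp add: dual_vector_eq_None_iff)
  \<comment> \<open>A dual basis and its complement together cover \<open>Z\<close>, so the largest
    meet of a basis with \<open>Z\<close> corresponds to the smallest meet of a dual basis.\<close>
  have min: "card ((E - T) \<inter> Z) \<le> card (S \<inter> Z)" if "?P' S \<noteq> None" for S
  proof -
    have S: "S \<subseteq> E" "P (E - S) \<noteq> None" using that by (auto simp: dual_vector_eq_None_iff)
    have "(E - S) \<inter> Z = Z - S \<inter> Z" using Z(1) by blast
    then have "card Z - card (S \<inter> Z) \<le> card ?B"
      using max[OF S(2)] Z(2) by (simp add: card_Diff_subset)
    moreover have "card (Z - ?B) = card Z - card ?B" using Z(2) by (simp add: card_Diff_subset)
    moreover have "card (S \<inter> Z) \<le> card Z" using Z(2) by (simp add: card_mono)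
    ultimately show ?thesis unfolding T'(2) by linarith
  qed
  have cardB: "card (Z - ?B) = card Z - card ?B" "card ?B \<le> card Z" "card ?B \<le> ?r" "?r \<le> card E"
    "card ?E = card E - card Z" "card Z \<le> card E"
    using Z TE E card_mono[of T ?B] card_mono[of E T] card_mono[of Z ?B] card_mono[of E Z]
    by (auto simp: card_Diff_subset)
  have "card (T \<union> Z) \<le> card E" using TE(1) Z(1) E by (simp add: card_mono)
  \<comment> \<open>Since \<open>T \<union> Z\<close> fits into \<open>E\<close>, the subtractions
    of natural numbers in the rank of the deletion do not truncate.\<close>
  then have rZ: "?r + card Z \<le> card E + card ?B" using card_Un_Int[OF TE(3) Z(2)] TE(2) by simp
  have "delete k (trop F) (dual (trop F) M) Z =
      delete k (trop F) (matroid_of (trop F) E (card E - ?r) ?P') Z"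
    by (subst M) (simp only: T.dual_matroid_of[of E P, OF E cl])
  also have "\<dots> = matroid_of (trop F) ?E (card E - ?r - card (Z - ?B))
      (minor_vector (trop F) ?E (Z - ?B) ?P')"
    using T.delete_matroid_of[OF E P' Z(1) T'_basis min] unfolding T'(2) .
  \<comment> \<open>The vectors of the deletion and of the dual of the contraction differ by a
    global sign, which the scaling class absorbs.\<close>
  also have "\<dots> = matroid_of (trop F) ?E (card E - ?r - card (Z - ?B)) (dual_vector (trop F) ?E D)"
  proof -
    obtain n where "\<And>I. dual_vector (trop F) ?E D I =
        sign_unit (trop F) n \<odot>\<^bsub>trop F\<^esub> minor_vector (trop F) ?E (Z - ?B) ?P' I"
      unfolding D_def using T.dual_vector_minor_vector[OF E Z(1) _ nz, of ?B] by blast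
    then show ?thesis
      by (intro T.matroid_of_sign_unit[symmetric] T.minor_vector_closed T.dual_vector_closed E cl)
  qed
  also have "card E - ?r - card (Z - ?B) = card ?E - d"
    using cardB rZ unfolding d_def by linarith
  also have "matroid_of (trop F) ?E (card ?E - d) (dual_vector (trop F) ?E D) =
      dual (trop F) (matroid_of (trop F) ?E d D)"
    by (rule T.dual_matroid_of[of ?E D, OF Z(3) Dcl, symmetric])
  finally have "initial (delete k (trop F) (dual (trop F) M) Z) (\<lambda>i. - v i) =
      dual F (initial (matroid_of (trop F) ?E d D) v)"
    by (simp only: dual_initial_matroid_of[OF Z(3) D])
  also have "\<dots> = matroid_of F ?E (card ?E - d) (dual_vector F ?E Q)"
    unfolding init by (rule dual_matroid_of[of ?E Q, OF Z(3) Qcl])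
  finally have "add_loops k F (initial (delete k (trop F) (dual (trop F) M) Z) (\<lambda>i. - v i)) Z =
      matroid_of F E (card ?E - d) (dual_vector F ?E Q)"
    using add_loops_matroid_of(2)[OF Z(3,2) EZ(1) dual_vector_plucker[OF Z(3) Q]]
    unfolding EZ(2) by simp
  moreover have "card ?E - d = card E - (d + card Z)" using cardB(5) by simp
  ultimately show "dual F (initial_ext k F M u) =
      add_loops k F
        (initial (delete k (trop F) (dual (trop F) M) (inf_set E u)) (\<lambda>i. - fin (u i))) (inf_set E u)"
    unfolding lhs Z_def[symmetric] v_def by simp
qed

end
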